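(* Let $k\ge 2$, $n\ge 1$, and let $\delta\in\mathbf{C}$ be a root of $(\delta^{n+k}-1)(\delta^2-1)-\delta(\delta^{k+1}-1)(\delta^{n-1}-1)$ that is not a root of unity. Then there exists a basic cremona map $F=S\circ J\circ T^{-1}:\mathbf{P}^k\dashrightarrow\mathbf{P}^k$ properly fixing $C$, with multiplier of $F|_C$ equal to $\delta$, such that (a) $S(\mathbf{e}_j)=T(\mathbf{e}_{j+1})$ for $j=0,1,\dots,k-1$; (b) $F^{n-1}(S(\mathbf{e}_k))=T(\mathbf{e}_0)$; (c) $F^{j}(S(\mathbf{e}_k))\notin I(F)$ for $0\le j<n-1$. Up to linear conjugacy, $F$ is uniquely specified by the further conditions $$T(\mathbf{e}_j)=\gamma\left(\delta^j\,\frac{k+1}{k-1}\cdot\frac{\delta^2-1}{\delta(\delta^{k+1}-1)}-\frac{2}{k-1}\right),\qquad 0\le j\le k.$$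
   Context: $\mathbf{P}^k$ is complex projective space with homogeneous coordinates $[x_0:\dots:x_k]$, and $\mathbf{e}_j\in\mathbf{P}^k$ is the point whose only nonzero coordinate is the $j$-th. $C\subset\mathbf{P}^k$ is the curve of degree $k+1$ parametrized by $\gamma:\mathbf{C}\cup\{\infty\}\to\mathbf{P}^k$, $\gamma(t)=[1:t:\dots:t^{k-1}:t^{k+1}]$, $\gamma(\infty)=[0:\dots:0:1]$; its only singular point is the cusp $\gamma(\infty)$ and $C_{reg}=\gamma(\mathbf{C})$. $J:\mathbf{P}^k\dashrightarrow\mathbf{P}^k$ is the birational involution $J[x_0:\dots:x_k]=[1/x_0:\dots:1/x_k]$. A basic cremona map is a birational map of the form $F=S\circ J\circ T^{-1}$ with $S,T\in\mathrm{Aut}(\mathbf{P}^k)$. $I(F)$ is the indeterminacy set of $F$. $F$ is centered on $C$ if $T(\mathbf{e}_j)\in C_{reg}$ for all $0\le j\le k$, and $F$ properly fixes $C$ if it is centered on $C$ and $F(C)=C$ (proper transform). In that case $F|_C$ has the form $\gamma(t)\mapsto\gamma(\delta t+\tau)$ with $\delta\in\mathbf{C}^*$, $\tau\in\mathbf{C}$, and $\delta$ is called the multiplier of $F|_C$. Linear conjugacy means conjugation by an element of $\mathrm{Aut}(\mathbf{P}^k)$. *)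

theory Defs
  imports Complex_Main "HOL-Library.FuncSet" "Jordan_Normal_Form.Matrix"
begin

section \<open>Complex projective space\<close>

text \<open>
  The dimension \<open>k\<close> is an arbitrary natural number, so \<open>P\<^sup>k\<close> is a carrier set: a point is the set of
  all its homogeneous coordinate vectors in \<open>C\<^sup>k\<^sup>+\<^sup>1\<close>, indexed by \<open>0, \<dots>, k\<close>.
\<close>

type_synonym ppoint = "complex vec set"

definition pclass :: "complex vec \<Rightarrow> ppoint" where
  "pclass v = {c \<cdot>\<^sub>v v | c. c \<noteq> 0}"

definition proj_space :: "nat \<Rightarrow> ppoint set" where
  "proj_space k = pclass ` (carrier_vec (k + 1) - {0\<^sub>v (k + 1)})"

definition coord_point :: "nat \<Rightarrow> nat \<Rightarrow> ppoint" where
  "coord_point k j = pclass (unit_vec (k + 1) j)"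

definition proj_aut :: "nat \<Rightarrow> (ppoint \<Rightarrow> ppoint) set" where
  "proj_aut k = {\<lambda>p. (\<lambda>v. A *\<^sub>v v) ` p | A. A \<in> carrier_mat (k + 1) (k + 1) \<and> invertible_mat A}"

section \<open>Homogeneous polynomials and rational maps\<close>

text \<open>
  Polynomials in \<open>x\<^sub>0, \<dots>, x\<^sub>k\<close> are given by the functions they induce, which over the complex numbers
  loses no information.
\<close>

definition homogeneous_poly :: "nat \<Rightarrow> nat \<Rightarrow> (complex vec \<Rightarrow> complex) \<Rightarrow> bool" where
  "homogeneous_poly k d f \<longleftrightarrow>
     (\<exists>c :: (nat \<Rightarrow> nat) \<Rightarrow> complex. \<forall>v \<in> carrier_vec (k + 1).
        f v = (\<Sum>\<alpha> \<in> {\<alpha> \<in> {..k} \<rightarrow>\<^sub>E {..d}. sum \<alpha> {..k} = d}. c \<alpha> * (\<Prod>i\<le>k. (v $ i) ^ \<alpha> i)))"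

definition zariski_closure :: "nat \<Rightarrow> ppoint set \<Rightarrow> ppoint set" where
  "zariski_closure k X =
     {p \<in> proj_space k. \<forall>d f. homogeneous_poly k d f \<and> (\<forall>q \<in> X. \<forall>v \<in> q. f v = 0)
        \<longrightarrow> (\<forall>v \<in> p. f v = 0)}"

text \<open>
  A rational map is a partial function on its full domain of regularity. It is specified by its
  values on some Zariski dense open set: \<open>regular_value k f p q\<close> says that some tuple
  \<open>[P\<^sub>0 : \<dots> : P\<^sub>k]\<close> of homogeneous polynomials of equal degree agrees with the partial function \<open>f\<close>
  wherever both are defined, is defined at \<open>p\<close>, and has value \<open>q\<close> there. If the domain of \<open>f\<close> is dense
  then \<open>q\<close> is determined by \<open>p\<close>, and \<open>rational_map k f\<close> is the maximal regular extension of \<open>f\<close>.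
\<close>

definition regular_value :: "nat \<Rightarrow> (ppoint \<rightharpoonup> ppoint) \<Rightarrow> ppoint \<Rightarrow> ppoint \<Rightarrow> bool" where
  "regular_value k f p q \<longleftrightarrow>
     (\<exists>d P. let \<Phi> = (\<lambda>v. vec (k + 1) (\<lambda>i. P i v)) in
        (\<forall>i\<le>k. homogeneous_poly k d (P i)) \<and>
        (\<forall>v \<in> carrier_vec (k + 1) - {0\<^sub>v (k + 1)}.
           pclass v \<in> dom f \<and> \<Phi> v \<noteq> 0\<^sub>v (k + 1) \<longrightarrow> f (pclass v) = Some (pclass (\<Phi> v))) \<and>
        (\<exists>v \<in> carrier_vec (k + 1) - {0\<^sub>v (k + 1)}.
           p = pclass v \<and> \<Phi> v \<noteq> 0\<^sub>v (k + 1) \<and> q = pclass (\<Phi> v)))"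

definition rational_map :: "nat \<Rightarrow> (ppoint \<rightharpoonup> ppoint) \<Rightarrow> (ppoint \<rightharpoonup> ppoint)" where
  "rational_map k f p =
     (if \<exists>q. regular_value k f p q then Some (THE q. regular_value k f p q) else None)"

definition indeterminacy :: "nat \<Rightarrow> (ppoint \<rightharpoonup> ppoint) \<Rightarrow> ppoint set" where
  "indeterminacy k F = proj_space k - dom F"

definition proper_transform :: "nat \<Rightarrow> (ppoint \<rightharpoonup> ppoint) \<Rightarrow> ppoint set \<Rightarrow> ppoint set" where
  "proper_transform k F V = zariski_closure k {q. \<exists>p \<in> V - indeterminacy k F. F p = Some q}"

text \<open>The orbit of a point, which stops being defined once it has met the indeterminacy set.\<close>

definition orbit_point :: "(ppoint \<rightharpoonup> ppoint) \<Rightarrow> nat \<Rightarrow> ppoint \<Rightarrow> ppoint option" where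
  "orbit_point F m p = ((\<lambda>q. Option.bind q F) ^^ m) (Some p)"

definition linearly_conjugate :: "nat \<Rightarrow> (ppoint \<rightharpoonup> ppoint) \<Rightarrow> (ppoint \<rightharpoonup> ppoint) \<Rightarrow> bool" where
  "linearly_conjugate k F G \<longleftrightarrow>
     (\<exists>L \<in> proj_aut k. \<forall>p \<in> proj_space k. G (L p) = map_option L (F p))"

section \<open>Basic cremona maps\<close>

definition torus :: "nat \<Rightarrow> ppoint set" where
  "torus k = pclass ` {v \<in> carrier_vec (k + 1). \<forall>i\<le>k. v $ i \<noteq> 0}"

text \<open>
  The formula \<open>[1/x\<^sub>0 : \<dots> : 1/x\<^sub>k]\<close> for \<open>J\<close>; since \<open>inverse 0 = 0\<close> in HOL, it is only to be used on
  \<^const>\<open>torus\<close>.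
\<close>

definition J_torus :: "ppoint \<Rightarrow> ppoint" where
  "J_torus p = map_vec inverse ` p"

text \<open>The rational map \<open>S \<circ> J \<circ> T\<^sup>-\<^sup>1\<close>.\<close>

definition basic_cremona :: "nat \<Rightarrow> (ppoint \<Rightarrow> ppoint) \<Rightarrow> (ppoint \<Rightarrow> ppoint) \<Rightarrow> (ppoint \<rightharpoonup> ppoint)" where
  "basic_cremona k S T =
     rational_map k (\<lambda>p. if p \<in> T ` torus k
                         then Some (S (J_torus (inv_into (proj_space k) T p))) else None)"

section \<open>The cuspidal curve\<close>

definition \<gamma> :: "nat \<Rightarrow> complex \<Rightarrow> ppoint" where
  "\<gamma> k t = pclass (vec (k + 1) (\<lambda>i. if i < k then t ^ i else t ^ (k + 1)))"

definition \<gamma>_infinity :: "nat \<Rightarrow> ppoint" where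
  "\<gamma>_infinity k = coord_point k k"

definition curve_reg :: "nat \<Rightarrow> ppoint set" where
  "curve_reg k = range (\<gamma> k)"

definition curve :: "nat \<Rightarrow> ppoint set" where
  "curve k = insert (\<gamma>_infinity k) (curve_reg k)"

definition centered_on_curve :: "nat \<Rightarrow> (ppoint \<Rightarrow> ppoint) \<Rightarrow> bool" where
  "centered_on_curve k T \<longleftrightarrow> (\<forall>j\<le>k. T (coord_point k j) \<in> curve_reg k)"

definition properly_fixes_curve :: "nat \<Rightarrow> (ppoint \<Rightarrow> ppoint) \<Rightarrow> (ppoint \<Rightarrow> ppoint) \<Rightarrow> bool" where
  "properly_fixes_curve k S T \<longleftrightarrow>
     centered_on_curve k T \<and> proper_transform k (basic_cremona k S T) (curve k) = curve k"

text \<open>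
  The restriction of \<open>F\<close> to the curve is \<open>\<gamma>(t) \<mapsto> \<gamma>(\<delta>t + \<tau>)\<close>; as \<open>F\<close> itself is undefined on its
  indeterminacy set, the formula is imposed on the other points.
\<close>

definition has_multiplier :: "nat \<Rightarrow> (ppoint \<rightharpoonup> ppoint) \<Rightarrow> complex \<Rightarrow> bool" where
  "has_multiplier k F \<delta> \<longleftrightarrow>
     \<delta> \<noteq> 0 \<and> (\<exists>\<tau>. \<forall>t. \<gamma> k t \<notin> indeterminacy k F \<longrightarrow> F (\<gamma> k t) = Some (\<gamma> k (\<delta> * t + \<tau>)))"

text \<open>
  The cremona maps of the theorem: \<open>S, T \<in> Aut(P\<^sup>k)\<close>, the map \<open>F = S \<circ> J \<circ> T\<^sup>-\<^sup>1\<close> properly fixes the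
  curve with multiplier \<open>\<delta>\<close>, and the last three conjuncts are (a), (b), (c).
\<close>

definition realizes :: "nat \<Rightarrow> nat \<Rightarrow> complex \<Rightarrow> (ppoint \<Rightarrow> ppoint) \<Rightarrow> (ppoint \<Rightarrow> ppoint) \<Rightarrow> bool" where
  "realizes k n \<delta> S T \<longleftrightarrow> (let F = basic_cremona k S T in
     S \<in> proj_aut k \<and> T \<in> proj_aut k \<and>
     properly_fixes_curve k S T \<and> has_multiplier k F \<delta> \<and>
     (\<forall>j<k. S (coord_point k j) = T (coord_point k (j + 1))) \<and>
     orbit_point F (n - 1) (S (coord_point k k)) = Some (T (coord_point k 0)) \<and>
     (\<forall>j<n - 1. \<exists>q. orbit_point F j (S (coord_point k k)) = Some q \<and> q \<notin> indeterminacy k F))"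

text \<open>The explicit centers prescribed in the theorem.\<close>

definition normalized_centers :: "nat \<Rightarrow> complex \<Rightarrow> (ppoint \<Rightarrow> ppoint) \<Rightarrow> bool" where
  "normalized_centers k \<delta> T \<longleftrightarrow>
     (\<forall>j\<le>k. T (coord_point k j) =
        \<gamma> k (\<delta> ^ j * (of_nat (k + 1) / of_nat (k - 1)) * ((\<delta>\<^sup>2 - 1) / (\<delta> * (\<delta> ^ (k + 1) - 1)))
             - 2 / of_nat (k - 1)))"

end

theory Submission
  imports Defs "Jordan_Normal_Form.Determinant"
    "HOL-Computational_Algebra.Fundamental_Theorem_Algebra"
    "HOL-Computational_Algebra.Polynomial_Factorial"
begin

text \<open>
  Put \<open>P = p\<^sub>0 + \<dots> + p\<^sub>k\<close> for the parameters \<open>p\<^sub>j\<close> of the centers. A hyperplane section of the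
  cuspidal curve has parameters summing to zero, so the hyperplane through the centers other than the
  \<open>j\<close>-th meets the curve again at \<open>p\<^sub>j - P\<close>. Writing \<open>\<gamma>(t)\<close> in the basis of the centers by Lagrange
  interpolation, the cremona map becomes explicit on the curve. This shows that a map with multiplier
  \<open>\<delta>\<close> and centers \<open>\<gamma>(p\<^sub>j)\<close> exists and is unique, that its translation part is \<open>\<delta>(k - 1)P/(k + 1)\<close>, and
  that it contracts these hyperplanes to the points with parameters
  \<open>q\<^sub>j = \<delta>p\<^sub>j - 2\<delta>P/(k + 1)\<close>. Condition (a) is therefore the recursion \<open>q\<^sub>j = p\<^sub>j\<^sub>+\<^sub>1\<close>, which determines the
  \<open>p\<^sub>j\<close> up to a common factor, and (b) is the equation for \<open>\<delta>\<close>.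

  If (c) failed, \<open>\<delta>\<close> would satisfy a second equation besides the one coming from (b). The latter is
  reciprocal and, because it says that \<open>(1 + y)/(1 - y)\<close> equals the sum of \<open>(1 + y\<^sup>m)/(1 - y\<^sup>m)\<close> over
  three exponents \<open>m\<close>, has by the Schwarz--Pick principle at most one root in the unit disc. Since \<open>\<delta>\<close> is
  an algebraic unit, it follows that the inverse of \<open>\<delta>\<close> is a Galois conjugate of \<open>\<delta>\<close>. But two
  mutually inverse numbers that both solve the second equation are roots of unity.
\<close>

section \<open>Equations for the multiplier\<close>

text \<open>The delicate condition is (c): nothing in the construction keeps the orbit away from the
  other centers, and an early hit is excluded by arithmetic only. On the unit circle this is
  elementary, since there the inverse of \<delta> is its complex conjugate. Off the circle one has
  to know where the other conjugates lie, and the bound on the roots in the disc supplies this,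
  because the product of all conjugates of a unit has modulus 1. A second obstacle is that a
  rational map is a maximal regular extension. Indeterminacy at the centers is therefore a statement
  about all tuples of polynomials representing the map, of any degree and with any common factor. It
  is settled once, in \<open>regular_value_unique\<close>; afterwards the map is the formula of
  \<open>F_value\<close>. The constants in the prescribed centers reflect a choice of the free
  common factor: it makes 1 the fixed point of the map on the curve, whose translation part is then
  \<open>1 - \<delta>\<close>.\<close>

text \<open>For the normalized centers \<open>hitting_eq k r j \<delta>\<close> says that \<open>r\<close> iterations of the map on the curve take
  \<open>p\<^sub>j\<close> to \<open>p\<^sub>0\<close>. The equation for \<open>\<delta>\<close> in the theorem is the case \<open>r = n - 1\<close>, \<open>j = k + 1\<close>.\<close>

definition hitting_eq :: "nat \<Rightarrow> nat \<Rightarrow> nat \<Rightarrow> complex \<Rightarrow> bool" where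
  "hitting_eq k r j x \<longleftrightarrow> (x ^ (r + j) - 1) * (x\<^sup>2 - 1) = x * (x ^ (k + 1) - 1) * (x ^ r - 1)"

lemma hitting_eq_nonzero:
  assumes "hitting_eq k r j x" and "0 < r"
  shows "x \<noteq> 0"
  using assms by (auto simp: hitting_eq_def power_0_left)

text \<open>The single power \<open>c\<close> clears the denominators of both sides at
  \<open>inverse x\<close>. The same two products survive, with surplus factors
  \<open>x ^ (k + 1)\<close> and \<open>x ^ j\<close>. As powers these agree only for
  \<open>j = k + 1\<close>, which is why the equation from (b) is reciprocal and the others are
  not.\<close>

lemma hitting_eq_inverse:
  assumes x: "x \<noteq> 0"
  shows "hitting_eq k r j (inverse x) \<longleftrightarrow>
    x ^ (k + 1) * ((x ^ (r + j) - 1) * (x\<^sup>2 - 1)) = x ^ j * (x * (x ^ (k + 1) - 1) * (x ^ r - 1))"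
proof -
  define c where "c = x ^ (r + j) * x\<^sup>2 * x ^ (k + 1)"
  have c: "c \<noteq> 0" using x by (simp add: c_def)
  have l: "c * ((inverse x ^ (r + j) - 1) * ((inverse x)\<^sup>2 - 1)) =
        x ^ (k + 1) * ((x ^ (r + j) - 1) * (x\<^sup>2 - 1))"
  proof -
    have "x ^ (r + j) * inverse x ^ (r + j) = 1" "x\<^sup>2 * (inverse x)\<^sup>2 = 1"
      using x by (simp_all add: power_inverse)
    hence "x ^ (r + j) * (inverse x ^ (r + j) - 1) = 1 - x ^ (r + j)"
          "x\<^sup>2 * ((inverse x)\<^sup>2 - 1) = 1 - x\<^sup>2" by (simp_all add: right_diff_distrib)
    moreover have "c * ((inverse x ^ (r + j) - 1) * ((inverse x)\<^sup>2 - 1)) =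
      x ^ (k+1) * ((x ^ (r + j) * (inverse x ^ (r + j) - 1)) * (x\<^sup>2 * ((inverse x)\<^sup>2 - 1)))"
      unfolding c_def by (simp only: ac_simps)
    ultimately show ?thesis by (simp add: algebra_simps)
  qed
  have r: "c * (inverse x * (inverse x ^ (k + 1) - 1) * (inverse x ^ r - 1)) =
        x ^ j * (x * (x ^ (k + 1) - 1) * (x ^ r - 1))"
  proof -
    have "x ^ (k + 1) * inverse x ^ (k + 1) = 1" "x ^ r * inverse x ^ r = 1"
      using x by (simp_all add: power_inverse del: power_Suc)
    hence "x ^ (k + 1) * (inverse x ^ (k + 1) - 1) = 1 - x ^ (k + 1)"
          "x ^ r * (inverse x ^ r - 1) = 1 - x ^ r"
      by (simp_all add: right_diff_distrib del: power_Suc)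
    moreover have "x\<^sup>2 * inverse x = x" using x by (simp add: power2_eq_square)
    moreover have "c * (inverse x * (inverse x ^ (k + 1) - 1) * (inverse x ^ r - 1)) =
       x ^ j * ((x\<^sup>2 * inverse x) * (x ^ (k + 1) * (inverse x ^ (k + 1) - 1)) * (x ^ r * (inverse x ^ r - 1)))"
      unfolding c_def power_add[of x r j] by (simp only: ac_simps)
    ultimately show ?thesis by (simp add: algebra_simps)
  qed
  show ?thesis
    unfolding hitting_eq_def l[symmetric] r[symmetric] using c by simp
qed

lemma hitting_eq_reciprocal:
  assumes "x \<noteq> 0" "hitting_eq k r (k + 1) x"
  shows "hitting_eq k r (k + 1) (inverse x)"
  using assms(2) unfolding hitting_eq_inverse[OF assms(1)] by (simp add: hitting_eq_def)

text \<open>Comparing the two equations and cancelling their nonzero common side \<open>L\<close>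
  leaves \<open>x ^ (k + 1) = x ^ j\<close>, where the exponents differ.\<close>

lemma hitting_eq_not_reciprocal:
  assumes "0 < r" "j \<le> k" "hitting_eq k r j x" "hitting_eq k r j (inverse x)"
  shows "\<exists>m>0. x ^ m = 1"
proof (rule ccontr)
  assume no: "\<not> ?thesis"
  have x: "x \<noteq> 0" using hitting_eq_nonzero assms by blast
  define L where "L = (x ^ (r + j) - 1) * (x\<^sup>2 - 1)"
  have "x ^ (r + j) \<noteq> 1" "x\<^sup>2 \<noteq> 1" using no assms(1) by (metis add_gr_0, metis zero_less_numeral)
  hence L: "L \<noteq> 0" by (simp add: L_def)
  have "x ^ (k + 1) * L = x ^ j * L"
    using assms(3,4) unfolding hitting_eq_inverse[OF x] by (simp add: hitting_eq_def L_def)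
  hence "x ^ (k + 1) = x ^ j" using L by simp
  moreover have "x ^ (k + 1) = x ^ j * x ^ (k + 1 - j)" using assms(2) by (simp flip: power_add)
  ultimately have "x ^ (k + 1 - j) = 1" using x by simp
  thus False using no assms(2) by (metis add.commute less_Suc_eq_le plus_1_eq_Suc zero_less_diff)
qed

lemma hitting_eq_cnj: "hitting_eq k r j x \<Longrightarrow> hitting_eq k r j (cnj x)"
  unfolding hitting_eq_def by (drule arg_cong[where f = cnj]) simp

section \<open>Schwarz--Pick and the roots in the unit disc\<close>

lemma Cauchy_Schwarz_equality:
  fixes F G :: "'i \<Rightarrow> complex"
  assumes fin: "finite I"
    and FF: "(\<Sum>i\<in>I. F i * cnj (F i)) = u * cnj u"
    and GG: "(\<Sum>i\<in>I. G i * cnj (G i)) = v * cnj v"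
    and FG: "(\<Sum>i\<in>I. F i * cnj (G i)) = u * cnj v"
    and i: "i \<in> I"
  shows "F i * v = G i * u"
proof -
  have GF: "(\<Sum>i\<in>I. G i * cnj (F i)) = v * cnj u"
    using arg_cong[OF FG, of cnj] by (simp add: mult.commute)
  \<comment> \<open>The hypotheses say that \<open>F\<close> and \<open>G\<close> have the same Gram
    matrix as the scalars \<open>u\<close> and \<open>v\<close>, so it has rank one. This sum of
    squares is a combination of its entries that cancels.\<close>
  have "complex_of_real (\<Sum>i\<in>I. (cmod (F i * v - G i * u))\<^sup>2) =
        (\<Sum>i\<in>I. (F i * v - G i * u) * cnj (F i * v - G i * u))"
    by (simp only: of_real_sum complex_norm_square)
  also have "\<dots> = (\<Sum>i\<in>I. (v * cnj v) * (F i * cnj (F i)) + (u * cnj u) * (G i * cnj (G i))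
        - (v * cnj u) * (F i * cnj (G i)) - (u * cnj v) * (G i * cnj (F i)))"
    by (intro sum.cong refl) (simp add: algebra_simps)
  also have "\<dots> = 0"
    unfolding sum_subtractf sum.distrib sum_distrib_left[symmetric] FF GG FG GF
    by (simp add: algebra_simps)
  finally have "(\<Sum>i\<in>I. (cmod (F i * v - G i * u))\<^sup>2) = 0" using of_real_eq_0_iff by blast
  hence "(cmod (F i * v - G i * u))\<^sup>2 = 0"
    using fin i by (subst (asm) sum_nonneg_eq_0_iff) auto
  thus ?thesis by simp
qed

lemma power_neq_one_in_disc:
  fixes y :: complex
  assumes "cmod y < 1" "0 < m"
  shows "1 - y ^ m \<noteq> 0"
proof
  assume "1 - y ^ m = 0"
  hence "cmod y ^ m = 1" by (metis eq_iff_diff_eq_0 norm_one norm_power)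
  thus False using assms power_less_one_iff[of "cmod y" m] by simp
qed

text \<open>The function (1 + y^m) / (1 - y^m) has positive real part on the unit disc; its Herglotz kernel is
  a sum of m squares.\<close>

lemma herglotz_kernel:
  fixes y z :: complex
  assumes "cmod y < 1" "cmod z < 1" "0 < m"
  shows "2 * (1 - y * cnj z) * (\<Sum>i<m. (y ^ i / (1 - y ^ m)) * cnj (z ^ i / (1 - z ^ m))) =
         (1 + y ^ m) / (1 - y ^ m) + cnj ((1 + z ^ m) / (1 - z ^ m))"
proof -
  define A where "A = 1 - y ^ m"
  define B where "B = 1 - cnj z ^ m"
  have A: "A \<noteq> 0" unfolding A_def using power_neq_one_in_disc assms by blast
  have B: "B \<noteq> 0" unfolding B_def using power_neq_one_in_disc[of "cnj z" m] assms by simp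
  have "(\<Sum>i<m. (y ^ i / (1 - y ^ m)) * cnj (z ^ i / (1 - z ^ m))) =
        (\<Sum>i<m. (y * cnj z) ^ i) / (A * B)"
    by (simp add: sum_divide_distrib A_def B_def power_mult_distrib)
  moreover have "(1 - y * cnj z) * (\<Sum>i<m. (y * cnj z) ^ i) = 1 - (y * cnj z) ^ m"
    by (rule one_diff_power_eq[symmetric])
  ultimately have "2 * (1 - y * cnj z) * (\<Sum>i<m. (y ^ i / (1 - y ^ m)) * cnj (z ^ i / (1 - z ^ m)))
      = 2 * (1 - (y * cnj z) ^ m) / (A * B)"
    by (metis (no_types, lifting) mult.assoc times_divide_eq_right)
  also have "\<dots> = (1 + y ^ m) / A + (1 + cnj z ^ m) / B"
    using A B by (simp add: field_simps power_mult_distrib) (simp add: A_def B_def algebra_simps)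
  finally show ?thesis by (simp add: A_def B_def)
qed

text \<open>The terms with exponents 1 and 2 differ by \<open>2 * y / (1 - y\<^sup>2)\<close>, and
  those with exponents \<open>a\<close> and \<open>b\<close> add up to
  \<open>2 * (1 - y ^ (a + b)) / ((1 - y ^ a) * (1 - y ^ b))\<close>. The hypothesis equates the
  two. In this form \<open>herglotz_kernel\<close> applies to every term.\<close>

lemma star_equation:
  fixes y :: complex
  assumes "cmod y < 1" "0 < a" "0 < b"
    and eq: "(y ^ (a + b) - 1) * (y\<^sup>2 - 1) = y * (y ^ a - 1) * (y ^ b - 1)"
  shows "(1 + y) / (1 - y) =
    (1 + y\<^sup>2) / (1 - y\<^sup>2) + (1 + y ^ a) / (1 - y ^ a) + (1 + y ^ b) / (1 - y ^ b)"
proof -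
  define A where "A = 1 - y ^ a"
  define B where "B = 1 - y ^ b"
  have nz: "A \<noteq> 0" "B \<noteq> 0" "1 - y \<noteq> 0" "1 - y\<^sup>2 \<noteq> 0" "1 + y \<noteq> 0"
    using power_neq_one_in_disc[OF assms(1)] assms(2,3)
      power_neq_one_in_disc[OF assms(1), of 1] power_neq_one_in_disc[OF assms(1), of 2]
    by (auto simp: A_def B_def power2_eq_square algebra_simps add_eq_0_iff)
  have ya: "y ^ a = 1 - A" "y ^ b = 1 - B" by (simp_all add: A_def B_def)
  have e: "(1 - (1 - A) * (1 - B)) * (1 - y\<^sup>2) = y * A * B"
    using eq unfolding power_add ya by (simp add: algebra_simps)
  have 1: "(1 + y) / (1 - y) - (1 + y\<^sup>2) / (1 - y\<^sup>2) = 2 * y / (1 - y\<^sup>2)"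
    using nz by (simp add: divide_simps) (simp add: algebra_simps power2_eq_square)
  have 2: "(1 + (1 - A)) / A + (1 + (1 - B)) / B = 2 * (1 - (1 - A) * (1 - B)) / (A * B)"
    using nz by (simp add: divide_simps) (simp add: algebra_simps)
  have "1 - (1 - A) * (1 - B) = y * A * B / (1 - y\<^sup>2)"
    using nz e by (simp add: eq_divide_eq)
  hence "2 * (1 - (1 - A) * (1 - B)) / (A * B) = 2 * y / (1 - y\<^sup>2)"
    using nz by simp
  with 1 2 have "(1 + y) / (1 - y) = (1 + y\<^sup>2) / (1 - y\<^sup>2) + ((1 + (1 - A)) / A + (1 + (1 - B)) / B)"
    by (simp add: algebra_simps)
  thus ?thesis unfolding A_def B_def by simp
qed

text \<open>The identity of \<open>star_equation\<close> holds at the roots only, so the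
  Schwarz--Pick argument is applied to the pair of roots directly. The kernel of the left side is
  the rank-one product of \<open>1 / (1 - y)\<close> and \<open>cnj (1 / (1 - z))\<close>, that of
  the right side is a Gram matrix of vectors \<open>f\<close>. They coincide at \<open>y\<close> and
  \<open>z\<close>, so \<open>f y\<close> and \<open>f z\<close> are parallel.\<close>

lemma star_root_unique:
  fixes y z :: complex
  assumes y: "cmod y < 1" and z: "cmod z < 1" and ab: "0 < a" "0 < b"
    and ey: "(y ^ (a + b) - 1) * (y\<^sup>2 - 1) = y * (y ^ a - 1) * (y ^ b - 1)"
    and ez: "(z ^ (a + b) - 1) * (z\<^sup>2 - 1) = z * (z ^ a - 1) * (z ^ b - 1)"
  shows "y = z"
proof -
  define \<mu> where "\<mu> s = (if s = 0 then 2 else if s = 1 then a else b)" for s :: nat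
  define I where "I = Sigma {..<3::nat} (\<lambda>s. {..<\<mu> s})"
  define f where "f x = (\<lambda>(s, i). x ^ i / (1 - x ^ \<mu> s))" for x :: complex
  have \<mu>: "0 < \<mu> s" for s using ab by (simp add: \<mu>_def)
  have star: "(1 + x) / (1 - x) = (\<Sum>s<3. (1 + x ^ \<mu> s) / (1 - x ^ \<mu> s))" if "x \<in> {y, z}" for x
    using that star_equation[OF y ab ey] star_equation[OF z ab ez]
    by (auto simp: \<mu>_def eval_nat_numeral)
  have gram: "(\<Sum>p\<in>I. f x p * cnj (f x' p)) = (1 / (1 - x)) * cnj (1 / (1 - x'))"
    if xx: "x \<in> {y, z}" "x' \<in> {y, z}" for x x'
  proof -
    have n: "cmod x < 1" "cmod x' < 1" using xx y z by auto
    define d where "d = 2 * (1 - x * cnj x')"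
    have "cmod (x * cnj x') < 1"
      using mult_strict_mono'[of "cmod x" 1 "cmod x'" 1] n by (simp add: norm_mult)
    hence d: "d \<noteq> 0" unfolding d_def by auto
    have "d * (\<Sum>p\<in>I. f x p * cnj (f x' p)) =
       (\<Sum>s<3. d * (\<Sum>i<\<mu> s. x ^ i / (1 - x ^ \<mu> s) * cnj (x' ^ i / (1 - x' ^ \<mu> s))))"
      unfolding I_def f_def by (simp add: sum.Sigma sum_distrib_left split_def del: times_divide_eq_left times_divide_eq_right)
    also have "\<dots> = (\<Sum>s<3. (1 + x ^ \<mu> s) / (1 - x ^ \<mu> s) + cnj ((1 + x' ^ \<mu> s) / (1 - x' ^ \<mu> s)))"
      unfolding d_def by (intro sum.cong refl herglotz_kernel n \<mu>)
    also have "\<dots> = (1 + x) / (1 - x) + cnj ((1 + x') / (1 - x'))"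
      using star[OF xx(1)] arg_cong[OF star[OF xx(2)], of cnj] by (simp add: sum.distrib)
    also have "\<dots> = d * ((1 / (1 - x)) * cnj (1 / (1 - x')))"
      using herglotz_kernel[OF n, of 1] by (simp add: d_def)
    finally show ?thesis by (simp only: mult_left_cancel[OF d])
  qed
  have fin: "finite I" by (simp add: I_def)
  have par: "f y p * (1 / (1 - z)) = f z p * (1 / (1 - y))" if "p \<in> I" for p
    by (rule Cauchy_Schwarz_equality[OF fin _ _ _ that]) (simp_all only: gram insertI1 insertI2 insert_iff simp_thms)
  \<comment> \<open>These two components belong to the exponent 2. In \<open>f x\<close> the second
    is \<open>x\<close> times the first, so parallel vectors come from equal arguments.\<close>
  have mem: "(0, 0) \<in> I" "(0, 1) \<in> I" by (auto simp: I_def \<mu>_def)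
  have nz: "1 - y \<noteq> 0" "1 - z \<noteq> 0" "1 - y\<^sup>2 \<noteq> 0" "1 - z\<^sup>2 \<noteq> 0"
    using power_neq_one_in_disc[OF y, of 1] power_neq_one_in_disc[OF z, of 1]
      power_neq_one_in_disc[OF y, of 2] power_neq_one_in_disc[OF z, of 2] by auto
  have e0: "1 / (1 - y\<^sup>2) * (1 / (1 - z)) = 1 / (1 - z\<^sup>2) * (1 / (1 - y))"
    using par[OF mem(1)] by (simp add: f_def \<mu>_def)
  have "y * (1 / (1 - y\<^sup>2) * (1 / (1 - z))) = z * (1 / (1 - z\<^sup>2) * (1 / (1 - y)))"
    using par[OF mem(2)] by (simp add: f_def \<mu>_def)
  with e0 have "y * (1 / (1 - z\<^sup>2) * (1 / (1 - y))) = z * (1 / (1 - z\<^sup>2) * (1 / (1 - y)))" by simp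
  thus ?thesis using nz by simp
qed

section \<open>Integer polynomials, their common factors and the moduli of their roots\<close>

lemma map_poly_of_int_hom:
  "map_poly complex_of_int (p + q) = map_poly of_int p + map_poly of_int q"
  "map_poly complex_of_int (p - q) = map_poly of_int p - map_poly of_int q"
  "map_poly complex_of_int (p * q) = map_poly of_int p * map_poly of_int q"
  "map_poly complex_of_int (smult c p) = smult (of_int c) (map_poly of_int p)"
proof -
  show "map_poly complex_of_int (p + q) = map_poly of_int p + map_poly of_int q"
    by (rule poly_eqI) (simp add: coeff_map_poly)
  show "map_poly complex_of_int (p - q) = map_poly of_int p - map_poly of_int q"
    by (rule poly_eqI) (simp add: coeff_map_poly)
  show "map_poly complex_of_int (p * q) = map_poly of_int p * map_poly of_int q"
    by (rule poly_eqI) (simp add: coeff_map_poly coeff_mult)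
  show "map_poly complex_of_int (smult c p) = smult (of_int c) (map_poly of_int p)"
    by (rule poly_eqI) (simp add: coeff_map_poly)
qed

text \<open>\<open>m\<close> is the minimal polynomial of \<open>x\<close> over the integers,
  obtained as the primitive part of an integer polynomial of least degree vanishing at
  \<open>x\<close>. Its extreme coefficients divide those of \<open>f\<close>, hence are
  units.\<close>

lemma exists_common_unimodular_factor:
  fixes f g :: "int poly" and x :: complex
  assumes f: "\<bar>lead_coeff f\<bar> = 1" "\<bar>coeff f 0\<bar> = 1"
    and fx: "poly (map_poly of_int f) x = 0" and gx: "poly (map_poly of_int g) x = 0"
  obtains m :: "int poly" where "\<bar>lead_coeff m\<bar> = 1" "\<bar>coeff m 0\<bar> = 1" "m dvd f" "m dvd g"
    "poly (map_poly of_int m) x = 0"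
proof -
  define Z where "Z q \<longleftrightarrow> q \<noteq> 0 \<and> poly (map_poly of_int q) x = (0::complex)" for q :: "int poly"
  have hom: "poly (map_poly of_int (p * q)) x = poly (map_poly of_int p) x * poly (map_poly of_int q) (x::complex)"
       "poly (map_poly of_int (p + q)) x = poly (map_poly of_int p) x + poly (map_poly of_int q) (x::complex)"
       "poly (map_poly of_int (smult c p)) x = of_int c * poly (map_poly of_int p) (x::complex)"
    for p q :: "int poly" and c
    by (simp_all add: map_poly_of_int_hom)
  have "Z f" using f fx by (auto simp: Z_def)
  define m0 where "m0 = arg_min degree Z"
  have m0: "Z m0" and min: "Z q \<Longrightarrow> degree m0 \<le> degree q" for q
    unfolding m0_def using arg_min_natI[of Z f degree] arg_min_nat_le[of Z _ degree] \<open>Z f\<close> by auto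
  define m where "m = primitive_part m0"
  have cm: "content m = 1" unfolding m_def using m0 by (simp add: Z_def)
  have "m \<noteq> 0" using m0 by (simp add: m_def Z_def)
  have "poly (map_poly of_int (smult (content m0) m)) x = 0"
    using m0 by (simp add: m_def Z_def)
  hence mx: "poly (map_poly of_int m) x = 0"
    unfolding hom(3) using m0 by (simp add: Z_def)
  have dm: "degree m = degree m0" by (simp add: m_def)
  have dvd: "m dvd h" if hx: "poly (map_poly of_int h) x = 0" for h
  proof -
    obtain a q where a: "a \<noteq> 0" "smult a h = m * q + pseudo_mod h m"
      and deg: "pseudo_mod h m = 0 \<or> degree (pseudo_mod h m) < degree m"
      using pseudo_mod[OF \<open>m \<noteq> 0\<close>, of h] by blast
    have "poly (map_poly of_int (pseudo_mod h m)) x = 0"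
      using arg_cong[OF a(2), of "\<lambda>p. poly (map_poly of_int p) x"] hx mx unfolding hom by simp
    hence "pseudo_mod h m = 0"
      using deg min[of "pseudo_mod h m"] dm by (metis Z_def leD)
    hence e: "smult a h = m * q" using a by simp
    \<comment> \<open>Gauss's lemma: as \<open>m\<close> is primitive, the factor \<open>a\<close>
      introduced by pseudo-division divides the content of \<open>q\<close> and can be
      cancelled.\<close>
    have "content q = content (smult a h)" unfolding e content_mult cm by simp
    hence "a dvd content q" by (simp add: content_smult)
    hence "[:a:] dvd q" by (simp add: const_poly_dvd_iff_dvd_content)
    then obtain q' where "q = smult a q'" by (auto elim!: dvdE)
    with e a have "h = m * q'" by (metis mult_smult_right smult_cancel)
    thus ?thesis by simp
  qed
  from dvd[OF fx] obtain q where q: "f = m * q" by (auto elim: dvdE)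
  have "\<bar>lead_coeff m * lead_coeff q\<bar> = 1" "\<bar>coeff m 0 * coeff q 0\<bar> = 1"
    using f unfolding q lead_coeff_mult coeff_mult_0 by auto
  hence "\<bar>lead_coeff m\<bar> = 1" "\<bar>coeff m 0\<bar> = 1" by (blast dest: abs_zmult_eq_1)+
  with that dvd fx gx mx show ?thesis by blast
qed

text \<open>Vieta: the complete factorization, evaluated at 0.\<close>

lemma norm_prod_roots:
  fixes p :: "complex poly"
  assumes "cmod (lead_coeff p) = 1" "cmod (coeff p 0) = 1"
  shows "(\<Prod>z | poly p z = 0. cmod z ^ order z p) = 1"
proof -
  have "lead_coeff p * (\<Prod>z | poly p z = 0. (- z) ^ order z p) =
        poly (smult (lead_coeff p) (\<Prod>z | poly p z = 0. [:-z, 1:] ^ order z p)) 0"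
    by (simp add: poly_prod)
  also have "\<dots> = coeff p 0"
    unfolding complex_poly_decompose by (rule poly_0_coeff_0)
  finally have "cmod (lead_coeff p) * cmod (\<Prod>z | poly p z = 0. (- z) ^ order z p) = cmod (coeff p 0)"
    unfolding norm_mult[symmetric] by (rule arg_cong)
  thus ?thesis using assms unfolding prod_norm[symmetric] by (simp add: norm_power)
qed

definition hitting_poly :: "nat \<Rightarrow> nat \<Rightarrow> nat \<Rightarrow> int poly" where
  "hitting_poly k r j = (monom 1 (r + j) - 1) * (monom 1 2 - 1) - monom 1 1 * (monom 1 (k + 1) - 1) * (monom 1 r - 1)"

lemma hitting_poly_root_iff:
  "poly (map_poly of_int (hitting_poly k r j)) x = 0 \<longleftrightarrow> hitting_eq k r j x"
  by (simp add: hitting_poly_def hitting_eq_def map_poly_of_int_hom map_poly_monom poly_monom)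

text \<open>Only the first product reaches the extreme coefficients: its degree is
  \<open>r + k + 3\<close> against at most \<open>r + k + 2\<close>, and the second product is
  divisible by the variable. Hence the roots are algebraic units.\<close>

lemma hitting_poly_reciprocal_coeffs:
  assumes "0 < r"
  shows "lead_coeff (hitting_poly k r (k + 1)) = 1" "coeff (hitting_poly k r (k + 1)) 0 = 1"
proof -
  define A :: "int poly" where "A = (monom 1 (r + (k + 1)) - 1) * (monom 1 2 - 1)"
  define B :: "int poly" where "B = monom 1 1 * (monom 1 (k + 1) - 1) * (monom 1 r - 1)"
  have d: "degree (monom 1 m - 1 :: int poly) = m" "lead_coeff (monom 1 m - 1 :: int poly) = 1" if "0 < m" for m
  proof -
    have "degree (- 1 + monom 1 m :: int poly) = degree (monom 1 m :: int poly)"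
      by (rule degree_add_eq_right) (use that in \<open>simp add: degree_monom_eq\<close>)
    thus "degree (monom 1 m - 1 :: int poly) = m" by (simp add: degree_monom_eq)
    thus "lead_coeff (monom 1 m - 1 :: int poly) = 1" using that by simp
  qed
  have nz: "monom 1 m - 1 \<noteq> (0 :: int poly)" if "0 < m" for m using d(1)[OF that] that by (metis degree_0 less_irrefl)
  have A: "degree A = r + k + 3"
    unfolding A_def using degree_mult_eq[OF nz nz, of "r + (k + 1)" 2] d(1)[of "r + (k + 1)"] d(1)[of 2] by simp
  have A1: "lead_coeff A = 1"
    unfolding A_def lead_coeff_mult using d(2)[of "r + (k + 1)"] d(2)[of 2] by simp
  have "monom 1 1 * (monom 1 (k + 1) - 1) \<noteq> (0 :: int poly)"
    unfolding mult_eq_0_iff using nz[of "k + 1"] by simp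
  hence "degree B = degree (monom 1 1 * (monom 1 (k + 1) - 1) :: int poly) + r"
    unfolding B_def using degree_mult_eq[OF _ nz[OF assms]] d(1)[OF assms] by metis
  also have "degree (monom 1 1 * (monom 1 (k + 1) - 1) :: int poly) \<le> degree (monom 1 1 :: int poly) + (k + 1)"
    using degree_mult_le[of "monom 1 1" "monom 1 (k + 1) - 1 :: int poly"] d(1)[of "k + 1"] by simp
  finally have B: "degree B \<le> r + k + 2"
    using degree_monom_le[of "1::int" 1] by linarith
  have "degree (- B) < degree A" using A B by simp
  hence "degree (- B + A) = degree A" "coeff (- B) (degree A) = 0"
    by (simp_all only: degree_add_eq_right coeff_eq_0)
  hence "lead_coeff (- B + A) = lead_coeff A" by simp
  thus "lead_coeff (hitting_poly k r (k + 1)) = 1"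
    using A1 by (simp add: hitting_poly_def A_def B_def)
  show "coeff (hitting_poly k r (k + 1)) 0 = 1"
    using assms by (simp add: hitting_poly_def coeff_mult_0)
qed

text \<open>If \<open>x\<close> is not a root of unity, the second equation bars
  \<open>inverse x\<close>. By uniqueness in the disc, a root of the common factor \<open>m\<close>
  off the unit circle is \<open>x\<close> or \<open>inverse x\<close>, hence \<open>x\<close>. But
  the moduli of all roots multiply to 1, which puts \<open>x\<close> on the circle, where
  \<open>inverse x\<close> is \<open>cnj x\<close> and a solution after all.\<close>

lemma hitting_eq_exclusive:
  assumes N: "0 < N" and E1: "hitting_eq k N (k + 1) x"
    and r: "0 < r" and j: "j \<le> k" and E2: "hitting_eq k r j x"
  shows "\<exists>m>0. x ^ m = 1"
proof (rule ccontr)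
  assume no: "\<not> ?thesis"
  have norec: "\<not> hitting_eq k r j (inverse x)"
    using hitting_eq_not_reciprocal[OF r j E2] no by blast
  have x0: "x \<noteq> 0" using hitting_eq_nonzero[OF E2 r] .
  show False
  proof (cases "cmod x = 1")
    case True
    hence "x * cnj x = 1" using complex_norm_square[of x] by simp
    hence "inverse x = cnj x" by (rule inverse_unique)
    thus False using hitting_eq_cnj[OF E2] norec by simp
  next
    case False
    obtain m where m: "\<bar>lead_coeff m\<bar> = 1" "\<bar>coeff m 0\<bar> = 1"
      "m dvd hitting_poly k N (k + 1)" "m dvd hitting_poly k r j" "poly (map_poly of_int m) x = 0"
      using exists_common_unimodular_factor[of "hitting_poly k N (k + 1)" x "hitting_poly k r j"]
        hitting_poly_reciprocal_coeffs[OF N, of k] E1 E2 unfolding hitting_poly_root_iff by auto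
    define p where "p = map_poly complex_of_int m"
    have p0: "p \<noteq> 0" using m(1) by (auto simp: p_def map_poly_eq_0_iff)
    have roots: "hitting_eq k N (k + 1) z \<and> hitting_eq k r j z" if "poly p z = 0" for z
      using m(3,4) that unfolding hitting_poly_root_iff[symmetric] p_def
      by (auto elim!: dvdE simp: map_poly_of_int_hom)
    have small: "z = w" if "hitting_eq k N (k + 1) z" "cmod z < 1" "hitting_eq k N (k + 1) w" "cmod w < 1" for z w
      using star_root_unique[of z w "k + 1" N] that N unfolding hitting_eq_def by (simp add: add.commute[of N])
    have other: "cmod z = 1 \<or> z = x" if z: "poly p z = 0" for z
    proof (rule ccontr)
      assume c: "\<not> ?thesis"
      have z0: "z \<noteq> 0" using hitting_eq_nonzero roots[OF z] r by blast
      \<comment> \<open>The equation from (b) is reciprocal, so \<open>z\<close> and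
        \<open>x\<close> may be replaced by their inverses to bring both into the open disc.\<close>
      define u where "u = (if cmod z < 1 then z else inverse z)"
      define v where "v = (if cmod x < 1 then x else inverse x)"
      have "hitting_eq k N (k + 1) u" "hitting_eq k N (k + 1) v"
        using roots[OF z] E1 hitting_eq_reciprocal x0 z0 by (auto simp: u_def v_def)
      moreover have "cmod u < 1" "cmod v < 1"
        using c False x0 z0 by (auto simp: u_def v_def norm_inverse intro!: one_less_inverse inverse_less_1_iff[THEN iffD2])
      ultimately have "u = v" using small by blast
      hence "z = x \<or> z = inverse x" by (auto simp: u_def v_def split: if_splits)
      thus False using c roots[OF z] norec by auto
    qed
    have fin: "finite {z. poly p z = 0}" using p0 by (rule poly_roots_finite)
    have "x \<in> {z. poly p z = 0}" using m(5) by (simp add: p_def)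
    moreover have "(\<Prod>z \<in> {z. poly p z = 0} - {x}. cmod z ^ order z p) = 1"
      by (rule prod.neutral) (use other in fastforce)
    ultimately have "(\<Prod>z | poly p z = 0. cmod z ^ order z p) = cmod x ^ order x p"
      using prod.remove[OF fin, of x "\<lambda>z. cmod z ^ order z p"] by simp
    moreover have "lead_coeff p = of_int (lead_coeff m)"
      unfolding p_def by (subst degree_map_poly) (auto simp: coeff_map_poly)
    moreover have "coeff p 0 = of_int (coeff m 0)" by (simp add: p_def coeff_map_poly)
    ultimately have "cmod x ^ order x p = 1"
      using norm_prod_roots[of p] m(1,2) by simp
    moreover have "0 < order x p"
      using p0 m(5) order_root[of p x] by (simp add: p_def)
    ultimately have "cmod x = 1" using power_eq_iff_eq_base[of "order x p" "cmod x" 1] by simp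
    thus False using False by simp
  qed
qed

section \<open>Points and projective automorphisms\<close>

lemma pclass_eq_iff: "pclass v = pclass w \<longleftrightarrow> (\<exists>c. c \<noteq> 0 \<and> w = c \<cdot>\<^sub>v v)"
proof
  assume "pclass v = pclass w"
  moreover have "w \<in> pclass w" unfolding pclass_def by (auto intro!: exI[of _ 1])
  ultimately show "\<exists>c. c \<noteq> 0 \<and> w = c \<cdot>\<^sub>v v" unfolding pclass_def by auto
next
  assume "\<exists>c. c \<noteq> 0 \<and> w = c \<cdot>\<^sub>v v"
  then obtain c where c: "c \<noteq> 0" "w = c \<cdot>\<^sub>v v" by blast
  have "d \<cdot>\<^sub>v v = (d / c) \<cdot>\<^sub>v w" for d using c by (simp add: smult_smult_assoc)
  moreover have "d \<cdot>\<^sub>v w = (d * c) \<cdot>\<^sub>v v" for d using c by (simp add: smult_smult_assoc)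
  ultimately show "pclass v = pclass w"
    unfolding pclass_def using c(1) by (auto; metis divide_eq_0_iff mult_eq_0_iff)
qed

lemma self_in_pclass [simp]: "v \<in> pclass v"
  unfolding pclass_def by (auto intro!: exI[of _ 1])

lemma pclass_smult [simp]: "c \<noteq> 0 \<Longrightarrow> pclass (c \<cdot>\<^sub>v v) = pclass v"
  by (metis pclass_eq_iff)

lemma proj_space_cases:
  assumes "p \<in> proj_space k"
  obtains v where "v \<in> carrier_vec (k + 1)" "v \<noteq> 0\<^sub>v (k + 1)" "p = pclass v"
  using assms unfolding proj_space_def by blast

lemma pclass_in_proj_space_iff:
  assumes "v \<in> carrier_vec (k + 1)"
  shows "pclass v \<in> proj_space k \<longleftrightarrow> v \<noteq> 0\<^sub>v (k + 1)"
proof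
  assume "pclass v \<in> proj_space k"
  then obtain w where w: "w \<in> carrier_vec (k + 1)" "w \<noteq> 0\<^sub>v (k + 1)" "pclass v = pclass w"
    by (rule proj_space_cases)
  from w(3) obtain c where "w = c \<cdot>\<^sub>v v" unfolding pclass_eq_iff by blast
  thus "v \<noteq> 0\<^sub>v (k + 1)" using w(2) by auto
qed (use assms in \<open>auto simp: proj_space_def\<close>)

definition proj_map :: "complex mat \<Rightarrow> ppoint \<Rightarrow> ppoint" where
  "proj_map A p = (\<lambda>v. A *\<^sub>v v) ` p"

lemma proj_map_pclass:
  assumes "A \<in> carrier_mat n m" "v \<in> carrier_vec m"
  shows "proj_map A (pclass v) = pclass (A *\<^sub>v v)"
  unfolding proj_map_def pclass_def using mult_mat_vec[OF assms] by (auto simp: image_iff; metis)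

lemma proj_aut_iff:
  "L \<in> proj_aut k \<longleftrightarrow> (\<exists>A \<in> carrier_mat (k + 1) (k + 1). invertible_mat A \<and> L = proj_map A)"
  unfolding proj_aut_def proj_map_def[abs_def] by auto

lemma invertible_mat_inverse:
  assumes "A \<in> carrier_mat n n" "invertible_mat A"
  obtains B where "B \<in> carrier_mat n n" "A * B = 1\<^sub>m n" "B * A = 1\<^sub>m n"
proof -
  from assms obtain B where B: "A * B = 1\<^sub>m n" "B * A = 1\<^sub>m (dim_row B)"
    unfolding invertible_mat_def inverts_mat_def by auto
  hence "dim_col B = n" "dim_row B = n"
    using assms(1) by (metis carrier_matD index_mult_mat(3) index_one_mat(3))+
  with B that[of B] show ?thesis by auto
qed

lemma invertible_matI_left:
  fixes A :: "complex mat"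
  assumes "A \<in> carrier_mat n n" "B \<in> carrier_mat n n" "B * A = 1\<^sub>m n"
  shows "invertible_mat A"
proof -
  have "A * B = 1\<^sub>m n" using mat_mult_left_right_inverse assms by blast
  thus ?thesis using assms unfolding invertible_mat_def inverts_mat_def by auto
qed

lemma mult_mat_vec_eq_iff:
  assumes "A \<in> carrier_mat n n" "invertible_mat A" "v \<in> carrier_vec n" "w \<in> carrier_vec n"
  shows "A *\<^sub>v v = A *\<^sub>v w \<longleftrightarrow> v = w"
proof -
  obtain B where B: "B \<in> carrier_mat n n" "B * A = 1\<^sub>m n"
    using invertible_mat_inverse assms by metis
  have "B *\<^sub>v (A *\<^sub>v u) = u" if "u \<in> carrier_vec n" for u
    using that B assms(1) by (metis assoc_mult_mat_vec one_mult_mat_vec)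
  thus ?thesis using assms by metis
qed

lemma mult_mat_vec_surj:
  assumes "A \<in> carrier_mat n n" "invertible_mat A" "v \<in> carrier_vec n"
  obtains w where "w \<in> carrier_vec n" "v = A *\<^sub>v w"
proof -
  obtain B where B: "B \<in> carrier_mat n n" "A * B = 1\<^sub>m n"
    using invertible_mat_inverse assms by metis
  have "v = A *\<^sub>v (B *\<^sub>v v)"
    using assms B by (metis assoc_mult_mat_vec one_mult_mat_vec)
  thus ?thesis using that B assms by (metis mult_mat_vec_carrier)
qed

lemma mult_mat_zero_vec: "(A :: complex mat) \<in> carrier_mat n m \<Longrightarrow> A *\<^sub>v 0\<^sub>v m = 0\<^sub>v n"
  by (intro eq_vecI) auto

lemma mult_mat_vec_eq_0_iff:
  fixes A :: "complex mat"
  assumes "A \<in> carrier_mat n n" "invertible_mat A" "v \<in> carrier_vec n"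
  shows "A *\<^sub>v v = 0\<^sub>v n \<longleftrightarrow> v = 0\<^sub>v n"
  using mult_mat_vec_eq_iff[OF assms zero_carrier_vec] mult_mat_zero_vec[OF assms(1)] by simp

lemma proj_space_proj_map_cases:
  assumes "A \<in> carrier_mat (k + 1) (k + 1)" "invertible_mat A" "p \<in> proj_space k"
  obtains v where "v \<in> carrier_vec (k + 1)" "v \<noteq> 0\<^sub>v (k + 1)" "p = pclass (A *\<^sub>v v)"
proof -
  obtain u where u: "u \<in> carrier_vec (k + 1)" "u \<noteq> 0\<^sub>v (k + 1)" "p = pclass u"
    using assms(3) by (rule proj_space_cases)
  obtain v where "v \<in> carrier_vec (k + 1)" "u = A *\<^sub>v v"
    using mult_mat_vec_surj[OF assms(1,2) u(1)] .
  thus ?thesis using that u mult_mat_zero_vec[OF assms(1)] by auto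
qed

lemma pclass_mult_mat_vec_eq_iff:
  assumes "A \<in> carrier_mat n n" "invertible_mat A" "v \<in> carrier_vec n" "w \<in> carrier_vec n"
  shows "pclass (A *\<^sub>v v) = pclass (A *\<^sub>v w) \<longleftrightarrow> pclass v = pclass w"
  unfolding pclass_eq_iff
  using mult_mat_vec[OF assms(1,3)] mult_mat_vec_eq_iff[OF assms(1,2,4)] assms(3)
  by (metis smult_carrier_vec)

lemma coord_point_proj_map:
  assumes "A \<in> carrier_mat (k + 1) (k + 1)" "j \<le> k"
  shows "proj_map A (coord_point k j) = pclass (col A j)"
proof -
  have "A *\<^sub>v unit_vec (k + 1) j = col A j"
    using assms by (intro eq_vecI) (auto simp: scalar_prod_right_unit)
  thus ?thesis unfolding coord_point_def using assms by (subst proj_map_pclass) auto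
qed

section \<open>Homogeneous polynomials\<close>

definition exponents :: "nat \<Rightarrow> nat \<Rightarrow> (nat \<Rightarrow> nat) set" where
  "exponents k d = {\<alpha> \<in> {..k} \<rightarrow>\<^sub>E {..d}. sum \<alpha> {..k} = d}"

lemma finite_exponents [simp]: "finite (exponents k d)"
  unfolding exponents_def by (rule finite_subset[of _ "{..k} \<rightarrow>\<^sub>E {..d}"]) (auto intro: finite_PiE)

lemma homogeneous_poly_alt:
  "homogeneous_poly k d f \<longleftrightarrow>
     (\<exists>c. \<forall>v \<in> carrier_vec (k + 1). f v = (\<Sum>\<alpha> \<in> exponents k d. c \<alpha> * (\<Prod>i\<le>k. (v $ i) ^ \<alpha> i)))"
  unfolding homogeneous_poly_def exponents_def ..

lemma homogeneous_poly_cong: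
  assumes "\<And>v. v \<in> carrier_vec (k + 1) \<Longrightarrow> f v = g v"
  shows "homogeneous_poly k d f \<longleftrightarrow> homogeneous_poly k d g"
  unfolding homogeneous_poly_def using assms by auto

lemma homogeneous_poly_monom:
  assumes "\<alpha> \<in> exponents k d"
  shows "homogeneous_poly k d (\<lambda>v. \<Prod>i\<le>k. (v $ i) ^ \<alpha> i)"
proof -
  have "(\<Sum>\<beta> \<in> exponents k d. (if \<beta> = \<alpha> then 1 else 0) * (\<Prod>i\<le>k. (v $ i) ^ \<beta> i)) =
     (\<Prod>i\<le>k. (v $ i) ^ \<alpha> i)" for v :: "complex vec"
  proof -
    have "(\<Sum>\<beta> \<in> exponents k d. (if \<beta> = \<alpha> then 1 else 0) * (\<Prod>i\<le>k. (v $ i) ^ \<beta> i)) =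
      (\<Sum>\<beta> \<in> exponents k d. if \<beta> = \<alpha> then \<Prod>i\<le>k. (v $ i) ^ \<beta> i else 0)"
      by (intro sum.cong) auto
    thus ?thesis using assms by simp
  qed
  thus ?thesis unfolding homogeneous_poly_alt
    by (intro exI[of _ "\<lambda>\<beta>. if \<beta> = \<alpha> then 1 else 0"]) simp
qed

lemma homogeneous_poly_coord:
  assumes "i \<le> k"
  shows "homogeneous_poly k 1 (\<lambda>v. v $ i)"
proof -
  define \<alpha> :: "nat \<Rightarrow> nat" where "\<alpha> = (\<lambda>j\<in>{..k}. if j = i then 1 else 0)"
  have "\<alpha> \<in> exponents k 1"
    using assms by (auto simp: exponents_def \<alpha>_def)
  moreover have "(\<Prod>j\<le>k. (v $ j) ^ \<alpha> j) = v $ i" for v :: "complex vec"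
  proof -
    have "(\<Prod>j\<le>k. (v $ j) ^ \<alpha> j) = (\<Prod>j\<le>k. if j = i then v $ j else 1)"
      by (intro prod.cong) (auto simp: \<alpha>_def)
    thus ?thesis using assms by simp
  qed
  ultimately show ?thesis using homogeneous_poly_monom[of \<alpha> k 1] by simp
qed

lemma homogeneous_poly_const: "homogeneous_poly k 0 (\<lambda>v. c)"
  unfolding homogeneous_poly_alt
proof (rule exI[of _ "\<lambda>_. c"], rule ballI)
  fix v :: "complex vec"
  have "\<alpha> = (\<lambda>j\<in>{..k}. 0)" if "\<alpha> \<in> exponents k 0" for \<alpha>
  proof
    fix j
    have \<alpha>: "\<alpha> \<in> {..k} \<rightarrow>\<^sub>E {..0}" using that unfolding exponents_def by blast
    show "\<alpha> j = (\<lambda>j\<in>{..k}. 0) j"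
      using PiE_mem[OF \<alpha>, of j] PiE_arb[OF \<alpha>, of j] by (cases "j \<in> {..k}") simp_all
  qed
  moreover have "(\<lambda>j\<in>{..k}. 0) \<in> exponents k 0" by (simp add: exponents_def)
  ultimately have "exponents k 0 = {\<lambda>j\<in>{..k}. 0}" by blast
  thus "c = (\<Sum>\<alpha>\<in>exponents k 0. c * (\<Prod>i\<le>k. v $ i ^ \<alpha> i))" by simp
qed

lemma homogeneous_poly_add:
  assumes "homogeneous_poly k d f" "homogeneous_poly k d g"
  shows "homogeneous_poly k d (\<lambda>v. f v + g v)"
proof -
  from assms obtain a b where
    a: "\<forall>v\<in>carrier_vec (k + 1). f v = (\<Sum>\<alpha>\<in>exponents k d. a \<alpha> * (\<Prod>i\<le>k. v $ i ^ \<alpha> i))" and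
    b: "\<forall>v\<in>carrier_vec (k + 1). g v = (\<Sum>\<alpha>\<in>exponents k d. b \<alpha> * (\<Prod>i\<le>k. v $ i ^ \<alpha> i))"
    unfolding homogeneous_poly_alt by blast
  show ?thesis unfolding homogeneous_poly_alt
    by (rule exI[of _ "\<lambda>\<alpha>. a \<alpha> + b \<alpha>"]) (use a b in \<open>simp add: distrib_right sum.distrib\<close>)
qed

text \<open>The coefficients of the product are the convolution \<open>c\<close>: pairs of exponents
  are grouped by their sum \<open>add\<close>, which is restricted to \<open>{..k}\<close> because
  \<open>exponents\<close> consists of extensional functions.\<close>

lemma homogeneous_poly_mult:
  assumes "homogeneous_poly k d f" "homogeneous_poly k e g"
  shows "homogeneous_poly k (d + e) (\<lambda>v. f v * g v)"
proof -
  from assms obtain a b where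
    a: "\<forall>v\<in>carrier_vec (k + 1). f v = (\<Sum>\<alpha>\<in>exponents k d. a \<alpha> * (\<Prod>i\<le>k. v $ i ^ \<alpha> i))" and
    b: "\<forall>v\<in>carrier_vec (k + 1). g v = (\<Sum>\<alpha>\<in>exponents k e. b \<alpha> * (\<Prod>i\<le>k. v $ i ^ \<alpha> i))"
    unfolding homogeneous_poly_alt by blast
  define S where "S = exponents k d \<times> exponents k e"
  define add where "add = (\<lambda>(\<alpha>, \<beta>). \<lambda>i\<in>{..k}. \<alpha> i + \<beta> i :: nat)"
  define c where "c \<gamma> = (\<Sum>p\<in>{p \<in> S. add p = \<gamma>}. a (fst p) * b (snd p))" for \<gamma>
  have S: "add ` S \<subseteq> exponents k (d + e)"
  proof
    fix \<gamma> assume "\<gamma> \<in> add ` S"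
    then obtain \<alpha> \<beta> where "\<alpha> \<in> exponents k d" "\<beta> \<in> exponents k e" "\<gamma> = (\<lambda>i\<in>{..k}. \<alpha> i + \<beta> i)"
      by (auto simp: S_def add_def)
    thus "\<gamma> \<in> exponents k (d + e)"
      by (auto simp: exponents_def sum.distrib PiE_iff intro!: add_mono)
  qed
  have "f v * g v = (\<Sum>\<gamma>\<in>exponents k (d + e). c \<gamma> * (\<Prod>i\<le>k. v $ i ^ \<gamma> i))"
    if v: "v \<in> carrier_vec (k + 1)" for v
  proof -
    have "f v * g v = (\<Sum>(\<alpha>, \<beta>)\<in>S. (a \<alpha> * (\<Prod>i\<le>k. v $ i ^ \<alpha> i)) * (b \<beta> * (\<Prod>i\<le>k. v $ i ^ \<beta> i)))"
      using a b v unfolding S_def by (simp add: sum_product sum.cartesian_product)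
    also have "\<dots> = (\<Sum>p\<in>S. a (fst p) * b (snd p) * (\<Prod>i\<le>k. v $ i ^ (add p i)))"
      by (intro sum.cong refl) (auto simp: add_def power_add prod.distrib)
    also have "\<dots> = (\<Sum>\<gamma>\<in>exponents k (d + e). \<Sum>p\<in>{p \<in> S. add p = \<gamma>}.
        a (fst p) * b (snd p) * (\<Prod>i\<le>k. v $ i ^ (add p i)))"
      by (rule sum.group[symmetric]) (use S in \<open>auto simp: S_def\<close>)
    also have "\<dots> = (\<Sum>\<gamma>\<in>exponents k (d + e). c \<gamma> * (\<Prod>i\<le>k. v $ i ^ \<gamma> i))"
      by (intro sum.cong refl) (auto simp: c_def sum_distrib_right intro!: sum.cong)
    finally show ?thesis .
  qed
  thus ?thesis unfolding homogeneous_poly_alt by blast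
qed

lemma homogeneous_poly_scale:
  "homogeneous_poly k d f \<Longrightarrow> homogeneous_poly k d (\<lambda>v. c * f v)"
  using homogeneous_poly_mult[OF homogeneous_poly_const] by simp

lemma homogeneous_poly_diff:
  "homogeneous_poly k d f \<Longrightarrow> homogeneous_poly k d g \<Longrightarrow> homogeneous_poly k d (\<lambda>v. f v - g v)"
  using homogeneous_poly_add[OF _ homogeneous_poly_scale[of k d g "-1"]] by simp

lemma homogeneous_poly_sum:
  assumes "finite I" "\<And>i. i \<in> I \<Longrightarrow> homogeneous_poly k d (f i)"
  shows "homogeneous_poly k d (\<lambda>v. \<Sum>i\<in>I. f i v)"
  using assms
proof (induction I rule: finite_induct)
  case empty
  show ?case unfolding homogeneous_poly_alt by (auto intro!: exI[of _ "\<lambda>_. 0"])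
qed (simp add: homogeneous_poly_add)

lemma homogeneous_poly_prod:
  assumes "finite I" "\<And>i. i \<in> I \<Longrightarrow> homogeneous_poly k (d i) (f i)"
  shows "homogeneous_poly k (\<Sum>i\<in>I. d i) (\<lambda>v. \<Prod>i\<in>I. f i v)"
  using assms
  by (induction I rule: finite_induct) (simp_all add: homogeneous_poly_const homogeneous_poly_mult)

lemma homogeneous_poly_power:
  "homogeneous_poly k d f \<Longrightarrow> homogeneous_poly k (m * d) (\<lambda>v. f v ^ m)"
  using homogeneous_poly_prod[of "{..<m}" k "\<lambda>_. d" "\<lambda>_. f"] by simp

lemma homogeneous_poly_linear:
  assumes "A \<in> carrier_mat (k + 1) (k + 1)" "i \<le> k"
  shows "homogeneous_poly k 1 (\<lambda>v. (A *\<^sub>v v) $ i)"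
proof -
  have "homogeneous_poly k 1 (\<lambda>v. \<Sum>j\<in>{..k}. A $$ (i, j) * v $ j)"
    by (intro homogeneous_poly_sum homogeneous_poly_scale homogeneous_poly_coord) auto
  moreover have "(A *\<^sub>v v) $ i = (\<Sum>j\<in>{..k}. A $$ (i, j) * v $ j)" if "v \<in> carrier_vec (k + 1)" for v
    using that assms by (auto simp: scalar_prod_def atLeast0LessThan lessThan_Suc_atMost intro!: sum.cong)
  ultimately show ?thesis by (subst homogeneous_poly_cong) auto
qed

lemma homogeneous_poly_compose:
  assumes "homogeneous_poly k d f" and A: "A \<in> carrier_mat (k + 1) (k + 1)"
  shows "homogeneous_poly k d (\<lambda>v. f (A *\<^sub>v v))"
proof -
  from assms(1) obtain a where
    a: "\<forall>v\<in>carrier_vec (k + 1). f v = (\<Sum>\<alpha>\<in>exponents k d. a \<alpha> * (\<Prod>i\<le>k. v $ i ^ \<alpha> i))"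
    unfolding homogeneous_poly_alt by blast
  have "homogeneous_poly k d (\<lambda>v. \<Sum>\<alpha>\<in>exponents k d. a \<alpha> * (\<Prod>i\<in>{..k}. (A *\<^sub>v v) $ i ^ \<alpha> i))"
  proof (intro homogeneous_poly_sum homogeneous_poly_scale)
    fix \<alpha> assume \<alpha>: "\<alpha> \<in> exponents k d"
    have "homogeneous_poly k (\<Sum>i\<in>{..k}. \<alpha> i * 1) (\<lambda>v. \<Prod>i\<in>{..k}. (A *\<^sub>v v) $ i ^ \<alpha> i)"
      by (intro homogeneous_poly_prod homogeneous_poly_power homogeneous_poly_linear A) auto
    thus "homogeneous_poly k d (\<lambda>v. \<Prod>i\<in>{..k}. (A *\<^sub>v v) $ i ^ \<alpha> i)"
      using \<alpha> by (simp add: exponents_def)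
  qed simp
  moreover have "f (A *\<^sub>v v) = (\<Sum>\<alpha>\<in>exponents k d. a \<alpha> * (\<Prod>i\<in>{..k}. (A *\<^sub>v v) $ i ^ \<alpha> i))"
    if "v \<in> carrier_vec (k + 1)" for v
    using a mult_mat_vec_carrier[OF A that] by blast
  ultimately show ?thesis by (subst homogeneous_poly_cong) auto
qed

lemma homogeneous_poly_smult:
  assumes "homogeneous_poly k d f" "v \<in> carrier_vec (k + 1)"
  shows "f (c \<cdot>\<^sub>v v) = c ^ d * f v"
proof -
  from assms(1) obtain a where
    a: "\<forall>v\<in>carrier_vec (k + 1). f v = (\<Sum>\<alpha>\<in>exponents k d. a \<alpha> * (\<Prod>i\<le>k. v $ i ^ \<alpha> i))"
    unfolding homogeneous_poly_alt by blast
  have "(\<Prod>i\<le>k. (c \<cdot>\<^sub>v v) $ i ^ \<alpha> i) = c ^ d * (\<Prod>i\<le>k. v $ i ^ \<alpha> i)" if "\<alpha> \<in> exponents k d" for \<alpha>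
  proof -
    have "(\<Prod>i\<le>k. (c \<cdot>\<^sub>v v) $ i ^ \<alpha> i) = (\<Prod>i\<le>k. c ^ \<alpha> i * v $ i ^ \<alpha> i)"
      using assms(2) by (intro prod.cong) (auto simp: power_mult_distrib)
    thus ?thesis using that by (simp add: prod.distrib exponents_def flip: power_sum)
  qed
  thus ?thesis using a assms(2) by (simp add: sum_distrib_left mult.left_commute)
qed

lemma homogeneous_poly_isCont:
  assumes "homogeneous_poly k d f" "\<And>s. g s \<in> carrier_vec (k + 1)"
    "\<And>i. i \<le> k \<Longrightarrow> isCont (\<lambda>s. g s $ i) s0"
  shows "isCont (\<lambda>s :: complex. f (g s)) s0"
proof -
  from assms(1) obtain a where
    a: "\<forall>v\<in>carrier_vec (k + 1). f v = (\<Sum>\<alpha>\<in>exponents k d. a \<alpha> * (\<Prod>i\<le>k. v $ i ^ \<alpha> i))"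
    unfolding homogeneous_poly_alt by blast
  have "(\<lambda>s. f (g s)) = (\<lambda>s. \<Sum>\<alpha>\<in>exponents k d. a \<alpha> * (\<Prod>i\<le>k. g s $ i ^ \<alpha> i))"
    using a assms(2) by auto
  thus ?thesis using assms(3) by (auto intro!: continuous_intros)
qed

lemma isCont_eq_zero_if_cofinite_zero:
  fixes h :: "complex \<Rightarrow> complex"
  assumes "isCont h s0" "finite X" "\<And>s. s \<notin> X \<Longrightarrow> h s = 0"
  shows "h s0 = 0"
proof -
  have "eventually (\<lambda>s. s \<notin> X) (at s0)"
  proof -
    have op: "open (- (X - {s0}))" using assms(2) by (intro open_Compl finite_imp_closed finite_Diff)
    show ?thesis unfolding eventually_at_topological by (rule exI[of _ "- (X - {s0})"]) (use op in blast)
  qed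
  hence "eventually (\<lambda>s. h s = 0) (at s0)" by (rule eventually_mono) (use assms in auto)
  hence "(h \<longlongrightarrow> 0) (at s0)" by (rule tendsto_eventually)
  moreover have "(h \<longlongrightarrow> h s0) (at s0)" using assms(1) by (simp add: isCont_def)
  ultimately show ?thesis using tendsto_unique by force
qed

text \<open>This takes the place of Zariski density: an identity is carried over to a point along a
  one-parameter family \<open>g\<close> through it that meets the bad locus for finitely many
  parameters only.\<close>

lemma homogeneous_poly_zero_by_continuity:
  fixes s0 :: complex
  assumes "homogeneous_poly k d f" "\<And>s. g s \<in> carrier_vec (k + 1)"
    "\<And>i. i \<le> k \<Longrightarrow> isCont (\<lambda>s. g s $ i) s0"
    "finite X" "\<And>s. s \<notin> X \<Longrightarrow> f (g s) = 0"
  shows "f (g s0) = 0"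
  using isCont_eq_zero_if_cofinite_zero[OF homogeneous_poly_isCont[OF assms(1-3)] assms(4,5)] by blast

section \<open>Values of a basic cremona map\<close>

text \<open>J with its denominators cleared, a tuple of degree \<open>k\<close>. Unlike
  \<open>J_torus\<close> it makes sense off the torus.\<close>

definition cremona_vec :: "nat \<Rightarrow> complex vec \<Rightarrow> complex vec" where
  "cremona_vec k v = vec (k + 1) (\<lambda>i. \<Prod>j\<in>{..k} - {i}. v $ j)"

lemma cremona_vec_carrier [simp]: "cremona_vec k v \<in> carrier_vec (k + 1)"
  by (simp add: cremona_vec_def)

lemma cremona_vec_index: "i \<le> k \<Longrightarrow> cremona_vec k v $ i = (\<Prod>j\<in>{..k} - {i}. v $ j)"
  by (simp add: cremona_vec_def)

lemma cremona_vec_times_coord: "i \<le> k \<Longrightarrow> cremona_vec k v $ i * v $ i = (\<Prod>j\<le>k. v $ j)"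
  by (simp add: cremona_vec_index prod.remove[of "{..k}" i] mult.commute)

lemma cremona_vec_smult:
  assumes "v \<in> carrier_vec (k + 1)"
  shows "cremona_vec k (c \<cdot>\<^sub>v v) = c ^ k \<cdot>\<^sub>v cremona_vec k v"
proof (rule eq_vecI)
  fix i assume "i < dim_vec (c ^ k \<cdot>\<^sub>v cremona_vec k v)"
  hence i: "i \<le> k" by (simp add: cremona_vec_def)
  have "(\<Prod>j\<in>{..k} - {i}. (c \<cdot>\<^sub>v v) $ j) = (\<Prod>j\<in>{..k} - {i}. c * v $ j)"
    using assms by (intro prod.cong) auto
  thus "cremona_vec k (c \<cdot>\<^sub>v v) $ i = (c ^ k \<cdot>\<^sub>v cremona_vec k v) $ i"
    using i by (simp add: cremona_vec_def prod.distrib)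
qed (simp add: cremona_vec_def)

text \<open>The condition says that at least two coordinates vanish, which describes the
  indeterminacy set of J.\<close>

lemma cremona_vec_eq_0_iff:
  "cremona_vec k v = 0\<^sub>v (k + 1) \<longleftrightarrow> (\<forall>i\<le>k. \<exists>j\<le>k. j \<noteq> i \<and> v $ j = 0)"
proof -
  have "cremona_vec k v = 0\<^sub>v (k + 1) \<longleftrightarrow> (\<forall>i\<le>k. cremona_vec k v $ i = 0)"
    by (auto simp: cremona_vec_def vec_eq_iff)
  thus ?thesis by (auto simp: cremona_vec_index)
qed

lemma homogeneous_poly_cremona_vec:
  assumes "i \<le> k"
  shows "homogeneous_poly k k (\<lambda>v. cremona_vec k v $ i)"
proof -
  have "homogeneous_poly k (\<Sum>j\<in>{..k} - {i}. 1) (\<lambda>v. \<Prod>j\<in>{..k} - {i}. v $ j)"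
    by (intro homogeneous_poly_prod homogeneous_poly_coord) auto
  thus ?thesis using assms by (simp add: cremona_vec_index)
qed

text \<open>\<open>A\<close> represents S and \<open>B\<close> represents T. Source points are
  written \<open>B *\<^sub>v v\<close>, so that \<open>v\<close> holds the coordinates in the frame
  of the T(e_j) and the map is J followed by \<open>A\<close>.\<close>

locale cremona_pair =
  fixes k :: nat and A B :: "complex mat"
  assumes A: "A \<in> carrier_mat (k + 1) (k + 1)" "invertible_mat A"
    and B: "B \<in> carrier_mat (k + 1) (k + 1)" "invertible_mat B"
begin

abbreviation "F \<equiv> basic_cremona k (proj_map A) (proj_map B)"

definition on_torus :: "ppoint \<rightharpoonup> ppoint" where
  "on_torus p = (if p \<in> proj_map B ` torus k
     then Some (proj_map A (J_torus (inv_into (proj_space k) (proj_map B) p))) else None)"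

lemma F_alt: "F = rational_map k on_torus"
  unfolding basic_cremona_def on_torus_def[abs_def] ..

lemma J_torus_pclass:
  assumes "v \<in> carrier_vec (k + 1)" "\<forall>i\<le>k. v $ i \<noteq> 0"
  shows "J_torus (pclass v) = pclass (cremona_vec k v)"
proof -
  have sm: "map_vec inverse (c \<cdot>\<^sub>v v) = inverse c \<cdot>\<^sub>v map_vec inverse v" for c
    by (rule eq_vecI) auto
  have "J_torus (pclass v) = pclass (map_vec inverse v)"
  proof
    show "J_torus (pclass v) \<subseteq> pclass (map_vec inverse v)"
      unfolding J_torus_def pclass_def by (auto simp: sm)
    show "pclass (map_vec inverse v) \<subseteq> J_torus (pclass v)"
    proof
      fix w assume "w \<in> pclass (map_vec inverse v)"
      then obtain c where c: "c \<noteq> 0" "w = c \<cdot>\<^sub>v map_vec inverse v" unfolding pclass_def by blast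
      hence "w = map_vec inverse (inverse c \<cdot>\<^sub>v v)" by (simp add: sm)
      thus "w \<in> J_torus (pclass v)"
        unfolding J_torus_def pclass_def using c(1) by (intro image_eqI) auto
    qed
  qed
  moreover have "cremona_vec k v = (\<Prod>j\<le>k. v $ j) \<cdot>\<^sub>v map_vec inverse v"
  proof (rule eq_vecI)
    fix i assume "i < dim_vec ((\<Prod>j\<le>k. v $ j) \<cdot>\<^sub>v map_vec inverse v)"
    hence i: "i \<le> k" "i < dim_vec v" using assms(1) by auto
    have "cremona_vec k v $ i = (\<Prod>j\<le>k. v $ j) / v $ i"
      using cremona_vec_times_coord[OF i(1), of v] assms(2) i(1) by (metis nonzero_mult_div_cancel_right)
    thus "cremona_vec k v $ i = ((\<Prod>j\<le>k. v $ j) \<cdot>\<^sub>v map_vec inverse v) $ i"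
      using i(2) by (simp add: divide_inverse)
  qed (use assms(1) in \<open>simp add: cremona_vec_def\<close>)
  moreover have "(\<Prod>j\<le>k. v $ j) \<noteq> 0" using assms by simp
  ultimately show ?thesis by simp
qed

lemma on_torus_value:
  assumes v: "v \<in> carrier_vec (k + 1)" "\<forall>i\<le>k. v $ i \<noteq> 0"
  shows "on_torus (pclass (B *\<^sub>v v)) = Some (pclass (A *\<^sub>v cremona_vec k v))"
proof -
  have "v \<noteq> 0\<^sub>v (k + 1)" using v(2) by (auto intro!: exI[of _ 0])
  hence p: "pclass v \<in> proj_space k" using pclass_in_proj_space_iff v by blast
  have inj: "inj_on (proj_map B) (proj_space k)"
  proof (rule inj_onI)
    fix p q assume "p \<in> proj_space k" "q \<in> proj_space k" and eq: "proj_map B p = proj_map B q"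
    then obtain u w where "u \<in> carrier_vec (k + 1)" "p = pclass u" "w \<in> carrier_vec (k + 1)" "q = pclass w"
      by (meson proj_space_cases)
    thus "p = q" using eq pclass_mult_mat_vec_eq_iff[OF B] by (simp add: proj_map_pclass[OF B(1)])
  qed
  have "pclass (B *\<^sub>v v) = proj_map B (pclass v)" by (simp add: proj_map_pclass[OF B(1) v(1)])
  moreover have "pclass v \<in> torus k" using v by (auto simp: torus_def)
  ultimately show ?thesis
    using inv_into_f_f[OF inj p] J_torus_pclass[OF v] proj_map_pclass[OF A(1) cremona_vec_carrier]
    by (simp add: on_torus_def)
qed

lemma on_torus_domD:
  assumes v: "v \<in> carrier_vec (k + 1)" and dom: "pclass (B *\<^sub>v v) \<in> dom on_torus"
  shows "\<forall>i\<le>k. v $ i \<noteq> 0"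
proof -
  from dom obtain u where u: "u \<in> carrier_vec (k + 1)" "\<forall>i\<le>k. u $ i \<noteq> 0"
    "pclass (B *\<^sub>v v) = proj_map B (pclass u)"
    unfolding on_torus_def torus_def by (auto split: if_splits)
  hence "pclass u = pclass v"
    using pclass_mult_mat_vec_eq_iff[OF B] v by (simp add: proj_map_pclass[OF B(1)])
  then obtain c where "c \<noteq> 0" "v = c \<cdot>\<^sub>v u" unfolding pclass_eq_iff by blast
  thus ?thesis using u by auto
qed

lemma regular_value_cremona_vec:
  assumes v: "v \<in> carrier_vec (k + 1)" and nz: "cremona_vec k v \<noteq> 0\<^sub>v (k + 1)"
    and v0: "v \<noteq> 0\<^sub>v (k + 1)"
  shows "regular_value k on_torus (pclass (B *\<^sub>v v)) (pclass (A *\<^sub>v cremona_vec k v))"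
proof -
  obtain B' where B': "B' \<in> carrier_mat (k + 1) (k + 1)" "B' * B = 1\<^sub>m (k + 1)"
    using invertible_mat_inverse[OF B] by metis
  have inv: "B' *\<^sub>v (B *\<^sub>v w) = w" if "w \<in> carrier_vec (k + 1)" for w
    using that B' B(1) by (metis assoc_mult_mat_vec one_mult_mat_vec)
  define P where "P i u = (A *\<^sub>v cremona_vec k (B' *\<^sub>v u)) $ i" for i u
  have vecP: "vec (k + 1) (\<lambda>i. P i u) = A *\<^sub>v cremona_vec k (B' *\<^sub>v u)" for u
    using A(1) by (intro eq_vecI) (auto simp: P_def)
  have "homogeneous_poly k k (P i)" if i: "i \<le> k" for i
  proof -
    have "homogeneous_poly k k (\<lambda>u. \<Sum>j\<in>{..k}. A $$ (i, j) * cremona_vec k (B' *\<^sub>v u) $ j)"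
      by (intro homogeneous_poly_sum homogeneous_poly_scale
            homogeneous_poly_compose[where f = "\<lambda>v. cremona_vec k v $ _"] homogeneous_poly_cremona_vec B'(1)) auto
    moreover have "P i u = (\<Sum>j\<in>{..k}. A $$ (i, j) * cremona_vec k (B' *\<^sub>v u) $ j)" for u
      unfolding P_def using i A(1)
      by (auto simp: scalar_prod_def cremona_vec_def atLeast0LessThan lessThan_Suc_atMost intro!: sum.cong)
    ultimately show ?thesis by (subst homogeneous_poly_cong) auto
  qed
  moreover have "on_torus (pclass u) = Some (pclass (A *\<^sub>v cremona_vec k (B' *\<^sub>v u)))"
    if u: "u \<in> carrier_vec (k + 1)" and dom: "pclass u \<in> dom on_torus" for u
  proof -
    obtain w where w: "w \<in> carrier_vec (k + 1)" "u = B *\<^sub>v w"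
      using mult_mat_vec_surj[OF B u] .
    show ?thesis using on_torus_value[OF w(1)] on_torus_domD[OF w(1)] dom unfolding w(2) inv[OF w(1)] by blast
  qed
  moreover have "A *\<^sub>v cremona_vec k v \<noteq> 0\<^sub>v (k + 1)" "B *\<^sub>v v \<noteq> 0\<^sub>v (k + 1)" "B *\<^sub>v v \<in> carrier_vec (k + 1)"
    using nz v0 v B(1) mult_mat_vec_eq_0_iff[OF A cremona_vec_carrier] mult_mat_vec_eq_0_iff[OF B v] by simp_all
  moreover from this have "\<exists>u \<in> carrier_vec (k + 1) - {0\<^sub>v (k + 1)}. pclass (B *\<^sub>v v) = pclass u \<and>
      A *\<^sub>v cremona_vec k (B' *\<^sub>v u) \<noteq> 0\<^sub>v (k + 1) \<and>
      pclass (A *\<^sub>v cremona_vec k v) = pclass (A *\<^sub>v cremona_vec k (B' *\<^sub>v u))"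
    by (intro bexI[of _ "B *\<^sub>v v"]) (unfold inv[OF v], blast+)
  ultimately show ?thesis
    unfolding regular_value_def Let_def
    by (intro exI[of _ k] exI[of _ P]) (unfold vecP, blast)
qed

text \<open>If \<open>M\<close> represents the map in the coordinates of the source and target frames, then \<open>x\<^sub>i M\<^sub>i\<close> does not
  depend on \<open>i\<close>, first on the torus and then everywhere by continuity. So \<open>M\<^sub>i\<close> vanishes as soon as another
  coordinate does.\<close>

lemma regular_value_unique:
  assumes v: "v \<in> carrier_vec (k + 1)" "v \<noteq> 0\<^sub>v (k + 1)"
    and reg: "regular_value k on_torus (pclass (B *\<^sub>v v)) q"
  shows "cremona_vec k v \<noteq> 0\<^sub>v (k + 1) \<and> q = pclass (A *\<^sub>v cremona_vec k v)"
proof -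
  from reg[unfolded regular_value_def Let_def] obtain d P where
    hP: "\<forall>i\<le>k. homogeneous_poly k d (P i)" and
    agP: "\<forall>u\<in>carrier_vec (k + 1) - {0\<^sub>v (k + 1)}. pclass u \<in> dom on_torus \<and>
       vec (k + 1) (\<lambda>i. P i u) \<noteq> 0\<^sub>v (k + 1) \<longrightarrow>
       on_torus (pclass u) = Some (pclass (vec (k + 1) (\<lambda>i. P i u)))" and
    exP: "\<exists>u\<in>carrier_vec (k + 1) - {0\<^sub>v (k + 1)}. pclass (B *\<^sub>v v) = pclass u \<and>
       vec (k + 1) (\<lambda>i. P i u) \<noteq> 0\<^sub>v (k + 1) \<and> q = pclass (vec (k + 1) (\<lambda>i. P i u))"
    by blast
  from exP obtain u where
    u: "u \<in> carrier_vec (k + 1)" "pclass (B *\<^sub>v v) = pclass u" "vec (k + 1) (\<lambda>i. P i u) \<noteq> 0\<^sub>v (k + 1)"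
      "q = pclass (vec (k + 1) (\<lambda>i. P i u))" by blast
  have P: "homogeneous_poly k d (P i)" if "i \<le> k" for i using hP that by blast
  have agree: "on_torus (pclass u) = Some (pclass (vec (k + 1) (\<lambda>i. P i u)))"
    if "u \<in> carrier_vec (k + 1)" "u \<noteq> 0\<^sub>v (k + 1)" "pclass u \<in> dom on_torus"
      "vec (k + 1) (\<lambda>i. P i u) \<noteq> 0\<^sub>v (k + 1)" for u
    using agP that by blast
  define \<Phi> where "\<Phi> u = vec (k + 1) (\<lambda>i. P i u)" for u
  obtain A' where A': "A' \<in> carrier_mat (k + 1) (k + 1)" "A' * A = 1\<^sub>m (k + 1)" "A * A' = 1\<^sub>m (k + 1)"
    using invertible_mat_inverse[OF A] by metis
  have inv: "A' *\<^sub>v (A *\<^sub>v w) = w" "A *\<^sub>v (A' *\<^sub>v w) = w" if "w \<in> carrier_vec (k + 1)" for w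
    using that A' A(1) by (metis assoc_mult_mat_vec one_mult_mat_vec)+
  define M where "M w = A' *\<^sub>v \<Phi> (B *\<^sub>v w)" for w
  have Mc: "M w \<in> carrier_vec (k + 1)" for w
    unfolding M_def \<Phi>_def using A'(1) by simp
  have hM: "homogeneous_poly k d (\<lambda>w. M w $ i)" if i: "i \<le> k" for i
  proof -
    have "homogeneous_poly k d (\<lambda>w. \<Sum>j\<in>{..k}. A' $$ (i, j) * P j (B *\<^sub>v w))"
      by (intro homogeneous_poly_sum homogeneous_poly_scale homogeneous_poly_compose P B) auto
    moreover have "M w $ i = (\<Sum>j\<in>{..k}. A' $$ (i, j) * P j (B *\<^sub>v w))" for w
      unfolding M_def \<Phi>_def using i A'(1)
      by (auto simp: scalar_prod_def atLeast0LessThan lessThan_Suc_atMost intro!: sum.cong)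
    ultimately show ?thesis by simp
  qed
  have torus_eq: "M w $ i * w $ i - M w $ j * w $ j = 0"
    if w: "w \<in> carrier_vec (k + 1)" "\<forall>i\<le>k. w $ i \<noteq> 0" and ij: "i \<le> k" "j \<le> k" for w i j
  proof (cases "\<Phi> (B *\<^sub>v w) = 0\<^sub>v (k + 1)")
    case True
    hence "M w = 0\<^sub>v (k + 1)" unfolding M_def using mult_mat_zero_vec[OF A'(1)] by simp
    thus ?thesis using ij by simp
  next
    case False
    have "w \<noteq> 0\<^sub>v (k + 1)" using w(2) by (auto intro!: exI[of _ 0])
    hence "B *\<^sub>v w \<noteq> 0\<^sub>v (k + 1)" using mult_mat_vec_eq_0_iff[OF B w(1)] by simp
    moreover have "B *\<^sub>v w \<in> carrier_vec (k + 1)" using B(1) w(1) by simp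
    ultimately have "pclass (A *\<^sub>v cremona_vec k w) = pclass (\<Phi> (B *\<^sub>v w))"
      using agree[of "B *\<^sub>v w"] on_torus_value[OF w] False unfolding \<Phi>_def by auto
    then obtain c where "\<Phi> (B *\<^sub>v w) = c \<cdot>\<^sub>v (A *\<^sub>v cremona_vec k w)"
      unfolding pclass_eq_iff by blast
    hence "\<Phi> (B *\<^sub>v w) = A *\<^sub>v (c \<cdot>\<^sub>v cremona_vec k w)"
      using mult_mat_vec[OF A(1) cremona_vec_carrier] by simp
    moreover have "c \<cdot>\<^sub>v cremona_vec k w \<in> carrier_vec (k + 1)" using cremona_vec_carrier[of k w] by (simp only: smult_carrier_vec)
    ultimately have "M w = c \<cdot>\<^sub>v cremona_vec k w" unfolding M_def by (simp only: inv)
    hence "M w $ i * w $ i = c * (\<Prod>j\<le>k. w $ j)" if "i \<le> k" for i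
      using that cremona_vec_times_coord[OF that, of w] by (simp add: cremona_vec_def)
    thus ?thesis using ij by simp
  qed
  have rel: "M w $ i * w $ i = M w $ j * w $ j"
    if w: "w \<in> carrier_vec (k + 1)" and ij: "i \<le> k" "j \<le> k" for w i j
  proof -
    \<comment> \<open>Adding the same \<open>s\<close> to all coordinates leaves the torus only if
      \<open>s\<close> is one of the numbers \<open>- w $ l\<close>.\<close>
    define g where "g s = vec (k + 1) (\<lambda>l. w $ l + s)" for s :: complex
    have "g 0 = w" using w by (auto simp: g_def)
    moreover have "M (g 0) $ i * g 0 $ i - M (g 0) $ j * g 0 $ j = 0"
    proof (rule homogeneous_poly_zero_by_continuity
        [where g = g and f = "\<lambda>w. M w $ i * w $ i - M w $ j * w $ j" and X = "(\<lambda>l. - w $ l) ` {..k}"])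
      show "homogeneous_poly k (d + 1) (\<lambda>w. M w $ i * w $ i - M w $ j * w $ j)"
        by (intro homogeneous_poly_diff homogeneous_poly_mult hM homogeneous_poly_coord ij)
      show "M (g s) $ i * g s $ i - M (g s) $ j * g s $ j = 0" if "s \<notin> (\<lambda>l. - w $ l) ` {..k}" for s
      proof (rule torus_eq[OF _ _ ij])
        show "\<forall>i\<le>k. g s $ i \<noteq> 0" using that by (auto simp: g_def add_eq_0_iff image_iff)
      qed (simp add: g_def)
    qed (auto simp: g_def intro!: continuous_intros)
    ultimately show ?thesis by simp
  qed
  have Mzero: "M w $ i = 0"
    if w: "w \<in> carrier_vec (k + 1)" and ij: "i \<le> k" "j \<le> k" "i \<noteq> j" and wj: "w $ j = 0" for w i j
  proof -
    \<comment> \<open>Moving coordinate \<open>i\<close> alone keeps coordinate \<open>j\<close> at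
      0, so \<open>rel\<close> gives \<open>M (g s) $ i * g s $ i = 0\<close> with a nonzero second
      factor.\<close>
    define g where "g s = vec (k + 1) (\<lambda>l. w $ l + (if l = i then s else 0))" for s :: complex
    have "g 0 = w" using w by (auto simp: g_def)
    moreover have "M (g 0) $ i = 0"
    proof (rule homogeneous_poly_zero_by_continuity
        [where g = g and f = "\<lambda>w. M w $ i" and X = "{- w $ i}"])
      show "M (g s) $ i = 0" if "s \<notin> {- w $ i}" for s
      proof -
        have "g s $ j = 0" "g s $ i \<noteq> 0" using that ij wj by (auto simp: g_def add_eq_0_iff)
        moreover have "g s \<in> carrier_vec (k + 1)" by (simp add: g_def)
        ultimately show ?thesis using rel[of "g s" i j] ij by simp
      qed
      show "isCont (\<lambda>s. g s $ l) 0" if "l \<le> k" for l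
        using that by (cases "l = i") (auto simp: g_def)
    qed (auto simp: g_def intro!: hM ij)
    ultimately show ?thesis by simp
  qed
  obtain w where w: "w \<in> carrier_vec (k + 1)" "u = B *\<^sub>v w"
    using mult_mat_vec_surj[OF B u(1)] .
  have "pclass w = pclass v"
    using u(2) pclass_mult_mat_vec_eq_iff[OF B w(1) v(1)] w(2) by simp
  then obtain c where c: "c \<noteq> 0" "v = c \<cdot>\<^sub>v w" unfolding pclass_eq_iff by blast
  have \<Phi>w: "\<Phi> (B *\<^sub>v w) = A *\<^sub>v M w" unfolding M_def by (simp add: inv \<Phi>_def)
  have Mw: "M w \<noteq> 0\<^sub>v (k + 1)"
    using u(3) \<Phi>w mult_mat_zero_vec[OF A(1)] unfolding w(2) \<Phi>_def by auto
  have nz: "cremona_vec k w \<noteq> 0\<^sub>v (k + 1)"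
  proof
    assume "cremona_vec k w = 0\<^sub>v (k + 1)"
    hence "M w $ i = 0" if "i \<le> k" for i
      using Mzero[OF w(1) that] that unfolding cremona_vec_eq_0_iff by metis
    hence "M w = 0\<^sub>v (k + 1)" using Mc[of w] by (intro eq_vecI) auto
    thus False using Mw by simp
  qed
  obtain e where e: "M w = e \<cdot>\<^sub>v cremona_vec k w"
  proof (cases "\<forall>i\<le>k. w $ i \<noteq> 0")
    case True
    define e where "e = M w $ 0 * w $ 0 / (\<Prod>j\<le>k. w $ j)"
    have pr: "(\<Prod>j\<le>k. w $ j) \<noteq> 0" using True by simp
    have "M w $ i = e * cremona_vec k w $ i" if i: "i \<le> k" for i
    proof -
      have "M w $ i * w $ i = e * (\<Prod>j\<le>k. w $ j)" using rel[OF w(1) i, of 0] pr by (simp add: e_def)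
      also have "\<dots> = e * cremona_vec k w $ i * w $ i" using cremona_vec_times_coord[OF i, of w] by simp
      finally show ?thesis using True i by simp
    qed
    hence "M w = e \<cdot>\<^sub>v cremona_vec k w" using Mc[of w] by (intro eq_vecI) (auto simp: cremona_vec_def)
    thus thesis by (rule that)
  next
    case False
    \<comment> \<open>As \<open>cremona_vec k w\<close> is nonzero, \<open>a\<close> is the only
      vanishing coordinate, and both vectors are multiples of the \<open>a\<close>-th unit
      vector.\<close>
    then obtain a where a: "a \<le> k" "w $ a = 0" by blast
    have z: "M w $ i = 0" "cremona_vec k w $ i = 0" if "i \<le> k" "i \<noteq> a" for i
      using Mzero[OF w(1) that(1) a(1) that(2) a(2)] that a by (auto simp: cremona_vec_index)
    have ca: "cremona_vec k w $ a \<noteq> 0"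
    proof
      assume "cremona_vec k w $ a = 0"
      hence "cremona_vec k w $ i = 0" if "i \<le> k" for i using z(2)[OF that] by (cases "i = a") auto
      hence "cremona_vec k w = 0\<^sub>v (k + 1)"
        using cremona_vec_carrier[of k w] by (intro eq_vecI) auto
      thus False using nz by simp
    qed
    have "M w $ i = M w $ a / cremona_vec k w $ a * cremona_vec k w $ i" if "i \<le> k" for i
      using z[OF that] ca by (cases "i = a") auto
    hence "M w = (M w $ a / cremona_vec k w $ a) \<cdot>\<^sub>v cremona_vec k w"
      using Mc[of w] by (intro eq_vecI) (auto simp: cremona_vec_def)
    thus thesis by (rule that)
  qed
  have "0 \<cdot>\<^sub>v cremona_vec k w = 0\<^sub>v (k + 1)" using cremona_vec_carrier[of k w] by (intro eq_vecI) auto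
  hence e0: "e \<noteq> 0" using e Mw by auto
  have "q = pclass (A *\<^sub>v (e \<cdot>\<^sub>v cremona_vec k w))"
    using u(4) \<Phi>w e unfolding w(2) \<Phi>_def by simp
  also have "\<dots> = pclass (A *\<^sub>v cremona_vec k w)"
    using mult_mat_vec[OF A(1) cremona_vec_carrier] e0 by simp
  also have "\<dots> = pclass (A *\<^sub>v cremona_vec k v)"
    unfolding c(2) cremona_vec_smult[OF w(1)] using mult_mat_vec[OF A(1) cremona_vec_carrier] c(1) by simp
  finally have "q = pclass (A *\<^sub>v cremona_vec k v)" .
  moreover have "cremona_vec k v \<noteq> 0\<^sub>v (k + 1)"
    using nz c(1) unfolding c(2) cremona_vec_smult[OF w(1)] by (auto simp: vec_eq_iff)
  ultimately show ?thesis by blast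
qed

text \<open>Together with \<open>F_outside\<close> this removes \<open>regular_value\<close> and the
  maximal extension from the rest of the argument.\<close>

theorem F_value:
  assumes v: "v \<in> carrier_vec (k + 1)" "v \<noteq> 0\<^sub>v (k + 1)"
  shows "F (pclass (B *\<^sub>v v)) =
    (if cremona_vec k v = 0\<^sub>v (k + 1) then None else Some (pclass (A *\<^sub>v cremona_vec k v)))"
proof (cases "cremona_vec k v = 0\<^sub>v (k + 1)")
  case True
  thus ?thesis using regular_value_unique[OF v] by (auto simp: F_alt rational_map_def)
next
  case False
  have "regular_value k on_torus (pclass (B *\<^sub>v v)) q \<longleftrightarrow> q = pclass (A *\<^sub>v cremona_vec k v)" for q
    using regular_value_unique[OF v] regular_value_cremona_vec[OF v(1) False v(2)] by blast
  hence "(\<exists>q. regular_value k on_torus (pclass (B *\<^sub>v v)) q)"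
    "(THE q. regular_value k on_torus (pclass (B *\<^sub>v v)) q) = pclass (A *\<^sub>v cremona_vec k v)" by auto
  thus ?thesis unfolding F_alt rational_map_def using False by simp
qed

lemma F_outside: "p \<notin> proj_space k \<Longrightarrow> F p = None"
  unfolding F_alt rational_map_def regular_value_def Let_def proj_space_def by auto

end

section \<open>The cuspidal curve and its hyperplane sections\<close>

definition monic_with_roots :: "nat \<Rightarrow> (nat \<Rightarrow> complex) \<Rightarrow> complex poly" where
  "monic_with_roots k a = (\<Prod>i\<le>k. [:- a i, 1:])"

lemma poly_monic_with_roots: "poly (monic_with_roots k a) t = (\<Prod>i\<le>k. t - a i)"
  by (simp add: monic_with_roots_def poly_prod)

lemma degree_monic_with_roots: "degree (monic_with_roots k a) = k + 1"
  unfolding monic_with_roots_def by (subst degree_prod_eq_sum_degree) auto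

lemma coeff_monic_with_roots:
  "coeff (monic_with_roots k a) (k + 1) = 1" "coeff (monic_with_roots k a) k = - (\<Sum>i\<le>k. a i)"
proof -
  have "coeff (monic_with_roots k a) (k + 1) = 1 \<and> coeff (monic_with_roots k a) k = - (\<Sum>i\<le>k. a i)"
  proof (induction k)
    case 0
    show ?case by (simp add: monic_with_roots_def)
  next
    case (Suc k)
    have "monic_with_roots (Suc k) a = smult (- a (Suc k)) (monic_with_roots k a) + pCons 0 (monic_with_roots k a)"
      by (simp add: monic_with_roots_def mult.commute)
    moreover have "coeff (monic_with_roots k a) (Suc (Suc k)) = 0"
      by (rule coeff_eq_0) (simp add: degree_monic_with_roots)
    ultimately show ?case using Suc by simp
  qed
  thus "coeff (monic_with_roots k a) (k + 1) = 1" "coeff (monic_with_roots k a) k = - (\<Sum>i\<le>k. a i)" by auto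
qed

definition gexp :: "nat \<Rightarrow> nat \<Rightarrow> nat" where
  "gexp k i = (if i < k then i else k + 1)"

definition gvec :: "nat \<Rightarrow> complex \<Rightarrow> complex vec" where
  "gvec k t = vec (k + 1) (\<lambda>i. t ^ gexp k i)"

lemma \<gamma>_alt: "\<gamma> k t = pclass (gvec k t)"
  unfolding \<gamma>_def gvec_def gexp_def by (rule arg_cong[where f = pclass]) auto

lemma gvec_carrier [simp]: "gvec k t \<in> carrier_vec (k + 1)"
  by (simp add: gvec_def)

lemma gvec_index [simp]: "i \<le> k \<Longrightarrow> gvec k t $ i = t ^ gexp k i"
  by (simp add: gvec_def)

lemma gexp_0 [simp]: "0 < k \<Longrightarrow> gexp k 0 = 0"
  by (simp add: gexp_def)

lemma gvec_nonzero: "0 < k \<Longrightarrow> gvec k t \<noteq> 0\<^sub>v (k + 1)"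
  by (metis gexp_0 gvec_index index_zero_vec(1) le0 add_gr_0 less_one power_0 zero_neq_one)

lemma gvec_eq_smultD:
  assumes "2 \<le> k" "gvec k s = c \<cdot>\<^sub>v gvec k t"
  shows "c = 1" "s = t"
proof -
  have e: "s ^ gexp k i = c * t ^ gexp k i" if "i \<le> k" for i
    using arg_cong[OF assms(2), of "\<lambda>v. v $ i"] that by (simp add: gvec_def)
  show "c = 1" using e[of 0] assms(1) by simp
  thus "s = t" using e[of 1] assms(1) by (simp add: gexp_def)
qed

lemma \<gamma>_inj:
  assumes "2 \<le> k" "\<gamma> k s = \<gamma> k t"
  shows "s = t"
  using assms gvec_eq_smultD unfolding \<gamma>_alt pclass_eq_iff by metis

text \<open>The restrictions of linear forms to the curve.\<close>

definition curve_poly :: "nat \<Rightarrow> complex poly \<Rightarrow> bool" where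
  "curve_poly k f \<longleftrightarrow> degree f \<le> k + 1 \<and> coeff f k = 0"

lemma curve_poly_monom_gexp: "curve_poly k (monom 1 (gexp k i))"
  by (auto simp: curve_poly_def gexp_def degree_monom_eq)

lemma poly_eq_sum_gexp:
  assumes "curve_poly k f"
  shows "poly f t = (\<Sum>i\<le>k. coeff f (gexp k i) * t ^ gexp k i)"
proof -
  have "poly f t = (\<Sum>i\<le>k + 1. coeff f i * t ^ i)"
    unfolding poly_altdef using assms
    by (intro sum.mono_neutral_left) (auto simp: curve_poly_def coeff_eq_0)
  also have "\<dots> = (\<Sum>i<k. coeff f i * t ^ i) + coeff f (k + 1) * t ^ (k + 1)"
    using assms by (simp add: curve_poly_def lessThan_Suc_atMost[symmetric])
  also have "\<dots> = (\<Sum>i\<le>k. coeff f (gexp k i) * t ^ gexp k i)"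
    by (simp add: gexp_def lessThan_Suc_atMost[symmetric])
  finally show ?thesis .
qed

text \<open>A generalized Vandermonde matrix whose column \<open>j\<close> is
  \<open>\<beta> j\<close> times the vector of \<gamma>(p j). The scales \<open>\<beta>\<close> are
  there because the images of the coordinate points fix the columns only up to factors.\<close>

definition center_mat :: "nat \<Rightarrow> (nat \<Rightarrow> complex) \<Rightarrow> (nat \<Rightarrow> complex) \<Rightarrow> complex mat" where
  "center_mat k p \<beta> = mat (k + 1) (k + 1) (\<lambda>(i, j). \<beta> j * p j ^ gexp k i)"

lemma center_mat_carrier [simp]: "center_mat k p \<beta> \<in> carrier_mat (k + 1) (k + 1)"
  by (simp add: center_mat_def)

lemma center_mat_mult_vec_index:
  assumes "v \<in> carrier_vec (k + 1)" "i \<le> k"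
  shows "(center_mat k p \<beta> *\<^sub>v v) $ i = (\<Sum>j\<le>k. \<beta> j * p j ^ gexp k i * v $ j)"
  using assms by (auto simp: center_mat_def scalar_prod_def atLeast0LessThan lessThan_Suc_atMost intro!: sum.cong)

lemma center_mat_mult_vec_eqI:
  assumes "v \<in> carrier_vec (k + 1)" "w \<in> carrier_vec (k + 1)"
    "\<And>i. i \<le> k \<Longrightarrow> (\<Sum>j\<le>k. \<beta> j * p j ^ gexp k i * v $ j) = w $ i"
  shows "center_mat k p \<beta> *\<^sub>v v = w"
proof (rule eq_vecI)
  fix i assume "i < dim_vec w"
  hence i: "i \<le> k" using assms(2) by auto
  show "(center_mat k p \<beta> *\<^sub>v v) $ i = w $ i"
    by (simp only: center_mat_mult_vec_index[OF assms(1) i] assms(3)[OF i])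
qed (use assms(2) in \<open>simp add: center_mat_def\<close>)

lemma center_mat_coord_point:
  assumes "j \<le> k" "\<beta> j \<noteq> 0"
  shows "proj_map (center_mat k p \<beta>) (coord_point k j) = \<gamma> k (p j)"
proof -
  have "col (center_mat k p \<beta>) j = \<beta> j \<cdot>\<^sub>v gvec k (p j)"
    using assms by (intro eq_vecI) (auto simp: center_mat_def gvec_def)
  thus ?thesis using assms coord_point_proj_map[OF center_mat_carrier assms(1)] by (simp add: \<gamma>_alt)
qed

lemma center_mat_of_centers:
  assumes "B \<in> carrier_mat (k + 1) (k + 1)"
    and "\<forall>j\<le>k. proj_map B (coord_point k j) = \<gamma> k (p j)"
  obtains \<beta> where "\<forall>j\<le>k. \<beta> j \<noteq> 0" "B = center_mat k p \<beta>"
proof -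
  have "\<exists>c. c \<noteq> 0 \<and> col B j = c \<cdot>\<^sub>v gvec k (p j)" if "j \<le> k" for j
    using assms(2) that coord_point_proj_map[OF assms(1) that] unfolding \<gamma>_alt by (metis pclass_eq_iff)
  then obtain \<beta> where \<beta>: "\<And>j. j \<le> k \<Longrightarrow> \<beta> j \<noteq> 0 \<and> col B j = \<beta> j \<cdot>\<^sub>v gvec k (p j)" by metis
  have "B $$ (i, j) = \<beta> j * p j ^ gexp k i" if ij: "i \<le> k" "j \<le> k" for i j
  proof -
    have "col B j $ i = B $$ (i, j)" using assms(1) ij by (intro index_col) auto
    thus ?thesis using \<beta>[OF ij(2)] ij(1) by (simp add: gvec_def)
  qed
  hence "B = center_mat k p \<beta>" using assms(1) by (intro eq_matI) (auto simp: center_mat_def)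
  with \<beta> that show ?thesis by blast
qed

text \<open>The determinant is the usual Vandermonde determinant times the sum of the
  \<open>p j\<close> and the product of the \<open>\<beta> j\<close>. Instead of computing it, each
  degeneracy is refuted by a kernel vector: on the right for a zero scale or a repeated parameter,
  on the left for a zero sum.\<close>

lemma center_mat_invertibleD:
  assumes inv: "invertible_mat (center_mat k p \<beta>)"
  shows "inj_on p {..k}" "(\<Sum>j\<le>k. p j) \<noteq> 0" "\<forall>j\<le>k. \<beta> j \<noteq> 0"
proof -
  let ?V = "center_mat k p \<beta>"
  have ker: "v = 0\<^sub>v (k + 1)" if "v \<in> carrier_vec (k + 1)" "\<And>i. i \<le> k \<Longrightarrow> (\<Sum>j\<le>k. \<beta> j * p j ^ gexp k i * v $ j) = 0" for v
  proof -
    have "?V *\<^sub>v v = 0\<^sub>v (k + 1)" by (rule center_mat_mult_vec_eqI) (use that in auto)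
    thus ?thesis using mult_mat_vec_eq_0_iff[OF center_mat_carrier inv] that(1) by blast
  qed
  show \<beta>: "\<forall>j\<le>k. \<beta> j \<noteq> 0"
  proof (intro allI impI notI)
    fix j assume j: "j \<le> k" "\<beta> j = 0"
    have "unit_vec (k + 1) j = (0\<^sub>v (k + 1) :: complex vec)"
    proof (rule ker)
      show "(\<Sum>l\<le>k. \<beta> l * p l ^ gexp k i * unit_vec (k + 1) j $ l) = 0" if "i \<le> k" for i
        using j by (intro sum.neutral) (auto simp: unit_vec_def)
    qed simp
    thus False using j by simp
  qed
  show "inj_on p {..k}"
  proof (rule inj_onI, rule ccontr)
    fix a b assume ab: "a \<in> {..k}" "b \<in> {..k}" "p a = p b" "a \<noteq> b"
    define v where "v = vec (k + 1) (\<lambda>j. if j = a then \<beta> b else if j = b then - \<beta> a else 0)"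
    have "v = 0\<^sub>v (k + 1)"
    proof (rule ker)
      fix i assume "i \<le> k"
      have "(\<Sum>j\<le>k. \<beta> j * p j ^ gexp k i * v $ j) = (\<Sum>j\<in>{a, b}. \<beta> j * p j ^ gexp k i * v $ j)"
        by (rule sum.mono_neutral_right) (use ab in \<open>auto simp: v_def\<close>)
      also have "\<dots> = 0" using ab by (simp add: v_def)
      finally show "(\<Sum>j\<le>k. \<beta> j * p j ^ gexp k i * v $ j) = 0" .
    qed (simp add: v_def)
    hence "v $ a = 0" using ab by simp
    thus False using \<beta> ab by (simp add: v_def)
  qed
  show "(\<Sum>j\<le>k. p j) \<noteq> 0"
  proof
    assume s: "(\<Sum>j\<le>k. p j) = 0"
    \<comment> \<open>With zero sum, \<open>W\<close> has no term of degree \<open>k\<close>, so it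
      is the restriction of a linear form \<open>w\<close> vanishing at all centers. Its leading
      coefficient 1 is the entry \<open>w $ k\<close>.\<close>
    define W where "W = monic_with_roots k p"
    have cp: "curve_poly k W"
      using s by (simp add: curve_poly_def W_def degree_monic_with_roots coeff_monic_with_roots)
    define w where "w = vec (k + 1) (\<lambda>i. coeff W (gexp k i))"
    obtain U where U: "U \<in> carrier_mat (k + 1) (k + 1)" "?V * U = 1\<^sub>m (k + 1)"
      using invertible_mat_inverse[OF center_mat_carrier inv] by metis
    have "w \<bullet> (?V *\<^sub>v u) = 0" if u: "u \<in> carrier_vec (k + 1)" for u
    proof -
      have "w \<bullet> (?V *\<^sub>v u) = (\<Sum>i\<le>k. coeff W (gexp k i) * (\<Sum>j\<le>k. \<beta> j * p j ^ gexp k i * u $ j))"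
        using u by (auto simp: scalar_prod_def w_def center_mat_def[of k p \<beta>] atLeast0LessThan lessThan_Suc_atMost intro!: sum.cong)
      also have "\<dots> = (\<Sum>j\<le>k. \<beta> j * u $ j * (\<Sum>i\<le>k. coeff W (gexp k i) * p j ^ gexp k i))"
        unfolding sum_distrib_left by (subst sum.swap) (simp add: mult_ac)
      also have "\<dots> = (\<Sum>j\<le>k. \<beta> j * u $ j * poly W (p j))"
        unfolding poly_eq_sum_gexp[OF cp] ..
      also have "\<dots> = 0"
        by (intro sum.neutral) (auto simp: W_def poly_monic_with_roots)
      finally show ?thesis .
    qed
    moreover obtain u where "u \<in> carrier_vec (k + 1)" "unit_vec (k + 1) k = ?V *\<^sub>v u"
      using mult_mat_vec_surj[OF center_mat_carrier inv unit_vec_carrier] .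
    ultimately have "w \<bullet> unit_vec (k + 1) k = 0" by metis
    hence "w $ k = 0" by (simp add: w_def)
    thus False by (simp add: w_def W_def gexp_def coeff_monic_with_roots[unfolded Suc_eq_plus1[symmetric]])
  qed
qed

section \<open>Lagrange interpolation on the curve with the centers as nodes\<close>

locale curve_centers =
  fixes k :: nat and p :: "nat \<Rightarrow> complex"
  assumes k: "2 \<le> k" and inj: "inj_on p {..k}" and sum_nonzero: "(\<Sum>j\<le>k. p j) \<noteq> 0"
begin

definition P :: complex where "P = (\<Sum>j\<le>k. p j)"

lemma P_nonzero: "P \<noteq> 0"
  using sum_nonzero by (simp add: P_def)

text \<open>Normalizes \<open>lagrange j\<close> at \<open>p j\<close>, where its extra factor
  \<open>t - p j + P\<close> equals \<open>P\<close>. As leading coefficients of that basis, the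
  \<open>c j\<close> are also the coordinates of the cusp in the frame of the centers.\<close>

definition c :: "nat \<Rightarrow> complex" where
  "c j = inverse (P * (\<Prod>i\<in>{..k} - {j}. p j - p i))"

lemma c_nonzero: "j \<le> k \<Longrightarrow> c j \<noteq> 0"
  using P_nonzero inj by (auto simp: c_def inj_on_def)

text \<open>A linear form vanishing at the other centers, restricted to the curve. The residual root
  \<open>p j - P\<close> makes the roots sum to zero, as \<open>curve_poly\<close> requires.\<close>

definition lagrange :: "nat \<Rightarrow> complex poly" where
  "lagrange j = smult (c j) (monic_with_roots k (p(j := p j - P)))"

lemma prod_fun_upd:
  fixes h :: "complex \<Rightarrow> complex"
  shows "j \<le> k \<Longrightarrow> (\<Prod>i\<le>k. h ((a(j := b)) i)) = h b * (\<Prod>i\<in>{..k} - {j}. h (a i))"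
  by (subst prod.remove[of _ j]) auto

lemma sum_fun_upd:
  fixes a :: "nat \<Rightarrow> complex"
  shows "j \<le> k \<Longrightarrow> (\<Sum>i\<le>k. (a(j := b)) i) = b + (\<Sum>i\<le>k. a i) - a j"
  by (subst (1 2) sum.remove[of _ j]) auto

lemma poly_lagrange:
  "j \<le> k \<Longrightarrow> poly (lagrange j) t = c j * ((t - p j + P) * (\<Prod>i\<in>{..k} - {j}. t - p i))"
  unfolding lagrange_def poly_smult poly_monic_with_roots
  by (subst prod_fun_upd[where h = "\<lambda>x. t - x"]) (auto simp: algebra_simps)

lemma coeff_lagrange:
  "coeff (lagrange j) (k + 1) = c j" "j \<le> k \<Longrightarrow> coeff (lagrange j) k = 0"
  unfolding lagrange_def coeff_smult coeff_monic_with_roots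
  by (simp, subst sum_fun_upd) (auto simp: P_def)

lemma degree_lagrange: "degree (lagrange j) \<le> k + 1"
  unfolding lagrange_def using degree_smult_le degree_monic_with_roots by metis

lemma curve_poly_lagrange: "j \<le> k \<Longrightarrow> curve_poly k (lagrange j)"
  unfolding curve_poly_def using degree_lagrange coeff_lagrange by blast

lemma poly_lagrange_center:
  assumes "i \<le> k" "j \<le> k"
  shows "poly (lagrange j) (p i) = (if i = j then 1 else 0)"
proof (cases "i = j")
  case True
  have "inverse x * x = 1" if "inverse x \<noteq> 0" for x :: complex using that by simp
  from this[OF c_nonzero[OF assms(2), unfolded c_def]] True show ?thesis
    unfolding poly_lagrange[OF assms(2)] c_def by (simp del: inverse_mult_distrib)
next
  case False
  hence "(\<Prod>l\<in>{..k} - {j}. p i - p l) = 0" using assms by (auto intro!: prod_zero)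
  thus ?thesis using False assms by (simp add: poly_lagrange)
qed

text \<open>The \<open>k + 1\<close> roots make \<open>f\<close> a multiple of \<open>W\<close>,
  whose coefficient of degree \<open>k\<close> is \<open>- P\<close>. That coefficient of
  \<open>f\<close> is zero, so the nonzero sum \<open>P\<close> makes up for the one root that the
  degree lacks.\<close>

lemma curve_poly_eq_0:
  assumes "curve_poly k f" "\<And>i. i \<le> k \<Longrightarrow> poly f (p i) = 0"
  shows "f = 0"
proof -
  define W where "W = monic_with_roots k p"
  define a where "a = coeff f (k + 1)"
  define g where "g = f - smult a W"
  have "degree g \<le> k + 1"
    unfolding g_def using assms(1) degree_monic_with_roots[of k p]
    by (intro degree_diff_le) (auto simp: curve_poly_def W_def intro: order_trans[OF degree_smult_le])
  moreover have "coeff g (k + 1) = 0"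
    by (simp only: g_def coeff_diff coeff_smult W_def coeff_monic_with_roots a_def) simp
  ultimately have "degree g \<le> k"
    by (metis Suc_eq_plus1 degree_0 le0 le_SucE leading_coeff_0_iff)
  moreover have "card (p ` {..k}) = k + 1" using inj by (simp add: card_image)
  ultimately have "g = 0"
    by (intro poly_eqI_degree[of "p ` {..k}"]) (auto simp: g_def W_def poly_monic_with_roots assms(2))
  hence "coeff f k = a * coeff W k" by (simp add: g_def)
  hence "a = 0" using assms(1) P_nonzero by (simp add: curve_poly_def W_def coeff_monic_with_roots P_def)
  thus ?thesis using \<open>g = 0\<close> by (simp add: g_def)
qed

lemma lagrange_interpolation:
  assumes f: "curve_poly k f"
  shows "f = (\<Sum>j\<le>k. smult (poly f (p j)) (lagrange j))"
proof -
  have "f - (\<Sum>j\<le>k. smult (poly f (p j)) (lagrange j)) = 0"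
  proof (rule curve_poly_eq_0)
    show "curve_poly k (f - (\<Sum>j\<le>k. smult (poly f (p j)) (lagrange j)))"
      unfolding curve_poly_def
    proof
      have "degree (\<Sum>j\<le>k. smult (poly f (p j)) (lagrange j)) \<le> k + 1"
        by (intro degree_sum_le order_trans[OF degree_smult_le] degree_lagrange) simp
      thus "degree (f - (\<Sum>j\<le>k. smult (poly f (p j)) (lagrange j))) \<le> k + 1"
        using f by (intro degree_diff_le) (auto simp: curve_poly_def)
      show "coeff (f - (\<Sum>j\<le>k. smult (poly f (p j)) (lagrange j))) k = 0"
        using f by (simp add: curve_poly_def coeff_sum coeff_lagrange)
    qed
    fix i assume i: "i \<le> k"
    have "(\<Sum>j\<le>k. poly f (p j) * poly (lagrange j) (p i)) = (\<Sum>j\<le>k. if i = j then poly f (p j) else 0)"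
      using i by (intro sum.cong) (auto simp: poly_lagrange_center)
    thus "poly (f - (\<Sum>j\<le>k. smult (poly f (p j)) (lagrange j))) (p i) = 0"
      using i by (simp add: poly_sum)
  qed
  thus ?thesis by simp
qed

text \<open>The interpolated monomial is compared at \<open>t\<close> and in its top coefficient;
  this expresses \<gamma>(t) and the cusp in the frame of the centers.\<close>

lemma gexp_interpolation:
  assumes "i \<le> k"
  shows "(\<Sum>j\<le>k. p j ^ gexp k i * poly (lagrange j) t) = t ^ gexp k i"
    and "(\<Sum>j\<le>k. p j ^ gexp k i * c j) = (if i = k then 1 else 0)"
proof -
  let ?f = "monom 1 (gexp k i) :: complex poly"
  have "?f = (\<Sum>j\<le>k. smult (p j ^ gexp k i) (lagrange j))"
    using lagrange_interpolation[OF curve_poly_monom_gexp[of k i]] by (simp add: poly_monom)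
  from arg_cong[OF this, of "\<lambda>f. poly f t"] arg_cong[OF this, of "\<lambda>f. coeff f (k + 1)"]
  show "(\<Sum>j\<le>k. p j ^ gexp k i * poly (lagrange j) t) = t ^ gexp k i"
    and "(\<Sum>j\<le>k. p j ^ gexp k i * c j) = (if i = k then 1 else 0)"
    using assms coeff_lagrange(1) by (auto simp: poly_sum poly_monom coeff_sum gexp_def)
qed

text \<open>The rows of the inverse are the coefficients of the Lagrange forms, divided by the
  scales.\<close>

lemma center_mat_invertible:
  assumes "\<forall>j\<le>k. \<beta> j \<noteq> 0"
  shows "invertible_mat (center_mat k p \<beta>)"
proof (rule invertible_matI_left[OF center_mat_carrier])
  let ?U = "mat (k + 1) (k + 1) (\<lambda>(j, i). coeff (lagrange j) (gexp k i) / \<beta> j)"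
  show "?U \<in> carrier_mat (k + 1) (k + 1)" by simp
  show "?U * center_mat k p \<beta> = 1\<^sub>m (k + 1)"
  proof (rule eq_matI)
    fix i j assume "i < dim_row (1\<^sub>m (k + 1) :: complex mat)" "j < dim_col (1\<^sub>m (k + 1) :: complex mat)"
    hence ij: "i \<le> k" "j \<le> k" by auto
    have "(?U * center_mat k p \<beta>) $$ (i, j) =
        (\<Sum>l\<le>k. coeff (lagrange i) (gexp k l) / \<beta> i * (\<beta> j * p j ^ gexp k l))"
      using ij by (simp add: center_mat_def scalar_prod_def atLeast0LessThan lessThan_Suc_atMost)
    also have "\<dots> = \<beta> j / \<beta> i * poly (lagrange i) (p j)"
      unfolding poly_eq_sum_gexp[OF curve_poly_lagrange[OF ij(1)]] sum_distrib_left
      by (intro sum.cong) (auto simp: field_simps)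
    finally show "(?U * center_mat k p \<beta>) $$ (i, j) = 1\<^sub>m (k + 1) $$ (i, j)"
      using ij assms by (simp add: poly_lagrange_center)
  qed (auto simp: center_mat_def)
qed

definition lagrange_vec :: "complex \<Rightarrow> complex vec" where
  "lagrange_vec t = vec (k + 1) (\<lambda>j. poly (lagrange j) t)"

lemma lagrange_vec_carrier [simp]: "lagrange_vec t \<in> carrier_vec (k + 1)"
  by (simp add: lagrange_vec_def)

lemma gvec_eq_center_mat: "center_mat k p (\<lambda>_. 1) *\<^sub>v lagrange_vec t = gvec k t"
proof (rule center_mat_mult_vec_eqI)
  fix i assume i: "i \<le> k"
  have "(\<Sum>j\<le>k. 1 * p j ^ gexp k i * lagrange_vec t $ j) = (\<Sum>j\<le>k. p j ^ gexp k i * poly (lagrange j) t)"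
    by (intro sum.cong) (auto simp: lagrange_vec_def)
  thus "(\<Sum>j\<le>k. 1 * p j ^ gexp k i * lagrange_vec t $ j) = gvec k t $ i"
    using gexp_interpolation(1)[OF i] i by simp
qed (rule lagrange_vec_carrier gvec_carrier)+

lemma cusp_eq_center_mat: "center_mat k p (\<lambda>_. 1) *\<^sub>v vec (k + 1) c = unit_vec (k + 1) k"
proof (rule center_mat_mult_vec_eqI)
  fix i assume i: "i \<le> k"
  have "(\<Sum>j\<le>k. 1 * p j ^ gexp k i * vec (k + 1) c $ j) = (\<Sum>j\<le>k. p j ^ gexp k i * c j)"
    by (intro sum.cong) auto
  thus "(\<Sum>j\<le>k. 1 * p j ^ gexp k i * vec (k + 1) c $ j) = unit_vec (k + 1) k $ i"
    using gexp_interpolation(2)[OF i] i by simp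
qed auto

text \<open>Up to a common factor, the polynomials that are the components of the restriction of J to the
  curve, in the coordinates in which the centers are the coordinate points.\<close>

definition dual :: "nat \<Rightarrow> complex poly" where
  "dual j = monic_with_roots k ((\<lambda>i. p i - P)(j := p j))"

lemma poly_dual:
  "j \<le> k \<Longrightarrow> poly (dual j) t = (t - p j) * (\<Prod>i\<in>{..k} - {j}. t - p i + P)"
  unfolding dual_def poly_monic_with_roots
  by (subst prod_fun_upd[where h = "\<lambda>x. t - x"]) (auto simp: algebra_simps)

text \<open>The roots add up to \<open>- (k - 1) * P\<close>. Compared with a pure power, this
  coefficient yields the translation part.\<close>

lemma coeff_dual:
  "coeff (dual j) (k + 1) = 1" "j \<le> k \<Longrightarrow> coeff (dual j) k = of_nat (k - 1) * P"
proof -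
  show "coeff (dual j) (k + 1) = 1" unfolding dual_def by (rule coeff_monic_with_roots)
  assume "j \<le> k"
  thus "coeff (dual j) k = of_nat (k - 1) * P"
    unfolding dual_def coeff_monic_with_roots using k
    by (subst sum_fun_upd) (auto simp: sum_subtractf P_def[symmetric] of_nat_diff algebra_simps)
qed

lemma degree_dual: "degree (dual j) = k + 1"
  by (simp add: dual_def degree_monic_with_roots)

definition common_factor :: "complex \<Rightarrow> complex" where
  "common_factor t = (\<Prod>i\<le>k. c i) * (\<Prod>i\<le>k. t - p i) ^ (k - 1)"

lemma common_factor_nonzero: "t \<notin> p ` {..k} \<Longrightarrow> common_factor t \<noteq> 0"
  using c_nonzero by (auto simp: common_factor_def)

text \<open>In the product over the \<open>i\<close> other than \<open>j\<close>, the full product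
  \<open>W\<close> of the \<open>t - p i\<close> occurs \<open>k\<close> times and is divided by
  \<open>W / (t - p j)\<close>. This leaves \<open>W ^ (k - 1) * (t - p j)\<close>, whose last
  factor completes the \<open>t - p i + P\<close> to \<open>dual j\<close>.\<close>

lemma cremona_vec_lagrange_vec:
  assumes t: "t \<notin> p ` {..k}" and j: "j \<le> k"
  shows "cremona_vec k (lagrange_vec t) $ j = common_factor t * poly (dual j) t / c j"
proof -
  define W where "W = (\<Prod>i\<le>k. t - p i)"
  have tp: "t - p i \<noteq> 0" if "i \<le> k" for i using t that by auto
  have W: "W \<noteq> 0" using tp by (simp add: W_def)
  have W_rem: "(\<Prod>i\<in>{..k} - {i}. t - p i) = W / (t - p i)" if "i \<le> k" for i
    unfolding W_def using tp[OF that] that by (simp add: prod.remove[of "{..k}" i])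
  have c_rem: "(\<Prod>i\<in>{..k} - {j}. c i) = (\<Prod>i\<le>k. c i) / c j"
    using c_nonzero[OF j] j by (simp add: prod.remove[of "{..k}" j])
  have "cremona_vec k (lagrange_vec t) $ j = (\<Prod>i\<in>{..k} - {j}. c i * ((t - p i + P) * (W / (t - p i))))"
    using j by (auto simp: cremona_vec_index lagrange_vec_def poly_lagrange W_rem intro!: prod.cong)
  also have "\<dots> = (\<Prod>i\<in>{..k} - {j}. c i) * ((\<Prod>i\<in>{..k} - {j}. t - p i + P) *
      (W ^ k / (\<Prod>i\<in>{..k} - {j}. t - p i)))"
    using j by (simp add: prod.distrib prod_dividef)
  also have "\<dots> = (\<Prod>i\<le>k. c i) / c j * ((\<Prod>i\<in>{..k} - {j}. t - p i + P) * (W ^ (k - 1) * (t - p j)))"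
    unfolding c_rem W_rem[OF j] using W tp[OF j] k by (cases k) auto
  finally show ?thesis using j by (simp add: common_factor_def poly_dual W_def)
qed

end

section \<open>The Zariski closure of the curve\<close>

lemma unit_vec_index: "i \<le> k \<Longrightarrow> unit_vec (k + 1) j $ i = (if i = j then 1 else 0)"
  by (simp add: unit_vec_def)

lemma curve_subset_proj_space:
  assumes "2 \<le> k"
  shows "curve k \<subseteq> proj_space k"
proof
  fix p assume "p \<in> curve k"
  then consider "p = pclass (unit_vec (k + 1) k)" | t where "p = pclass (gvec k t)"
    by (auto simp: curve_def curve_reg_def \<gamma>_infinity_def coord_point_def \<gamma>_alt)
  thus "p \<in> proj_space k"
    using pclass_in_proj_space_iff[OF unit_vec_carrier] pclass_in_proj_space_iff[OF gvec_carrier]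
      gvec_nonzero assms by cases auto
qed

lemma vanishes_on_curve:
  assumes f: "homogeneous_poly k d f"
    and "\<And>t. f (gvec k t) = 0" "f (unit_vec (k + 1) k) = 0"
    and "p \<in> curve k" "v \<in> p"
  shows "f v = 0"
proof -
  have "f (c \<cdot>\<^sub>v gvec k t) = 0" for c t
    using homogeneous_poly_smult[OF f gvec_carrier] assms(2) by simp
  moreover have "f (c \<cdot>\<^sub>v unit_vec (k + 1) k) = 0" for c
    using homogeneous_poly_smult[OF f unit_vec_carrier] assms(3) by simp
  ultimately show ?thesis
    using assms(4,5) by (auto simp: curve_def curve_reg_def \<gamma>_infinity_def coord_point_def \<gamma>_alt pclass_def)
qed

lemma curve_dense:
  assumes f: "homogeneous_poly k d f" and Z: "finite Z"
    and van: "\<And>t. t \<notin> Z \<Longrightarrow> f (gvec k t) = 0"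
  shows "f (gvec k t) = 0" "f (unit_vec (k + 1) k) = 0"
proof -
  show "f (gvec k t) = 0" for t
    by (rule homogeneous_poly_zero_by_continuity[OF f _ _ Z, where g = "gvec k"])
       (auto simp: van gvec_carrier[unfolded Suc_eq_plus1[symmetric]])
  \<comment> \<open>The chart at the cusp: \<open>g s\<close> is \<open>gvec k (1 / s)\<close>
    scaled by \<open>s ^ (k + 1)\<close>, hence polynomial in \<open>s\<close>, and it reaches the
    cusp at 0.\<close>
  define g where "g s = vec (k + 1) (\<lambda>i. if i = k then 1 else s ^ (k + 1 - i))" for s :: complex
  have "g 0 = unit_vec (k + 1) k" by (intro eq_vecI) (auto simp: g_def)
  moreover have "f (g 0) = 0"
  proof (rule homogeneous_poly_zero_by_continuity[OF f, where g = g and X = "insert 0 (inverse ` Z)"])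
    show "isCont (\<lambda>s. g s $ i) 0" if "i \<le> k" for i
      using that by (cases "i = k") (auto simp: g_def)
    show "f (g s) = 0" if s: "s \<notin> insert 0 (inverse ` Z)" for s
    proof -
      have "g s = s ^ (k + 1) \<cdot>\<^sub>v gvec k (inverse s)"
      proof (rule eq_vecI)
        fix i assume "i < dim_vec (s ^ (k + 1) \<cdot>\<^sub>v gvec k (inverse s))"
        hence i: "i \<le> k" by (simp add: gvec_def)
        have "s ^ (k + 1) = s ^ (k + 1 - i) * s ^ i" using i by (simp flip: power_add)
        hence "s ^ (k + 1) * inverse s ^ i = s ^ (k + 1 - i)"
          using s by (simp add: power_inverse)
        moreover have "s ^ (k + 1) * inverse s ^ (k + 1) = 1"
          using s by (metis insertCI power_mult_distrib power_one right_inverse)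
        ultimately show "g s $ i = (s ^ (k + 1) \<cdot>\<^sub>v gvec k (inverse s)) $ i"
          using i by (auto simp: g_def gvec_def gexp_def)
      qed (simp add: g_def gvec_def)
      moreover have "inverse s \<notin> Z" using s by (metis image_eqI inverse_inverse_eq insertCI)
      ultimately show ?thesis using homogeneous_poly_smult[OF f gvec_carrier] van by simp
    qed
  qed (use Z in \<open>auto simp: g_def\<close>)
  ultimately show "f (unit_vec (k + 1) k) = 0" by simp
qed

text \<open>\<open>e1\<close> and \<open>e2\<close> describe the curve where coordinate 0 is
  nonzero, with \<open>t = v $ 1 / v $ 0\<close>. Where coordinate 0 vanishes they do not suffice in
  general, and \<open>e3\<close> leaves only the cusp.\<close>

lemma curve_equations:
  assumes k: "2 \<le> k" and v: "v \<in> carrier_vec (k + 1)" "v \<noteq> 0\<^sub>v (k + 1)"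
    and e1: "\<And>i. 0 < i \<Longrightarrow> i < k \<Longrightarrow> v $ i * v $ 0 ^ (i - 1) = v $ 1 ^ i"
    and e2: "v $ k * v $ 0 ^ k = v $ 1 ^ (k + 1)"
    and e3: "\<And>i. 0 < i \<Longrightarrow> i < k \<Longrightarrow> v $ i ^ (k + 1) = v $ k ^ i * v $ 0 ^ (k + 1 - i)"
  shows "pclass v \<in> curve k"
proof (cases "v $ 0 = 0")
  case True
  have "v $ i = 0" if "i < k" for i
  proof (cases "i = 0")
    case False
    hence "v $ i ^ (k + 1) = 0" using e3[of i] that True by simp
    thus ?thesis by auto
  qed (simp add: True)
  hence eq: "v = v $ k \<cdot>\<^sub>v unit_vec (k + 1) k"
    using v(1) by (intro eq_vecI) (auto simp: less_Suc_eq)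
  have "v $ k \<noteq> 0"
  proof
    assume "v $ k = 0"
    hence "v = 0\<^sub>v (k + 1)" using v(1) \<open>\<And>i. i < k \<Longrightarrow> v $ i = 0\<close> by (intro eq_vecI) (auto simp: less_Suc_eq)
    thus False using v(2) by simp
  qed
  hence "pclass v = \<gamma>_infinity k"
    unfolding \<gamma>_infinity_def coord_point_def by (rule trans[OF arg_cong[OF eq, of pclass] pclass_smult])
  thus ?thesis by (simp add: curve_def)
next
  case False
  define t where "t = v $ 1 / v $ 0"
  have v1: "v $ 1 = v $ 0 * t" using False by (simp add: t_def)
  have vi: "v $ i = v $ 0 * t ^ gexp k i" if i: "i \<le> k" for i
  proof -
    consider "i = 0" | "0 < i" "i < k" | "i = k" using i by linarith
    thus ?thesis
    proof cases
      case 2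
      have "v $ i * v $ 0 ^ (i - 1) = v $ 0 * t ^ i * v $ 0 ^ (i - 1)"
        using e1[OF 2] 2 unfolding v1 power_mult_distrib by (cases i) auto
      thus ?thesis using False 2 by (simp add: gexp_def)
    next
      case 3
      have "v $ k * v $ 0 ^ k = v $ 0 * t ^ (k + 1) * v $ 0 ^ k"
        using e2 unfolding v1 power_mult_distrib by simp
      thus ?thesis using False 3 by (simp add: gexp_def)
    qed (use k in simp)
  qed
  have eq: "v = v $ 0 \<cdot>\<^sub>v gvec k t"
  proof (rule eq_vecI)
    fix i assume "i < dim_vec (v $ 0 \<cdot>\<^sub>v gvec k t)"
    hence i: "i \<le> k" by (simp add: gvec_def)
    hence "(v $ 0 \<cdot>\<^sub>v gvec k t) $ i = v $ 0 * t ^ gexp k i" by (simp add: gvec_def)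
    thus "v $ i = (v $ 0 \<cdot>\<^sub>v gvec k t) $ i" by (simp only: vi[OF i])
  qed (use v(1) in \<open>simp add: gvec_def\<close>)
  have "pclass v = \<gamma> k t" unfolding \<gamma>_alt by (rule trans[OF arg_cong[OF eq, of pclass] pclass_smult[OF False]])
  thus ?thesis by (auto simp: curve_def curve_reg_def)
qed

lemma zariski_closure_curve:
  assumes k: "2 \<le> k" and X: "X \<subseteq> curve k" and Z: "finite Z"
    and dense: "\<And>t. t \<notin> Z \<Longrightarrow> \<gamma> k t \<in> X"
  shows "zariski_closure k X = curve k"
proof
  show "curve k \<subseteq> zariski_closure k X"
  proof
    fix p assume p: "p \<in> curve k"
    have "f v = 0" if f: "homogeneous_poly k d f" "\<forall>q\<in>X. \<forall>v\<in>q. f v = 0" and v: "v \<in> p" for d f v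
    proof -
      have "f (gvec k t) = 0" if "t \<notin> Z" for t
        using f(2) dense[OF that] by (auto simp: \<gamma>_alt)
      from vanishes_on_curve[OF f(1) curve_dense[OF f(1) Z this] p v] show ?thesis .
    qed
    thus "p \<in> zariski_closure k X"
      using p curve_subset_proj_space[OF k] unfolding zariski_closure_def by blast
  qed
  show "zariski_closure k X \<subseteq> curve k"
  proof
    fix p assume "p \<in> zariski_closure k X"
    hence ps: "p \<in> proj_space k"
      and cl: "\<And>d f v. homogeneous_poly k d f \<Longrightarrow> (\<And>q v. q \<in> X \<Longrightarrow> v \<in> q \<Longrightarrow> f v = 0) \<Longrightarrow> v \<in> p \<Longrightarrow> f v = 0"
      unfolding zariski_closure_def by blast+
    obtain v where v: "v \<in> carrier_vec (k + 1)" "v \<noteq> 0\<^sub>v (k + 1)" "p = pclass v"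
      using ps by (rule proj_space_cases)
    have van: "f v = 0" if f: "homogeneous_poly k d f" "\<And>t. f (gvec k t) = 0" "f (unit_vec (k + 1) k) = 0" for d f
      by (rule cl[OF f(1)]) (use vanishes_on_curve[OF f] X v(3) in auto)
    have hp: "homogeneous_poly k (a * 1 + b * 1) (\<lambda>v. v $ i ^ a * v $ j ^ b)" if "i \<le> k" "j \<le> k" for i j a b
      by (intro homogeneous_poly_mult homogeneous_poly_power homogeneous_poly_coord that)
    have hp1: "homogeneous_poly k (a * 1) (\<lambda>v. v $ i ^ a)" if "i \<le> k" for i a
      by (intro homogeneous_poly_power homogeneous_poly_coord that)
    let ?e = "unit_vec (k + 1) k :: complex vec"
    show "p \<in> curve k" unfolding v(3)
    proof (rule curve_equations[OF k v(1,2)])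
      fix i assume i: "0 < i" "i < k"
      have "v $ i ^ 1 * v $ 0 ^ (i - 1) - v $ 1 ^ i = 0"
      proof (rule van)
        show "homogeneous_poly k i (\<lambda>v. v $ i ^ 1 * v $ 0 ^ (i - 1) - v $ 1 ^ i)"
          using homogeneous_poly_diff[OF hp[of i 0 1 "i - 1"], of "\<lambda>v. v $ 1 ^ i"] hp1[of 1 i] i k by simp
        show "gvec k t $ i ^ 1 * gvec k t $ 0 ^ (i - 1) - gvec k t $ 1 ^ i = 0" for t
          using i k by (simp add: gexp_def)
        show "?e $ i ^ 1 * ?e $ 0 ^ (i - 1) - ?e $ 1 ^ i = 0"
          using i k by simp
      qed
      thus "v $ i * v $ 0 ^ (i - 1) = v $ 1 ^ i" by simp
      have "v $ i ^ (k + 1) - v $ k ^ i * v $ 0 ^ (k + 1 - i) = 0"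
      proof (rule van)
        show "homogeneous_poly k (k + 1) (\<lambda>v. v $ i ^ (k + 1) - v $ k ^ i * v $ 0 ^ (k + 1 - i))"
          using homogeneous_poly_diff[OF hp1[of i "k + 1"] , of "\<lambda>v. v $ k ^ i * v $ 0 ^ (k + 1 - i)"]
            hp[of k 0 i "k + 1 - i"] i by simp
        show "gvec k t $ i ^ (k + 1) - gvec k t $ k ^ i * gvec k t $ 0 ^ (k + 1 - i) = 0" for t
        proof -
          have "(t ^ i) ^ (k + 1) = (t ^ (k + 1)) ^ i" by (simp only: power_mult[symmetric] mult.commute)
          thus ?thesis using i by (simp add: gexp_def)
        qed
        show "?e $ i ^ (k + 1) - ?e $ k ^ i * ?e $ 0 ^ (k + 1 - i) = 0"
          using i by simp
      qed
      thus "v $ i ^ (k + 1) = v $ k ^ i * v $ 0 ^ (k + 1 - i)" by simp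
    next
      have "v $ k ^ 1 * v $ 0 ^ k - v $ 1 ^ (k + 1) = 0"
      proof (rule van)
        show "homogeneous_poly k (k + 1) (\<lambda>v. v $ k ^ 1 * v $ 0 ^ k - v $ 1 ^ (k + 1))"
          using homogeneous_poly_diff[OF hp[of k 0 1 k], of "\<lambda>v. v $ 1 ^ (k + 1)"] hp1[of 1 "k + 1"] k by simp
        show "gvec k t $ k ^ 1 * gvec k t $ 0 ^ k - gvec k t $ 1 ^ (k + 1) = 0" for t
          using k by (simp add: gexp_def)
        show "?e $ k ^ 1 * ?e $ 0 ^ k - ?e $ 1 ^ (k + 1) = 0"
          using k by simp
      qed
      thus "v $ k * v $ 0 ^ k = v $ 1 ^ (k + 1)" by simp
    qed
  qed
qed

section \<open>Cremona maps that properly fix the curve\<close>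

locale curve_map = curve_centers +
  fixes \<delta> :: complex
  assumes \<delta>_nonzero: "\<delta> \<noteq> 0"
begin

text \<open>Forced by the two top coefficients of the last component of the map: their ratio is
  \<open>(k - 1) * P\<close> for every \<open>dual j\<close>, and
  \<open>(k + 1) * \<tau> / \<delta>\<close> for a multiple of
  \<open>(\<delta> * t + \<tau>) ^ (k + 1)\<close>.\<close>

definition \<tau> :: complex where "\<tau> = \<delta> * of_nat (k - 1) * P / of_nat (k + 1)"

definition q :: "nat \<Rightarrow> complex" where "q j = \<delta> * (p j - P) + \<tau>"

lemma of_nat_k1_nonzero: "(of_nat (k + 1) :: complex) \<noteq> 0"
  by (metis add_is_0 of_nat_eq_0_iff one_neq_zero)

lemma q_alt: "q j = \<delta> * p j - 2 * \<delta> * P / of_nat (k + 1)"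
proof -
  define n :: complex where "n = of_nat (k + 1)"
  have n: "n \<noteq> 0" unfolding n_def by (rule of_nat_k1_nonzero)
  have e: "of_nat (k - 1) = n - 2" using k by (simp add: n_def of_nat_diff)
  show ?thesis unfolding q_def \<tau>_def n_def[symmetric] e using n by (simp add: field_simps)
qed

lemma sum_q: "(\<Sum>j\<le>k. q j) = - \<delta> * P"
proof -
  have "(\<Sum>j\<le>k. q j) = \<delta> * P - of_nat (k + 1) * (2 * \<delta> * P / of_nat (k + 1))"
    unfolding q_alt sum_subtractf sum_distrib_left[symmetric] P_def[symmetric] by simp
  thus ?thesis using of_nat_k1_nonzero by simp
qed

text \<open>The \<open>q j\<close> serve as centers for the inverse map. Since
  \<open>im.P = - \<delta> * P\<close>, their residual parameters \<open>q j - im.P\<close> are the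
  images \<open>\<delta> * p j + \<tau>\<close> of the old centers, so the target forms pull back to
  multiples of the \<open>dual j\<close>.\<close>

sublocale im: curve_centers k q
proof
  show "inj_on q {..k}" using inj \<delta>_nonzero by (auto simp: inj_on_def q_def)
  show "(\<Sum>j\<le>k. q j) \<noteq> 0" using \<delta>_nonzero P_nonzero by (simp add: sum_q)
qed (rule k)

lemma im_P: "im.P = - \<delta> * P"
  unfolding im.P_def sum_q ..

lemma im_c:
  assumes "j \<le> k"
  shows "im.c j * \<delta> ^ (k + 1) = - c j"
proof -
  have "(\<Prod>i\<in>{..k} - {j}. q j - q i) = (\<Prod>i\<in>{..k} - {j}. \<delta> * (p j - p i))"
    by (intro prod.cong) (auto simp: q_def algebra_simps)
  also have "\<dots> = \<delta> ^ k * (\<Prod>i\<in>{..k} - {j}. p j - p i)" using assms by (simp add: prod.distrib)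
  finally have "im.P * (\<Prod>i\<in>{..k} - {j}. q j - q i) =
      - (\<delta> ^ (k + 1) * (P * (\<Prod>i\<in>{..k} - {j}. p j - p i)))" by (simp add: im_P)
  thus ?thesis unfolding c_def im.c_def using \<delta>_nonzero by (simp add: field_simps)
qed

lemma poly_im_lagrange:
  assumes j: "j \<le> k"
  shows "poly (im.lagrange j) (\<delta> * t + \<tau>) = - c j * poly (dual j) t"
proof -
  have "(\<Prod>i\<in>{..k} - {j}. \<delta> * t + \<tau> - q i) = (\<Prod>i\<in>{..k} - {j}. \<delta> * (t - p i + P))"
    by (intro prod.cong) (auto simp: q_def algebra_simps)
  also have "\<dots> = \<delta> ^ k * (\<Prod>i\<in>{..k} - {j}. t - p i + P)" using j by (simp add: prod.distrib)
  finally have 1: "(\<Prod>i\<in>{..k} - {j}. \<delta> * t + \<tau> - q i) = \<delta> ^ k * (\<Prod>i\<in>{..k} - {j}. t - p i + P)" .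
  have 2: "\<delta> * t + \<tau> - q j + im.P = \<delta> * (t - p j)"
    by (simp add: q_def im_P algebra_simps)
  have "poly (im.lagrange j) (\<delta> * t + \<tau>) =
      (im.c j * \<delta> ^ (k + 1)) * ((t - p j) * (\<Prod>i\<in>{..k} - {j}. t - p i + P))"
    unfolding im.poly_lagrange[OF j] 1 2 by (simp add: mult_ac)
  thus ?thesis unfolding im_c[OF j] poly_dual[OF j] .
qed

text \<open>Of the two factors \<open>c j\<close> one cancels the \<open>1 / c j\<close> in
  \<open>cremona_vec_lagrange_vec\<close>; the other turns \<open>dual j\<close> into the Lagrange
  form of the target frame, up to sign.\<close>

abbreviation "SM \<equiv> center_mat k q (\<lambda>j. c j ^ 2)"
abbreviation "TM \<equiv> center_mat k p (\<lambda>_. 1)"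

sublocale cremona_pair k SM TM
proof
  show "invertible_mat SM" by (rule im.center_mat_invertible) (simp add: c_nonzero)
  show "invertible_mat TM" by (rule center_mat_invertible) simp
qed (rule center_mat_carrier)+

lemma curve_values:
  assumes "v \<in> carrier_vec (k + 1)" "v \<noteq> 0\<^sub>v (k + 1)" "m \<noteq> 0"
    "SM *\<^sub>v cremona_vec k v = m \<cdot>\<^sub>v w" "w \<noteq> 0\<^sub>v (k + 1)" "w \<in> carrier_vec (k + 1)"
  shows "F (pclass (TM *\<^sub>v v)) = Some (pclass w)"
proof -
  have "m \<cdot>\<^sub>v w \<noteq> 0\<^sub>v (k + 1)" using assms(3,5,6) by (auto simp: vec_eq_iff)
  hence "cremona_vec k v \<noteq> 0\<^sub>v (k + 1)" using assms(4) mult_mat_zero_vec[OF A(1)] by auto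
  thus ?thesis using F_value[OF assms(1,2)] assms(3,4) by simp
qed

lemma F_\<gamma>:
  assumes t: "t \<notin> p ` {..k}"
  shows "F (\<gamma> k t) = Some (\<gamma> k (\<delta> * t + \<tau>))"
  unfolding \<gamma>_alt gvec_eq_center_mat[symmetric, of t]
proof (rule curve_values[OF lagrange_vec_carrier, of _ "- common_factor t"])
  have k0: "0 < k" using k by simp
  show "lagrange_vec t \<noteq> 0\<^sub>v (k + 1)"
    using gvec_nonzero[OF k0, of t] gvec_eq_center_mat[of t] mult_mat_zero_vec[OF B(1)] by auto
  show "- common_factor t \<noteq> 0" using common_factor_nonzero[OF t] by simp
  show "gvec k (\<delta> * t + \<tau>) \<noteq> 0\<^sub>v (k + 1)" by (rule gvec_nonzero[OF k0])
  show "SM *\<^sub>v cremona_vec k (lagrange_vec t) = - common_factor t \<cdot>\<^sub>v gvec k (\<delta> * t + \<tau>)"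
  proof (rule center_mat_mult_vec_eqI)
    fix i assume i: "i \<le> k"
    have "(\<Sum>j\<le>k. c j ^ 2 * q j ^ gexp k i * cremona_vec k (lagrange_vec t) $ j) =
        - common_factor t * (\<Sum>j\<le>k. q j ^ gexp k i * poly (im.lagrange j) (\<delta> * t + \<tau>))"
      unfolding sum_distrib_left
      using c_nonzero by (intro sum.cong)
        (auto simp: cremona_vec_lagrange_vec[OF t] poly_im_lagrange power2_eq_square)
    also have "\<dots> = - common_factor t * (\<delta> * t + \<tau>) ^ gexp k i"
      by (simp only: im.gexp_interpolation(1)[OF i])
    finally show "(\<Sum>j\<le>k. c j ^ 2 * q j ^ gexp k i * cremona_vec k (lagrange_vec t) $ j) =
        (- common_factor t \<cdot>\<^sub>v gvec k (\<delta> * t + \<tau>)) $ i"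
      using i by (simp add: gvec_def)
  qed (simp_all only: cremona_vec_carrier smult_carrier_vec gvec_carrier)
qed (rule gvec_carrier)

lemma F_center:
  assumes j: "j \<le> k"
  shows "F (\<gamma> k (p j)) = None"
proof -
  have u: "lagrange_vec (p j) = unit_vec (k + 1) j"
    using j by (intro eq_vecI) (auto simp: lagrange_vec_def poly_lagrange_center)
  have "cremona_vec k (unit_vec (k + 1) j) = 0\<^sub>v (k + 1)"
    unfolding cremona_vec_eq_0_iff
  proof (intro allI impI)
    fix i assume "i \<le> k"
    \<comment> \<open>A vanishing coordinate other than \<open>i\<close>; as it must also differ
      from \<open>j\<close>, three candidates are needed, and \<open>k \<ge> 2\<close> provides
      them.\<close>
    define l :: nat where "l = (if 0 \<notin> {i, j} then 0 else if 1 \<notin> {i, j} then 1 else 2)"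
    have "l \<le> k" "l \<notin> {i, j}" using k by (auto simp: l_def)
    moreover from this have "(unit_vec (k + 1) j :: complex vec) $ l = 0"
      using unit_vec_index[of l k j] by simp
    ultimately show "\<exists>l\<le>k. l \<noteq> i \<and> (unit_vec (k + 1) j :: complex vec) $ l = 0" by blast
  qed
  thus ?thesis
    using F_value[OF lagrange_vec_carrier, of "p j"] gvec_eq_center_mat[of "p j"] u j
    by (simp add: \<gamma>_alt)
qed

text \<open>Keeps the image inside the curve in \<open>proper_transform_curve\<close>. Inverting the
  coordinates \<open>c j\<close> and multiplying by \<open>c j ^ 2\<close> returns multiples of
  \<open>c j\<close>, which by \<open>im_c\<close> are proportional to the coordinates of the cusp
  in the target frame.\<close>

lemma F_cusp: "F (\<gamma>_infinity k) = Some (\<gamma>_infinity k)"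
  unfolding \<gamma>_infinity_def coord_point_def
proof (subst cusp_eq_center_mat[symmetric], rule curve_values[of _ "- (\<Prod>i\<le>k. c i) * \<delta> ^ (k + 1)"])
  show "vec (k + 1) c \<in> carrier_vec (k + 1)" by simp
  show "vec (k + 1) c \<noteq> 0\<^sub>v (k + 1)"
    using c_nonzero[of 0] by (auto simp: vec_eq_iff intro!: exI[of _ 0])
  show "- (\<Prod>i\<le>k. c i) * \<delta> ^ (k + 1) \<noteq> 0" using c_nonzero \<delta>_nonzero by simp
  show "unit_vec (k + 1) k \<noteq> (0\<^sub>v (k + 1) :: complex vec)" by simp
  show "SM *\<^sub>v cremona_vec k (vec (k + 1) c) = (- (\<Prod>i\<le>k. c i) * \<delta> ^ (k + 1)) \<cdot>\<^sub>v unit_vec (k + 1) k"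
  proof (rule center_mat_mult_vec_eqI)
    fix i assume i: "i \<le> k"
    have "cremona_vec k (vec (k + 1) c) $ j = (\<Prod>i\<le>k. c i) / c j" if "j \<le> k" for j
    proof -
      have "cremona_vec k (vec (k + 1) c) $ j = (\<Prod>i\<in>{..k} - {j}. c i)"
        using that by (auto simp: cremona_vec_index intro!: prod.cong)
      thus ?thesis using c_nonzero[OF that] that by (simp add: prod.remove[of "{..k}" j])
    qed
    hence "(\<Sum>j\<le>k. c j ^ 2 * q j ^ gexp k i * cremona_vec k (vec (k + 1) c) $ j) =
        (\<Sum>j\<le>k. c j * q j ^ gexp k i * (\<Prod>i\<le>k. c i))"
      using c_nonzero by (intro sum.cong) (auto simp: power2_eq_square)
    also have "\<dots> = (\<Sum>j\<le>k. (im.c j * \<delta> ^ (k + 1)) * q j ^ gexp k i * (- (\<Prod>i\<le>k. c i)))"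
      by (intro sum.cong refl) (simp only: im_c atMost_iff, simp)
    also have "\<dots> = - (\<Prod>i\<le>k. c i) * \<delta> ^ (k + 1) * (\<Sum>j\<le>k. q j ^ gexp k i * im.c j)"
      unfolding sum_distrib_left by (intro sum.cong) (simp_all add: mult_ac)
    finally show "(\<Sum>j\<le>k. c j ^ 2 * q j ^ gexp k i * cremona_vec k (vec (k + 1) c) $ j) =
        ((- (\<Prod>i\<le>k. c i) * \<delta> ^ (k + 1)) \<cdot>\<^sub>v unit_vec (k + 1) k) $ i"
      unfolding im.gexp_interpolation(2)[OF i] using i by simp
  qed (simp_all only: cremona_vec_carrier smult_carrier_vec unit_vec_carrier)
qed (rule unit_vec_carrier)

end

section \<open>The proper transform of the curve, and the outer matrix for given centers\<close>

context curve_map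
begin

lemma \<gamma>_indeterminacy_iff: "\<gamma> k t \<in> indeterminacy k F \<longleftrightarrow> t \<in> p ` {..k}"
proof -
  have "\<gamma> k t \<in> proj_space k"
    using curve_subset_proj_space[OF k] by (auto simp: curve_def curve_reg_def)
  thus ?thesis
    using F_\<gamma>[of t] F_center by (auto simp: indeterminacy_def)
qed

lemma proper_transform_curve: "proper_transform k F (curve k) = curve k"
  unfolding proper_transform_def
\<comment> \<open>The image may miss the points of the curve whose parameter comes from a
  center.\<close>
proof (rule zariski_closure_curve[OF k, where Z = "(\<lambda>t. \<delta> * t + \<tau>) ` p ` {..k}"])
  show "{q. \<exists>x\<in>curve k - indeterminacy k F. F x = Some q} \<subseteq> curve k"
  proof clarify
    fix q x assume x: "x \<in> curve k" "x \<notin> indeterminacy k F" "F x = Some q"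
    show "q \<in> curve k"
    proof (cases "x = \<gamma>_infinity k")
      case True
      thus ?thesis using x(3) F_cusp by (simp add: curve_def)
    next
      case False
      then obtain t where t: "x = \<gamma> k t" using x(1) by (auto simp: curve_def curve_reg_def)
      hence "t \<notin> p ` {..k}" using x(2) \<gamma>_indeterminacy_iff by simp
      thus ?thesis using x(3) F_\<gamma>[of t] unfolding t by (auto simp: curve_def curve_reg_def)
    qed
  qed
  fix t assume t: "t \<notin> (\<lambda>t. \<delta> * t + \<tau>) ` p ` {..k}"
  define s where "s = (t - \<tau>) / \<delta>"
  have "t = \<delta> * s + \<tau>" using \<delta>_nonzero by (simp add: s_def)
  moreover from this have "s \<notin> p ` {..k}" using t by blast
  ultimately show "\<gamma> k t \<in> {q. \<exists>x\<in>curve k - indeterminacy k F. F x = Some q}"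
    using F_\<gamma>[of s] \<gamma>_indeterminacy_iff[of s]
    by (auto simp: curve_def curve_reg_def intro!: bexI[of _ "\<gamma> k s"])
qed simp

lemma F_has_multiplier: "has_multiplier k F \<delta>"
  unfolding has_multiplier_def using \<delta>_nonzero F_\<gamma> \<gamma>_indeterminacy_iff by blast

text \<open>Replacing the coordinates x j of the source by x j / \<alpha> j is absorbed by rescaling the columns of the
  outer matrix, because J conjugates a diagonal matrix to its inverse.\<close>

lemma F_scaled:
  assumes \<alpha>: "\<forall>j\<le>k. \<alpha> j \<noteq> 0" and m: "m \<noteq> 0"
  shows "basic_cremona k (proj_map (center_mat k q (\<lambda>j. m * c j ^ 2 / \<alpha> j)))
    (proj_map (center_mat k p \<alpha>)) = F"
proof -
  let ?A = "center_mat k q (\<lambda>j. m * c j ^ 2 / \<alpha> j)" and ?B = "center_mat k p \<alpha>"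
  interpret s: cremona_pair k ?A ?B
  proof
    show "invertible_mat ?A" by (rule im.center_mat_invertible) (use \<alpha> m c_nonzero in auto)
    show "invertible_mat ?B" by (rule center_mat_invertible) (rule \<alpha>)
  qed (rule center_mat_carrier)+
  have "s.F x = F x" for x
  proof (cases "x \<in> proj_space k")
    case False
    thus ?thesis by (simp add: F_outside s.F_outside)
  next
    case True
    then obtain v where v: "v \<in> carrier_vec (k + 1)" "v \<noteq> 0\<^sub>v (k + 1)" "x = pclass (?B *\<^sub>v v)"
      using proj_space_proj_map_cases[OF s.B] by metis
    define v' where "v' = vec (k + 1) (\<lambda>j. \<alpha> j * v $ j)"
    have v': "v' \<in> carrier_vec (k + 1)" by (simp add: v'_def)
    have Bv: "?B *\<^sub>v v \<in> carrier_vec (k + 1)" by (rule mult_mat_vec_carrier[OF center_mat_carrier v(1)])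
    have TM: "TM *\<^sub>v v' = ?B *\<^sub>v v"
    proof (rule center_mat_mult_vec_eqI[OF v' Bv])
      fix i assume i: "i \<le> k"
      show "(\<Sum>j\<le>k. 1 * p j ^ gexp k i * v' $ j) = (?B *\<^sub>v v) $ i"
        unfolding center_mat_mult_vec_index[OF v(1) i] by (intro sum.cong) (auto simp: v'_def)
    qed
    have v'0: "v' \<noteq> 0\<^sub>v (k + 1)"
      using TM mult_mat_vec_eq_0_iff[OF s.B v(1)] v(2) mult_mat_zero_vec[OF B(1)] by auto
    define a where "a = (\<Prod>j\<le>k. \<alpha> j)"
    have a: "a \<noteq> 0" using \<alpha> by (simp add: a_def)
    have cv: "cremona_vec k v' $ j = a / \<alpha> j * cremona_vec k v $ j" if j: "j \<le> k" for j
    proof -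
      have "cremona_vec k v' $ j = (\<Prod>i\<in>{..k} - {j}. \<alpha> i) * cremona_vec k v $ j"
        unfolding cremona_vec_index[OF j] prod.distrib[symmetric] by (intro prod.cong) (auto simp: v'_def)
      thus ?thesis using \<alpha> j by (simp add: a_def prod.remove[of "{..k}" j])
    qed
    have cv0: "cremona_vec k v' = 0\<^sub>v (k + 1) \<longleftrightarrow> cremona_vec k v = 0\<^sub>v (k + 1)"
    proof -
      have "v' $ j = 0 \<longleftrightarrow> v $ j = 0" if "j \<le> k" for j using \<alpha> that by (simp add: v'_def)
      thus ?thesis unfolding cremona_vec_eq_0_iff by blast
    qed
    have cvc: "?A *\<^sub>v cremona_vec k v \<in> carrier_vec (k + 1)"
      by (rule mult_mat_vec_carrier[OF center_mat_carrier cremona_vec_carrier])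
    have "SM *\<^sub>v cremona_vec k v' = (a / m) \<cdot>\<^sub>v (?A *\<^sub>v cremona_vec k v)"
    proof (rule center_mat_mult_vec_eqI[OF cremona_vec_carrier])
      show "(a / m) \<cdot>\<^sub>v (?A *\<^sub>v cremona_vec k v) \<in> carrier_vec (k + 1)"
        using cvc by (simp only: smult_carrier_vec)
      fix i assume i: "i \<le> k"
      have "((a / m) \<cdot>\<^sub>v (?A *\<^sub>v cremona_vec k v)) $ i = a / m * (?A *\<^sub>v cremona_vec k v) $ i"
        by (rule index_smult_vec(1)) (unfold carrier_vecD[OF cvc], use i in simp)
      also have "\<dots> = (\<Sum>j\<le>k. c j ^ 2 * q j ^ gexp k i * cremona_vec k v' $ j)"
        unfolding center_mat_mult_vec_index[OF cremona_vec_carrier i] sum_distrib_left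
        using m by (intro sum.cong) (auto simp: cv)
      finally show "(\<Sum>j\<le>k. c j ^ 2 * q j ^ gexp k i * cremona_vec k v' $ j) =
          ((a / m) \<cdot>\<^sub>v (?A *\<^sub>v cremona_vec k v)) $ i" by simp
    qed
    hence "pclass (SM *\<^sub>v cremona_vec k v') = pclass (?A *\<^sub>v cremona_vec k v)" using a m by simp
    thus ?thesis
      using F_value[OF v' v'0] s.F_value[OF v(1,2)] cv0 unfolding TM v(3) by simp
  qed
  thus ?thesis by blast
qed

text \<open>Along the curve the components of the map are polynomials \<open>M\<^sub>i\<close> with \<open>M\<^sub>i = M\<^sub>0 (\<delta>t + \<tau>')\<^sup>e\<close>, where \<open>e\<close> is
  the exponent \<open>gexp k i\<close>. All \<open>M\<^sub>i\<close> have degree at most \<open>k + 1\<close>, so \<open>M\<^sub>0\<close> is constant. The values at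
  \<open>p\<^sub>j - P\<close> then give the columns of the matrix, and the two top coefficients of \<open>M\<^sub>k\<close> give \<open>\<tau>'\<close>.\<close>

lemma outer_matrix_determined:
  assumes A: "A \<in> carrier_mat (k + 1) (k + 1)" "invertible_mat A"
    and \<alpha>: "\<forall>j\<le>k. \<alpha> j \<noteq> 0"
    and mult: "has_multiplier k (basic_cremona k (proj_map A) (proj_map (center_mat k p \<alpha>))) \<delta>"
  obtains m where "m \<noteq> 0" "A = center_mat k q (\<lambda>j. m * c j ^ 2 / \<alpha> j)"
proof -
  let ?B = "center_mat k p \<alpha>"
  interpret s: cremona_pair k A ?B
    by unfold_locales (use A center_mat_invertible[OF \<alpha>] center_mat_carrier in blast)+
  from mult obtain \<tau>' where mult': "\<And>t. \<gamma> k t \<notin> indeterminacy k s.F \<Longrightarrow> s.F (\<gamma> k t) = Some (\<gamma> k (\<delta> * t + \<tau>'))"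
    unfolding has_multiplier_def by blast
  define M where "M i = (\<Sum>j\<le>k. smult (A $$ (i, j) * \<alpha> j / c j) (dual j))" for i
  define L where "L = [:\<tau>', \<delta>:]"
  \<comment> \<open>Outside \<open>Z\<close> the parameter is not a center and \<open>dual 0\<close>
    does not vanish, so the map is defined at \<gamma>(t).\<close>
  define Z where "Z = p ` {..k} \<union> (\<lambda>i. p i - P) ` {..k}"
  have k0: "gexp k 0 = 0" using k by simp
  have on_line: "poly (M i) t = poly (M 0) t * poly L t ^ gexp k i" if t: "t \<notin> Z" and i: "i \<le> k" for t i
  proof -
    define v where "v = vec (k + 1) (\<lambda>j. poly (lagrange j) t / \<alpha> j)"
    define a where "a = common_factor t / (\<Prod>j\<le>k. \<alpha> j)"
    have tp: "t \<notin> p ` {..k}" using t by (simp add: Z_def)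
    have a: "a \<noteq> 0" using common_factor_nonzero[OF tp] \<alpha> by (simp add: a_def)
    have v: "v \<in> carrier_vec (k + 1)" by (simp add: v_def)
    have Bv: "?B *\<^sub>v v = gvec k t"
    proof (rule center_mat_mult_vec_eqI[OF v gvec_carrier])
      fix i assume i: "i \<le> k"
      have "(\<Sum>j\<le>k. \<alpha> j * p j ^ gexp k i * v $ j) = (\<Sum>j\<le>k. p j ^ gexp k i * poly (lagrange j) t)"
        using \<alpha> by (intro sum.cong) (auto simp: v_def)
      thus "(\<Sum>j\<le>k. \<alpha> j * p j ^ gexp k i * v $ j) = gvec k t $ i"
        using gexp_interpolation(1)[OF i] i by simp
    qed
    have v0: "v \<noteq> 0\<^sub>v (k + 1)"
      using Bv gvec_nonzero[of k t] k mult_mat_zero_vec[OF s.B(1)] by auto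
    have cv: "cremona_vec k v $ j = a * (\<alpha> j / c j * poly (dual j) t)" if j: "j \<le> k" for j
    proof -
      have "cremona_vec k v $ j = (\<Prod>i\<in>{..k} - {j}. lagrange_vec t $ i / \<alpha> i)"
        unfolding cremona_vec_index[OF j] by (intro prod.cong) (auto simp: v_def lagrange_vec_def)
      also have "\<dots> = cremona_vec k (lagrange_vec t) $ j / (\<Prod>i\<in>{..k} - {j}. \<alpha> i)"
        by (simp only: prod_dividef cremona_vec_index[OF j])
      finally show ?thesis using \<alpha> j
        by (simp add: cremona_vec_lagrange_vec[OF tp j] a_def prod.remove[of "{..k}" j])
    qed
    have "poly (dual 0) t \<noteq> 0"
      using t by (auto simp: poly_dual Z_def algebra_simps image_iff)
    hence "cremona_vec k v $ 0 \<noteq> 0" using cv[of 0] a \<alpha> c_nonzero[of 0] by simp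
    hence cv0: "cremona_vec k v \<noteq> 0\<^sub>v (k + 1)" by auto
    have Fv: "s.F (\<gamma> k t) = Some (pclass (A *\<^sub>v cremona_vec k v))"
      using s.F_value[OF v v0] cv0 unfolding Bv \<gamma>_alt by simp
    hence "\<gamma> k t \<notin> indeterminacy k s.F" by (auto simp: indeterminacy_def)
    from mult'[OF this] Fv have "pclass (gvec k (\<delta> * t + \<tau>')) = pclass (A *\<^sub>v cremona_vec k v)"
      by (simp add: \<gamma>_alt)
    then obtain e where e: "A *\<^sub>v cremona_vec k v = e \<cdot>\<^sub>v gvec k (\<delta> * t + \<tau>')"
      unfolding pclass_eq_iff by blast
    have "a * poly (M i) t = e * poly L t ^ gexp k i" if i: "i \<le> k" for i
    proof -
      have "(A *\<^sub>v cremona_vec k v) $ i = (\<Sum>j\<le>k. A $$ (i, j) * cremona_vec k v $ j)"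
        using A(1) i by (auto simp: scalar_prod_def cremona_vec_def atLeast0LessThan lessThan_Suc_atMost intro!: sum.cong)
      also have "\<dots> = a * poly (M i) t"
        unfolding M_def poly_sum sum_distrib_left by (intro sum.cong) (auto simp: cv)
      finally show ?thesis using e i by (simp add: gvec_def L_def mult.commute add.commute)
    qed
    from this[OF i] this[of 0] have "a * poly (M i) t = a * (poly (M 0) t * poly L t ^ gexp k i)"
      using k0 by (simp add: mult.assoc[symmetric])
    thus ?thesis using a by simp
  qed
  have M: "M i = M 0 * L ^ gexp k i" if i: "i \<le> k" for i
  proof (rule ccontr)
    assume "M i \<noteq> M 0 * L ^ gexp k i"
    hence "finite {t. poly (M i - M 0 * L ^ gexp k i) t = 0}" by (intro poly_roots_finite) simp
    moreover have "- Z \<subseteq> {t. poly (M i - M 0 * L ^ gexp k i) t = 0}" using on_line[OF _ i] by auto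
    ultimately have "finite (- Z)" by (rule finite_subset[rotated])
    moreover have "finite Z" by (simp add: Z_def)
    ultimately have "finite (Z \<union> - Z)" by (rule finite_UnI[rotated])
    thus False using infinite_UNIV_char_0[where 'a = complex] by simp
  qed
  \<comment> \<open>At \<open>p j - P\<close> every other \<open>dual l\<close> has a zero factor,
    and \<open>dual j\<close> equals \<open>- inverse (c j)\<close>, so a single entry of
    \<open>A\<close> survives.\<close>
  have M_value: "poly (M i) (p j - P) = - (A $$ (i, j) * \<alpha> j / c j ^ 2)" if j: "j \<le> k" for i j
  proof -
    have d0: "poly (dual l) (p j - P) = 0" if "l \<le> k" "l \<noteq> j" for l
    proof -
      have "(\<Prod>i\<in>{..k} - {l}. p j - P - p i + P) = 0" using that j by (auto intro!: prod_zero)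
      thus ?thesis using that by (simp add: poly_dual)
    qed
    have "(\<Prod>i\<in>{..k} - {j}. p j - P - p i + P) = (\<Prod>i\<in>{..k} - {j}. p j - p i)" by (intro prod.cong) auto
    hence d1: "poly (dual j) (p j - P) = - inverse (c j)"
      by (simp add: poly_dual[OF j] c_def)
    have "poly (M i) (p j - P) = A $$ (i, j) * \<alpha> j / c j * poly (dual j) (p j - P)"
      unfolding M_def poly_sum using j d0 by (subst sum.remove[of _ j]) auto
    thus ?thesis unfolding d1 by (simp add: power2_eq_square divide_inverse)
  qed
  have L_alt: "L = smult \<delta> [:- (- \<tau>' / \<delta>), 1:]" using \<delta>_nonzero by (simp add: L_def)
  \<comment> \<open>Written with all roots equal, so that \<open>coeff_monic_with_roots\<close>
    gives the two top coefficients.\<close>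
  have L_pow: "L ^ (k + 1) = smult (\<delta> ^ (k + 1)) (monic_with_roots k (\<lambda>_. - \<tau>' / \<delta>))"
    unfolding L_alt smult_power monic_with_roots_def by simp
  have M0: "M 0 \<noteq> 0"
  proof
    assume "M 0 = 0"
    hence "M i = 0" if "i \<le> k" for i using M[OF that] by simp
    hence "A $$ (i, j) = 0" if "i \<le> k" "j \<le> k" for i j
      using M_value[of j i] that \<alpha> c_nonzero[of j] by auto
    hence "A *\<^sub>v unit_vec (k + 1) 0 = 0\<^sub>v (k + 1)" using A(1) by (intro eq_vecI) auto
    thus False using mult_mat_vec_eq_0_iff[OF A unit_vec_carrier, of 0] by simp
  qed
  have gk: "gexp k k = k + 1" by (simp add: gexp_def)
  have "degree (M k) \<le> k + 1"
    unfolding M_def by (intro degree_sum_le order_trans[OF degree_smult_le]) (simp_all add: degree_dual)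
  moreover have "degree (M k) = degree (M 0) + (k + 1)"
  proof -
    have d: "degree (L ^ (k + 1)) = k + 1" unfolding L_pow using \<delta>_nonzero by (simp add: degree_monic_with_roots)
    hence "L ^ (k + 1) \<noteq> 0" by (metis add_is_0 degree_0 one_neq_zero)
    thus ?thesis using M[of k] d M0 unfolding gk by (simp only: degree_mult_eq order_refl simp_thms)
  qed
  ultimately have "degree (M 0) = 0" by simp
  then obtain m where m: "M 0 = [:m:]" by (rule degree_eq_zeroE)
  have m0: "m \<noteq> 0" using m M0 by auto
  have Mk: "M k = smult (m * \<delta> ^ (k + 1)) (monic_with_roots k (\<lambda>_. - \<tau>' / \<delta>))"
    using M[of k] unfolding gk L_pow m by (simp add: mult_ac)
  have "\<tau>' = \<tau>"
  proof -
    have "coeff (M k) k = coeff (M k) (k + 1) * (of_nat (k - 1) * P)"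
      unfolding M_def coeff_sum coeff_smult sum_distrib_right
      by (intro sum.cong refl) (simp only: coeff_dual atMost_iff mult_1_right)
    hence "m * \<delta> ^ (k + 1) * (- (\<Sum>i\<le>k. - \<tau>' / \<delta>)) = m * \<delta> ^ (k + 1) * (of_nat (k - 1) * P)"
      unfolding Mk coeff_smult coeff_monic_with_roots by (simp only: mult_1_right mult.assoc)
    hence "- (\<Sum>i\<le>k. - \<tau>' / \<delta>) = of_nat (k - 1) * P" using m0 \<delta>_nonzero by simp
    hence "of_nat (k + 1) * \<tau>' / \<delta> = of_nat (k - 1) * P" by simp
    moreover have "n * t / d = x \<Longrightarrow> d \<noteq> 0 \<Longrightarrow> n \<noteq> 0 \<Longrightarrow> t = d * x / n" for n t d x :: complex
      by (auto simp: field_simps)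
    ultimately show ?thesis
      unfolding \<tau>_def using \<delta>_nonzero of_nat_k1_nonzero by (metis mult.assoc)
  qed
  hence "A $$ (i, j) = - m * c j ^ 2 / \<alpha> j * q j ^ gexp k i" if ij: "i \<le> k" "j \<le> k" for i j
  proof -
    have "- (A $$ (i, j) * \<alpha> j / c j ^ 2) = m * q j ^ gexp k i"
      unfolding M_value[OF ij(2), symmetric] M[OF ij(1)] m using \<open>\<tau>' = \<tau>\<close> by (simp add: L_def q_def add.commute mult.commute)
    hence "A $$ (i, j) * \<alpha> j / c j ^ 2 = - m * q j ^ gexp k i"
      by (metis minus_minus mult_minus_left)
    thus ?thesis using \<alpha> c_nonzero[OF ij(2)] ij by (simp add: field_simps)
  qed
  hence "A = center_mat k q (\<lambda>j. - m * c j ^ 2 / \<alpha> j)"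
    using A(1) by (intro eq_matI) (auto simp: center_mat_def)
  thus ?thesis using that[of "- m"] m0 by simp
qed

end

lemma basic_cremona_conjugate:
  assumes A: "A \<in> carrier_mat (k + 1) (k + 1)" "invertible_mat A"
    and B: "B \<in> carrier_mat (k + 1) (k + 1)" "invertible_mat B"
    and D: "D \<in> carrier_mat (k + 1) (k + 1)" "invertible_mat D"
    and DA: "invertible_mat (D * A)" and DB: "invertible_mat (D * B)"
  shows "linearly_conjugate k (basic_cremona k (proj_map A) (proj_map B))
    (basic_cremona k (proj_map (D * A)) (proj_map (D * B)))"
  unfolding linearly_conjugate_def
proof (intro bexI ballI)
  show "proj_map D \<in> proj_aut k" unfolding proj_aut_iff using D by blast
  interpret f: cremona_pair k A B by unfold_locales (rule A B)+
  interpret g: cremona_pair k "D * A" "D * B"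
    by unfold_locales (use A B D DA DB in auto)
  fix x assume "x \<in> proj_space k"
  then obtain v where v: "v \<in> carrier_vec (k + 1)" "v \<noteq> 0\<^sub>v (k + 1)" "x = pclass (B *\<^sub>v v)"
    by (rule proj_space_proj_map_cases[OF B])
  have "proj_map D x = pclass (D * B *\<^sub>v v)"
    unfolding v(3) using proj_map_pclass[OF D(1) mult_mat_vec_carrier[OF B(1) v(1)]]
      assoc_mult_mat_vec[OF D(1) B(1) v(1)] by simp
  moreover have "proj_map D (pclass (A *\<^sub>v cremona_vec k v)) = pclass (D * A *\<^sub>v cremona_vec k v)"
    using proj_map_pclass[OF D(1) mult_mat_vec_carrier[OF A(1) cremona_vec_carrier]]
      assoc_mult_mat_vec[OF D(1) A(1) cremona_vec_carrier] by simp
  ultimately show "g.F (proj_map D x) = map_option (proj_map D) (f.F x)"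
    using f.F_value[OF v(1,2)] g.F_value[OF v(1,2)] v(3) by simp
qed

section \<open>Maps with prescribed orbit data\<close>

lemma center_mat_cong:
  "(\<And>j. j \<le> k \<Longrightarrow> p j = p' j) \<Longrightarrow> (\<And>j. j \<le> k \<Longrightarrow> \<beta> j = \<beta>' j) \<Longrightarrow> center_mat k p \<beta> = center_mat k p' \<beta>'"
  unfolding center_mat_def by (rule eq_matI) auto

text \<open>The diagonal automorphism induces multiplication of the parameter by \<open>s\<close> on
  the curve. Conjugation by it absorbs the common factor that the recursion leaves free.\<close>

lemma diag_mult_center_mat:
  "mat_diag (k + 1) (\<lambda>i. s ^ gexp k i) * center_mat k p \<beta> = center_mat k (\<lambda>j. s * p j) \<beta>"
  unfolding mat_diag_mult_left[OF center_mat_carrier]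
  by (rule eq_matI) (auto simp: center_mat_def power_mult_distrib)

lemma diag_invertible:
  fixes s :: complex
  assumes "s \<noteq> 0"
  shows "invertible_mat (mat_diag (k + 1) (\<lambda>i. s ^ gexp k i))"
proof (rule invertible_matI_left)
  show "mat_diag (k + 1) (\<lambda>i. inverse s ^ gexp k i) * mat_diag (k + 1) (\<lambda>i. s ^ gexp k i) = 1\<^sub>m (k + 1)"
    unfolding mat_diag_diag using assms
    by (intro eq_matI) (auto simp: mat_diag_def simp flip: power_mult_distrib)
qed (simp_all only: mat_diag_dim)

lemma orbit_point_Suc: "orbit_point F (Suc m) x = Option.bind (orbit_point F m x) F"
  by (simp add: orbit_point_def)

context curve_map
begin

lemma orbit_on_curve:
  assumes "\<And>i. i < m \<Longrightarrow> ((\<lambda>t. \<delta> * t + \<tau>) ^^ i) t \<notin> p ` {..k}"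
  shows "orbit_point F m (\<gamma> k t) = Some (\<gamma> k (((\<lambda>t. \<delta> * t + \<tau>) ^^ m) t))"
  using assms
proof (induction m)
  case 0
  show ?case by (simp add: orbit_point_def)
next
  case (Suc m)
  thus ?case using F_\<gamma>[of "((\<lambda>t. \<delta> * t + \<tau>) ^^ m) t"] by (simp add: orbit_point_Suc)
qed

lemma proj_map_TM: "j \<le> k \<Longrightarrow> proj_map TM (coord_point k j) = \<gamma> k (p j)"
  by (rule center_mat_coord_point) auto

lemma proj_map_SM: "j \<le> k \<Longrightarrow> proj_map SM (coord_point k j) = \<gamma> k (q j)"
  by (rule center_mat_coord_point) (auto simp: c_nonzero)

lemma realizes_iff:
  "realizes k n \<delta> (proj_map SM) (proj_map TM) \<longleftrightarrow>
    (\<forall>j<k. q j = p (j + 1)) \<and>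
    orbit_point F (n - 1) (\<gamma> k (q k)) = Some (\<gamma> k (p 0)) \<and>
    (\<forall>j<n - 1. \<exists>x. orbit_point F j (\<gamma> k (q k)) = Some x \<and> x \<notin> indeterminacy k F)"
proof -
  have "proj_map SM \<in> proj_aut k" "proj_map TM \<in> proj_aut k"
    unfolding proj_aut_iff using A B by blast+
  moreover have "properly_fixes_curve k (proj_map SM) (proj_map TM)"
    using proper_transform_curve
    by (auto simp: properly_fixes_curve_def centered_on_curve_def curve_reg_def proj_map_TM)
  moreover have "(\<forall>j<k. proj_map SM (coord_point k j) = proj_map TM (coord_point k (j + 1))) \<longleftrightarrow>
      (\<forall>j<k. q j = p (j + 1))"
    using \<gamma>_inj[OF k] by (auto simp: proj_map_SM proj_map_TM)
  ultimately show ?thesis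
    unfolding realizes_def Let_def using F_has_multiplier by (simp add: proj_map_SM proj_map_TM)
qed

end

lemma realizesD:
  assumes k: "2 \<le> k" and re: "realizes k n \<delta> S T"
    and T: "\<forall>j\<le>k. T (coord_point k j) = \<gamma> k (p j)"
  shows "curve_map k p \<delta>"
    and "\<exists>\<alpha> m. (\<forall>j\<le>k. \<alpha> j \<noteq> 0) \<and> m \<noteq> 0 \<and>
      S = proj_map (center_mat k (curve_map.q k p \<delta>) (\<lambda>j. m * curve_centers.c k p j ^ 2 / \<alpha> j)) \<and>
      T = proj_map (center_mat k p \<alpha>)"
    and "\<forall>j<k. curve_map.q k p \<delta> j = p (j + 1)"
proof -
  from re have "S \<in> proj_aut k" "T \<in> proj_aut k" and mult: "has_multiplier k (basic_cremona k S T) \<delta>"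
    and a: "\<forall>j<k. S (coord_point k j) = T (coord_point k (j + 1))"
    unfolding realizes_def Let_def by blast+
  then obtain A B where MA: "A \<in> carrier_mat (k + 1) (k + 1)" "invertible_mat A" "S = proj_map A"
    and MB: "B \<in> carrier_mat (k + 1) (k + 1)" "invertible_mat B" "T = proj_map B"
    unfolding proj_aut_iff by blast
  obtain \<alpha> where \<alpha>: "\<forall>j\<le>k. \<alpha> j \<noteq> 0" "B = center_mat k p \<alpha>"
    using center_mat_of_centers[OF MB(1)] T unfolding MB(3) by metis
  show cm: "curve_map k p \<delta>"
    using k center_mat_invertibleD[of k p \<alpha>] MB(2) mult
    by unfold_locales (auto simp: \<alpha>(2) has_multiplier_def)
  interpret curve_map k p \<delta> by (rule cm)
  obtain m where m: "m \<noteq> 0" "A = center_mat k q (\<lambda>j. m * c j ^ 2 / \<alpha> j)"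
    using outer_matrix_determined[OF MA(1,2) \<alpha>(1)] mult unfolding MA(3) MB(3) \<alpha>(2) by blast
  show "\<exists>\<alpha> m. (\<forall>j\<le>k. \<alpha> j \<noteq> 0) \<and> m \<noteq> 0 \<and>
      S = proj_map (center_mat k q (\<lambda>j. m * c j ^ 2 / \<alpha> j)) \<and> T = proj_map (center_mat k p \<alpha>)"
    using \<alpha> m MA(3) MB(3) by blast
  show "\<forall>j<k. q j = p (j + 1)"
  proof (intro allI impI)
    fix j assume j: "j < k"
    have "\<gamma> k (q j) = S (coord_point k j)"
      unfolding MA(3) m(2) using j \<alpha>(1) m(1) c_nonzero[of j] by (subst center_mat_coord_point) auto
    also have "\<dots> = \<gamma> k (p (j + 1))" using a T j by simp
    finally show "q j = p (j + 1)" by (rule \<gamma>_inj[OF k])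
  qed
qed

section \<open>The recursion for the centers and its normalized solution\<close>

locale multiplier_root =
  fixes k n :: nat and \<delta> :: complex
  assumes k: "2 \<le> k" and n: "1 \<le> n"
    and root: "(\<delta> ^ (n + k) - 1) * (\<delta>\<^sup>2 - 1) - \<delta> * (\<delta> ^ (k + 1) - 1) * (\<delta> ^ (n - 1) - 1) = 0"
    and no_unity: "\<not> (\<exists>m::nat. m > 0 \<and> \<delta> ^ m = 1)"
begin

lemma power_neq_1: "0 < m \<Longrightarrow> \<delta> ^ m \<noteq> 1"
  using no_unity by blast

lemma \<delta>_neq: "\<delta> \<noteq> 0" "\<delta> \<noteq> 1"
proof -
  show "\<delta> \<noteq> 0" using root n k by (auto simp: power_0_left)
  show "\<delta> \<noteq> 1" using power_neq_1[of 1] by auto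
qed

text \<open>Fixed by consistency: the recursion contains \<open>P\<close>, which must be the sum of
  its own solution. For \<open>center j = K * (\<delta> ^ j * a - 1) + 1\<close> and
  \<open>P = K * (1 - \<delta>) / \<delta>\<close> this says that \<open>a\<close> times the
  geometric sum is \<open>(\<delta> + 1) / \<delta>\<close>.\<close>

definition a :: complex where "a = (\<delta>\<^sup>2 - 1) / (\<delta> * (\<delta> ^ (k + 1) - 1))"
definition K :: complex where "K = of_nat (k + 1) / of_nat (k - 1)"
definition center :: "nat \<Rightarrow> complex" where
  "center j = \<delta> ^ j * (of_nat (k + 1) / of_nat (k - 1)) * ((\<delta>\<^sup>2 - 1) / (\<delta> * (\<delta> ^ (k + 1) - 1)))
     - 2 / of_nat (k - 1)"

lemma of_nat_nonzero: "(of_nat (k - 1) :: complex) \<noteq> 0" "(of_nat (k + 1) :: complex) \<noteq> 0"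
  using k by (auto simp del: of_nat_Suc of_nat_add)

lemma K_nonzero: "K \<noteq> 0"
  using of_nat_nonzero unfolding K_def by simp

lemma a_nonzero: "a \<noteq> 0"
  using \<delta>_neq power_neq_1[of 2] power_neq_1[of "k + 1"] by (simp add: a_def)

text \<open>Adapted to the fixed point 1 of the map on the curve, whose iteration multiplies
  \<open>t - 1\<close> by powers of \<open>\<delta>\<close>. The recursion for the centers has
  another fixed point, \<open>- 2 / (k - 1) = 1 - K\<close>.\<close>

lemma center_alt: "center j = K * (\<delta> ^ j * a - 1) + 1"
proof -
  have e: "(of_nat (k + 1) :: complex) = of_nat (k - 1) + 2" using k by (simp add: of_nat_diff)
  define x :: complex where "x = 2 / of_nat (k - 1)"
  have "K = 1 + x"
    unfolding K_def e add_divide_distrib x_def using of_nat_nonzero(1) by simp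
  moreover have "center j = \<delta> ^ j * K * a - x" by (simp only: center_def K_def a_def x_def)
  ultimately show ?thesis by (simp add: algebra_simps)
qed

lemma sum_center: "(\<Sum>j\<le>k. center j) = K * (1 - \<delta>) / \<delta>"
proof -
  have "(1 - \<delta>) * (\<Sum>j\<le>k. \<delta> ^ j) = 1 - \<delta> ^ (k + 1)"
    using one_diff_power_eq[of \<delta> "k + 1"] by (simp add: lessThan_Suc_atMost)
  hence "(\<Sum>j\<le>k. \<delta> ^ j) = (\<delta> ^ (k + 1) - 1) / (\<delta> - 1)"
    using \<delta>_neq by (simp add: field_simps)
  moreover have "\<delta> ^ (k + 1) - 1 \<noteq> 0" using power_neq_1[of "k + 1"] by simp
  ultimately have s: "(\<Sum>j\<le>k. \<delta> ^ j) * a = (\<delta>\<^sup>2 - 1) / (\<delta> * (\<delta> - 1))"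
    using \<delta>_neq by (simp add: a_def)
  have "\<delta>\<^sup>2 - 1 = (\<delta> - 1) * (\<delta> + 1)" by (simp add: power2_eq_square algebra_simps)
  hence s: "(\<Sum>j\<le>k. \<delta> ^ j) * a = (\<delta> + 1) / \<delta>"
    unfolding s using \<delta>_neq by simp
  have K: "(of_nat (k + 1) :: complex) = K * of_nat (k - 1)"
    using of_nat_nonzero by (simp add: K_def)
  have "(\<Sum>j\<le>k. center j) = K * ((\<Sum>j\<le>k. \<delta> ^ j) * a - of_nat (k + 1)) + of_nat (k + 1)"
    unfolding center_alt
    by (simp add: sum.distrib sum_distrib_left sum_distrib_right sum_subtractf right_diff_distrib)
  also have "\<dots> = K * ((\<delta> + 1) / \<delta> - of_nat (k + 1) + of_nat (k - 1))"
    unfolding s by (subst (2) K) (simp add: algebra_simps)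
  also have "(\<delta> + 1) / \<delta> - of_nat (k + 1) + of_nat (k - 1) = (1 - \<delta>) / \<delta>"
    using k \<delta>_neq by (simp add: of_nat_diff field_simps)
  finally show ?thesis by simp
qed

sublocale curve_map k center \<delta>
proof
  show "inj_on center {..k}"
  proof (rule linorder_inj_onI)
    fix i j :: nat assume ij: "i < j"
    show "center i \<noteq> center j"
    proof
      assume "center i = center j"
      hence "\<delta> ^ i = \<delta> ^ j" using K_nonzero a_nonzero by (simp add: center_alt)
      also have "\<dots> = \<delta> ^ i * \<delta> ^ (j - i)" using ij by (simp flip: power_add)
      finally show False using \<delta>_neq power_neq_1[of "j - i"] ij by simp
    qed
  qed auto
  show "(\<Sum>j\<le>k. center j) \<noteq> 0" unfolding sum_center using \<delta>_neq K_nonzero by simp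
qed (use k \<delta>_neq in auto)

lemma P_center: "P = K * (1 - \<delta>) / \<delta>"
  unfolding P_def by (rule sum_center)

lemma \<tau>_center: "\<tau> = 1 - \<delta>"
  unfolding \<tau>_def P_center K_def using \<delta>_neq of_nat_nonzero by simp

text \<open>\<open>center\<close> continues past the index \<open>k\<close>: the parameter
  \<open>q k\<close> of S(e_k) is \<open>center (k + 1)\<close>, which explains the case
  \<open>j = k + 1\<close> of \<open>hitting_eq\<close> in (b).\<close>

lemma q_center: "q j = center (j + 1)"
  unfolding q_def \<tau>_center P_center center_alt using \<delta>_neq by (simp add: field_simps)

lemma iterate: "((\<lambda>t. \<delta> * t + \<tau>) ^^ m) t = \<delta> ^ m * (t - 1) + 1"
proof (induction m)
  case (Suc m)
  have "((\<lambda>t. \<delta> * t + \<tau>) ^^ Suc m) t = \<delta> * ((\<lambda>t. \<delta> * t + \<tau>) ^^ m) t + \<tau>" by simp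
  also have "\<dots> = \<delta> ^ Suc m * (t - 1) + 1" unfolding Suc unfolding \<tau>_center by (simp add: algebra_simps)
  finally show ?case .
qed simp

lemma center_hit_iff:
  "\<delta> ^ r * (center j - 1) + 1 = center 0 \<longleftrightarrow> hitting_eq k r j \<delta>"
proof -
  define d where "d = \<delta> * (\<delta> ^ (k + 1) - 1)"
  have d: "d \<noteq> 0" using \<delta>_neq power_neq_1[of "k + 1"] by (simp add: d_def)
  have "\<delta> ^ r * (center j - 1) + 1 = center 0 \<longleftrightarrow> K * (\<delta> ^ r * (\<delta> ^ j * a - 1)) = K * (a - 1)"
    unfolding center_alt by (simp add: algebra_simps)
  also have "\<dots> \<longleftrightarrow> \<delta> ^ r * (\<delta> ^ j * a - 1) = a - 1" using K_nonzero by simp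
  also have "\<dots> \<longleftrightarrow> (\<delta> ^ (r + j) - 1) * a = \<delta> ^ r - 1"
    by (auto simp: algebra_simps power_add)
  also have "\<dots> \<longleftrightarrow> hitting_eq k r j \<delta>"
    unfolding hitting_eq_def a_def d_def[symmetric] using d by (simp add: divide_simps mult.commute)
  finally show ?thesis .
qed

lemma hits: "hitting_eq k (n - 1) (k + 1) \<delta>"
  using root n by (simp add: hitting_eq_def add.commute)

text \<open>If step \<open>m\<close> lands on center \<open>j\<close>, the remaining
  \<open>n - 1 - m\<close> steps lead from there to center 0. This is a second hitting equation with
  \<open>j \<le> k\<close>, excluded by \<open>hitting_eq_exclusive\<close>.\<close>

lemma orbit_avoids_centers:
  assumes m: "m < n - 1"
  shows "((\<lambda>t. \<delta> * t + \<tau>) ^^ m) (q k) \<notin> center ` {..k}"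
proof
  assume "((\<lambda>t. \<delta> * t + \<tau>) ^^ m) (q k) \<in> center ` {..k}"
  then obtain j where j: "j \<le> k" "\<delta> ^ m * (center (k + 1) - 1) + 1 = center j"
    unfolding iterate q_center by auto
  have e: "\<delta> ^ (n - 1 - m) * \<delta> ^ m = \<delta> ^ (n - 1)" using m by (simp flip: power_add)
  have "\<delta> ^ (n - 1 - m) * (center j - 1) + 1 = \<delta> ^ (n - 1) * (center (k + 1) - 1) + 1"
    unfolding j(2)[symmetric] e[symmetric] by (simp add: mult.assoc)
  also have "\<dots> = center 0" unfolding center_hit_iff by (rule hits)
  finally have "hitting_eq k (n - 1 - m) j \<delta>" unfolding center_hit_iff .
  moreover have "0 < n - 1" "0 < n - 1 - m" using m by auto
  ultimately show False using hitting_eq_exclusive[OF _ hits _ j(1)] no_unity by blast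
qed

lemma realizes_SM_TM: "realizes k n \<delta> (proj_map SM) (proj_map TM)"
  unfolding realizes_iff
proof (intro conjI allI impI)
  have orbit: "orbit_point F m (\<gamma> k (q k)) = Some (\<gamma> k (((\<lambda>t. \<delta> * t + \<tau>) ^^ m) (q k)))"
    if "m \<le> n - 1" for m
    using orbit_on_curve orbit_avoids_centers that by auto
  show "orbit_point F (n - 1) (\<gamma> k (q k)) = Some (\<gamma> k (center 0))"
    using orbit[of "n - 1"] hits unfolding iterate q_center center_hit_iff[symmetric] by simp
  show "\<exists>x. orbit_point F j (\<gamma> k (q k)) = Some x \<and> x \<notin> indeterminacy k F" if "j < n - 1" for j
    using orbit[of j] that orbit_avoids_centers[OF that] by (auto simp: \<gamma>_indeterminacy_iff)
qed (simp add: q_center)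

lemma normalized_iff:
  "normalized_centers k \<delta> T \<longleftrightarrow> (\<forall>j\<le>k. T (coord_point k j) = \<gamma> k (center j))"
  unfolding normalized_centers_def center_def ..

lemma unique_normalized:
  assumes "realizes k n \<delta> S' T'" "normalized_centers k \<delta> T'"
  shows "basic_cremona k S' T' = F"
proof -
  obtain \<alpha> m where "\<forall>j\<le>k. \<alpha> j \<noteq> 0" "m \<noteq> 0"
    "S' = proj_map (center_mat k q (\<lambda>j. m * c j ^ 2 / \<alpha> j))" "T' = proj_map (center_mat k center \<alpha>)"
    using realizesD(2)[OF k assms(1)] assms(2) unfolding normalized_iff by blast
  thus ?thesis using F_scaled by blast
qed

text \<open>The factor \<open>e\<close> makes the two sums \<open>P\<close> agree, so the
  inhomogeneous terms of the recursions cancel in the difference \<open>d\<close>. This is a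
  geometric sequence with zero sum whose ratio is not a root of unity, hence zero.\<close>

lemma centers_unique_up_to_scaling:
  assumes "curve_map k p \<delta>" and rec: "\<forall>j<k. curve_map.q k p \<delta> j = p (j + 1)"
  shows "\<exists>e. e \<noteq> 0 \<and> (\<forall>j\<le>k. p j = e * center j)"
proof -
  interpret o: curve_map k p \<delta> by (rule assms(1))
  define e where "e = o.P / P"
  have e: "e \<noteq> 0" "o.P = e * P" using o.P_nonzero P_nonzero by (simp_all add: e_def)
  define d where "d j = p j - e * center j" for j
  define w where "w = 2 * \<delta> * P / of_nat (k + 1)"
  have p_Suc: "p (j + 1) = \<delta> * p j - e * w" if "j < k" for j
    using rec that o.q_alt[of j] e(2) by (simp add: w_def)
  have center_Suc: "center (j + 1) = \<delta> * center j - w" for j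
    using q_center[of j] q_alt[of j] by (simp add: w_def)
  have d: "d (j + 1) = \<delta> * d j" if "j < k" for j
    unfolding d_def p_Suc[OF that] center_Suc by (simp add: algebra_simps)
  have dj: "d j = \<delta> ^ j * d 0" if "j \<le> k" for j
    using that by (induction j) (auto simp: d[simplified])
  have "(\<Sum>j\<le>k. d j) = 0"
    unfolding d_def sum_subtractf sum_distrib_left[symmetric] using e(2) by (simp add: o.P_def P_def)
  moreover have "(\<Sum>j\<le>k. d j) = (\<Sum>j\<le>k. \<delta> ^ j * d 0)"
    by (intro sum.cong refl dj) simp
  ultimately have "(\<Sum>j\<le>k. \<delta> ^ j) * d 0 = 0" unfolding sum_distrib_right by simp
  moreover have "(1 - \<delta>) * (\<Sum>j\<le>k. \<delta> ^ j) = 1 - \<delta> ^ (k + 1)"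
    using one_diff_power_eq[of \<delta> "k + 1"] by (simp add: lessThan_Suc_atMost)
  hence "(\<Sum>j\<le>k. \<delta> ^ j) \<noteq> 0" using power_neq_1[of "k + 1"] by auto
  ultimately have d0: "d 0 = 0" by simp
  have "d j = 0" if "j \<le> k" for j unfolding dj[OF that] d0 by simp
  hence "p j = e * center j" if "j \<le> k" for j using that by (simp add: d_def)
  with e(1) show ?thesis by blast
qed

text \<open>The diagonal matrix for \<open>inverse e\<close> moves the centers to their normalized
  position. The constants \<open>c j\<close> change by a common power of \<open>e\<close>, which
  \<open>m'\<close> absorbs, and \<open>F_scaled\<close> removes the remaining scales.\<close>

lemma unique_up_to_conjugacy:
  assumes re: "realizes k n \<delta> S' T'"
  shows "linearly_conjugate k (basic_cremona k S' T') F"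
proof -
  from re have "\<forall>j\<le>k. T' (coord_point k j) \<in> range (\<gamma> k)"
    unfolding realizes_def Let_def properly_fixes_curve_def centered_on_curve_def curve_reg_def by blast
  then obtain p where p: "\<forall>j\<le>k. T' (coord_point k j) = \<gamma> k (p j)" unfolding image_iff by metis
  interpret o: curve_map k p \<delta> by (rule realizesD(1)[OF k re p])
  obtain \<alpha> m where \<alpha>: "\<forall>j\<le>k. \<alpha> j \<noteq> 0" and m: "m \<noteq> 0"
    and S': "S' = proj_map (center_mat k o.q (\<lambda>j. m * o.c j ^ 2 / \<alpha> j))"
    and T': "T' = proj_map (center_mat k p \<alpha>)"
    using realizesD(2)[OF k re p] by blast
  obtain e where e: "e \<noteq> 0" and "\<forall>j\<le>k. p j = e * center j"
    using centers_unique_up_to_scaling[OF o.curve_map_axioms realizesD(3)[OF k re p]] by blast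
  hence pe: "p j = e * center j" if "j \<le> k" for j using that by blast
  have oP: "o.P = e * P" unfolding o.P_def P_def sum_distrib_left using pe by (intro sum.cong) auto
  have oq: "o.q j = e * q j" if "j \<le> k" for j
    unfolding o.q_def q_def o.\<tau>_def \<tau>_def oP pe[OF that] by (simp add: algebra_simps)
  have oc: "o.c j = c j / e ^ (k + 1)" if j: "j \<le> k" for j
  proof -
    have "(\<Prod>i\<in>{..k} - {j}. p j - p i) = (\<Prod>i\<in>{..k} - {j}. e * (center j - center i))"
      using j by (intro prod.cong) (auto simp: pe algebra_simps)
    also have "\<dots> = e ^ k * (\<Prod>i\<in>{..k} - {j}. center j - center i)" using j by (simp add: prod.distrib)
    finally show ?thesis unfolding o.c_def c_def oP by (simp add: field_simps)
  qed
  define D where "D = mat_diag (k + 1) (\<lambda>i. inverse e ^ gexp k i)"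
  define A' where "A' = center_mat k o.q (\<lambda>j. m * o.c j ^ 2 / \<alpha> j)"
  define B' where "B' = center_mat k p \<alpha>"
  define m' where "m' = m / e ^ (2 * (k + 1))"
  have D: "D \<in> carrier_mat (k + 1) (k + 1)" "invertible_mat D"
    unfolding D_def using e by (simp_all only: mat_diag_dim) (intro diag_invertible, simp)
  have inv: "invertible_mat A'" "invertible_mat B'"
    unfolding A'_def B'_def
    by (rule o.im.center_mat_invertible o.center_mat_invertible; use \<alpha> m o.c_nonzero in simp)+
  have DA: "D * A' = center_mat k q (\<lambda>j. m' * c j ^ 2 / \<alpha> j)"
    unfolding D_def A'_def diag_mult_center_mat using e
    by (intro center_mat_cong) (simp_all add: oq oc m'_def power_divide power_mult power_mult_distrib[symmetric] power2_eq_square)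
  have DB: "D * B' = center_mat k center \<alpha>"
    unfolding D_def B'_def diag_mult_center_mat using e by (intro center_mat_cong) (simp_all add: pe)
  have "m' \<noteq> 0" using m e by (simp add: m'_def)
  hence "basic_cremona k (proj_map (D * A')) (proj_map (D * B')) = F"
    unfolding DA DB using F_scaled \<alpha> by blast
  moreover have "linearly_conjugate k (basic_cremona k (proj_map A') (proj_map B'))
      (basic_cremona k (proj_map (D * A')) (proj_map (D * B')))"
  proof (rule basic_cremona_conjugate[OF _ inv(1) _ inv(2) D])
    show "A' \<in> carrier_mat (k + 1) (k + 1)" "B' \<in> carrier_mat (k + 1) (k + 1)"
      unfolding A'_def B'_def by (rule center_mat_carrier)+
    show "invertible_mat (D * A')" unfolding DA
      by (rule im.center_mat_invertible) (use \<alpha> \<open>m' \<noteq> 0\<close> c_nonzero in simp)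
    show "invertible_mat (D * B')" unfolding DB by (rule center_mat_invertible[OF \<alpha>])
  qed
  ultimately show ?thesis unfolding S' T' A'_def B'_def by simp
qed

end

theorem theorem4p5:
  fixes k n :: nat and \<delta> :: complex
  assumes "k \<ge> 2" and "n \<ge> 1"
    and "(\<delta> ^ (n + k) - 1) * (\<delta>\<^sup>2 - 1) - \<delta> * (\<delta> ^ (k + 1) - 1) * (\<delta> ^ (n - 1) - 1) = 0"
    and "\<not> (\<exists>m::nat. m > 0 \<and> \<delta> ^ m = 1)"
  shows "\<exists>S T. realizes k n \<delta> S T \<and> normalized_centers k \<delta> T \<and>
           (\<forall>S' T'. realizes k n \<delta> S' T' \<longrightarrow>
              linearly_conjugate k (basic_cremona k S' T') (basic_cremona k S T)) \<and>
           (\<forall>S' T'. realizes k n \<delta> S' T' \<and> normalized_centers k \<delta> T' \<longrightarrow>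
              basic_cremona k S' T' = basic_cremona k S T)"
proof -
  interpret multiplier_root k n \<delta> by unfold_locales (fact assms)+
  have "normalized_centers k \<delta> (proj_map TM)"
    unfolding normalized_iff using proj_map_TM by blast
  thus ?thesis using realizes_SM_TM unique_normalized unique_up_to_conjugacy by blast
qed

end
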